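(* For every finite field $\mathbb F_q$, every integer $i\ge2$ and every integer $d\ge1$, there is a simple $3$-connected $\mathbb F_q$-representable matroid $M$ such that $Q_M(t)=\sum_jc_jt^j$ has degree exactly $i+d$, its coefficients are positive and strictly decreasing ($c_0>c_1>\cdots>c_{i+d}>0$), and, with $\Delta_j=c_j^2-c_{j-1}c_{j+1}$, one has $\Delta_i<0$ and $\Delta_j>0$ for every other internal index $1\le j<i+d$, $j\ne i$. Such a matroid can be chosen of rank $$(i+d)+40(i+d)^2.$$ Moreover, the failure ratio can be made arbitrarily small without changing the polynomial degree: for every finite field $\mathbb F_q$, all integers $i\ge2$ and $d\ge1$, and every $\varepsilon>0$ there is a simple $3$-connected $\mathbb F_q$-representable matroid $M$ (whose rank need not equal $(i+d)+40(i+d)^2$) such that $Q_M(t)=\sum_jc_jt^j$ has degree exactly $i+d$, $c_0>c_1>\cdots>c_{i+d}>0$, $\Delta_i<0$, $\Delta_j>0$ for every $1\le j<i+d$ with $j\ne i$ (where $\Delta_j=c_j^2-c_{j-1}c_{j+1}$), and $c_i^2/(c_{i-1}c_{i+1})<\varepsilon$.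
   Context: A matroid $M$ with ground set $E$ and rank function $r$ is $3$-connected if it has no $1$- or $2$-separation: for $k\in\{1,2\}$ there is no partition $(A,E\setminus A)$ with $|A|,|E\setminus A|\ge k$ and $r(A)+r(E\setminus A)-r(E)<k$. Matroid polynomials: for a loopless matroid $M$ of rank $r$, let $L(M)$ be its lattice of flats, $M|F$ the restriction to a flat $F$, $M/F$ the contraction, $\mu$ the Möbius function of $L(M)$, and $\chi_M(t)=\sum_{F\in L(M)}\mu(\varnothing,F)t^{r-\operatorname{rk}F}$. The Kazhdan–Lusztig polynomial $P_M$ is determined by: $P_M=1$ if $r=0$; $\deg P_M<r/2$ if $r>0$; and $t^rP_M(t^{-1})=\sum_{F\in L(M)}\chi_{M|F}(t)P_{M/F}(t)$. The (ordinary, unnormalized) inverse Kazhdan–Lusztig polynomial $Q_M$ is determined by $Q_M=1$ if $r=0$, and for $r>0$, $$Q_M=\sum_{\varnothing\ne F\in L(M)}(-1)^{\operatorname{rk}F+1}P_{M|F}\,Q_{M/F}.$$ *)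

theory Defs
  imports Complex_Main "HOL-Computational_Algebra.Polynomial"
begin

datatype 'a matroid = Matroid (ground: "'a set") (rk: "'a set \<Rightarrow> nat")

text \<open>The values of \<open>rk M\<close> outside the power set of the ground set are irrelevant.\<close>

definition is_matroid :: "'a matroid \<Rightarrow> bool" where
  "is_matroid M \<longleftrightarrow>
     finite (ground M) \<and>
     (\<forall>X. X \<subseteq> ground M \<longrightarrow> rk M X \<le> card X) \<and>
     (\<forall>X Y. X \<subseteq> Y \<and> Y \<subseteq> ground M \<longrightarrow> rk M X \<le> rk M Y) \<and>
     (\<forall>X Y. X \<subseteq> ground M \<and> Y \<subseteq> ground M \<longrightarrow>
        rk M (X \<union> Y) + rk M (X \<inter> Y) \<le> rk M X + rk M Y)"

definition matroid_rank :: "'a matroid \<Rightarrow> nat" where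
  "matroid_rank M = rk M (ground M)"

definition indep :: "'a matroid \<Rightarrow> 'a set \<Rightarrow> bool" where
  "indep M X \<longleftrightarrow> X \<subseteq> ground M \<and> rk M X = card X"

definition simple_matroid :: "'a matroid \<Rightarrow> bool" where
  "simple_matroid M \<longleftrightarrow>
     (\<forall>e \<in> ground M. indep M {e}) \<and>
     (\<forall>e \<in> ground M. \<forall>f \<in> ground M. e \<noteq> f \<longrightarrow> indep M {e, f})"

text \<open>The inequality \<open>r(A) + r(E - A) - r(E) < k\<close> is written without subtraction.\<close>

definition has_separation :: "nat \<Rightarrow> 'a matroid \<Rightarrow> bool" where
  "has_separation k M \<longleftrightarrow>
     (\<exists>A. A \<subseteq> ground M \<and> k \<le> card A \<and> k \<le> card (ground M - A) \<and>
          rk M A + rk M (ground M - A) < rk M (ground M) + k)"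

definition three_connected :: "'a matroid \<Rightarrow> bool" where
  "three_connected M \<longleftrightarrow> (\<forall>k \<in> {1, 2}. \<not> has_separation k M)"

text \<open>A representation is a matrix \<open>A\<close> with \<open>m\<close> rows whose columns are indexed by the ground set.
  Linear independence refers to the indexed family of columns, so that equal columns are
  dependent.\<close>

definition representable :: "'k::field itself \<Rightarrow> 'a matroid \<Rightarrow> bool" where
  "representable (K :: 'k itself) M \<longleftrightarrow>
     (\<exists>(m::nat) (A :: nat \<Rightarrow> 'a \<Rightarrow> 'k). \<forall>X. X \<subseteq> ground M \<longrightarrow>
        (indep M X \<longleftrightarrow>
          (\<forall>c :: 'a \<Rightarrow> 'k. (\<forall>i<m. (\<Sum>e\<in>X. c e * A i e) = 0) \<longrightarrow> (\<forall>e\<in>X. c e = 0))))"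

definition flats :: "'a matroid \<Rightarrow> 'a set set" where
  "flats M = {F. F \<subseteq> ground M \<and> (\<forall>e \<in> ground M - F. rk M F < rk M (insert e F))}"

definition restriction :: "'a matroid \<Rightarrow> 'a set \<Rightarrow> 'a matroid" where
  "restriction M F = Matroid F (rk M)"

definition contraction :: "'a matroid \<Rightarrow> 'a set \<Rightarrow> 'a matroid" where
  "contraction M F = Matroid (ground M - F) (\<lambda>X. rk M (X \<union> F) - rk M F)"

text \<open>The Moebius function of a family \<open>L\<close> of finite sets ordered by inclusion; the finiteness test
  only serves termination.\<close>

function moebius :: "'a set set \<Rightarrow> 'a set \<Rightarrow> 'a set \<Rightarrow> int" where
  "moebius L A B =
     (if A = B then 1
      else if A \<subset> B \<and> finite B then - (\<Sum>C \<in> {C \<in> L. A \<subseteq> C \<and> C \<subset> B}. moebius L A C)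
      else 0)"
  by auto
termination
  by (relation "measure (\<lambda>(L, A, B). card B)") (auto intro: psubset_card_mono)

declare moebius.simps [simp del]

definition char_poly :: "'a matroid \<Rightarrow> int poly" where
  "char_poly M =
     (\<Sum>F \<in> flats M. monom (moebius (flats M) {} F) (matroid_rank M - rk M F))"

text \<open>For \<open>degree p \<le> r\<close> this is the polynomial \<open>t ^ r * p (1 / t)\<close>.\<close>

definition reverse_poly :: "nat \<Rightarrow> int poly \<Rightarrow> int poly" where
  "reverse_poly r p = monom 1 (r - degree p) * reflect_poly p"

text \<open>The Kazhdan--Lusztig polynomial and its (unnormalized) inverse are meaningful for loopless
  matroids only. The defining identity of the former has \<open>P\<^sub>M\<close> itself as the factor
  belonging to the flat \<open>{}\<close>, since contracting \<open>{}\<close> does nothing; this occurrence is the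
  unknown \<open>p\<close>. The value 0 on infinite ground sets only serves termination.\<close>

function KL_poly :: "'a matroid \<Rightarrow> int poly" where
  "KL_poly M =
     (if infinite (ground M) then 0
      else if matroid_rank M = 0 then 1
      else (THE p. 2 * degree p < matroid_rank M \<and>
             reverse_poly (matroid_rank M) p =
               (\<Sum>F \<in> flats M. char_poly (restriction M F) *
                  (if F = {} then p else KL_poly (contraction M F)))))"
  by auto
termination
  by (relation "measure (\<lambda>M. card (ground M))")
     (auto simp: contraction_def flats_def intro!: psubset_card_mono)

declare KL_poly.simps [simp del]

function inverse_KL_poly :: "'a matroid \<Rightarrow> int poly" where
  "inverse_KL_poly M =
     (if infinite (ground M) then 0
      else if matroid_rank M = 0 then 1
      else (\<Sum>F \<in> flats M - {{}}. (-1) ^ (rk M F + 1) *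
              KL_poly (restriction M F) * inverse_KL_poly (contraction M F)))"
  by auto
termination
  by (relation "measure (\<lambda>M. card (ground M))")
     (auto simp: contraction_def flats_def intro!: psubset_card_mono)

declare inverse_KL_poly.simps [simp del]

definition log_concavity_defect :: "int poly \<Rightarrow> nat \<Rightarrow> int" where
  "log_concavity_defect p j = (coeff p j)\<^sup>2 - coeff p (j - 1) * coeff p (j + 1)"

definition fails_log_concavity_only_at :: "int poly \<Rightarrow> nat \<Rightarrow> nat \<Rightarrow> bool" where
  "fails_log_concavity_only_at p n i \<longleftrightarrow>
     degree p = n \<and>
     (\<forall>j<n. coeff p (j + 1) < coeff p j) \<and> 0 < coeff p n \<and>
     log_concavity_defect p i < 0 \<and>
     (\<forall>j. 1 \<le> j \<and> j < n \<and> j \<noteq> i \<longrightarrow> 0 < log_concavity_defect p j)"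

end

theory Submission
  imports Defs "HOL-Library.Function_Algebras" "HOL-Library.FuncSet"
begin

text \<open>
  Let \<open>M\<close> consist of points of \<open>PG(r - 1, q)\<close>. For a subspace \<open>Z\<close> of dimension \<open>z\<close> containing
  a part of rank \<open>\<rho>\<close> of \<open>M\<close>, put \<open>S(Z) = (- t) ^ (z - \<rho>) Q(M | Z)\<close>. This turns \<open>Q\<close> into a
  function on the modular lattice of all subspaces, and the Kazhdan--Lusztig duality says exactly that
  its inverse Moebius transform there takes values \<open>p(K)\<close> that are palindromic of degree
  \<open>dim K\<close>. Together with \<open>deg Q < rank / 2\<close> this forces \<open>p(K)\<close> to vanish in degree \<open>j\<close> unless
  \<open>K\<close> contains a \<open>j\<close>-dimensional subspace missing \<open>M\<close>, and to have coefficient \<open>\<plusminus> 1\<close> if there is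
  exactly one and \<open>dim K \<le> 2 j\<close>. Summing over \<open>K\<close>, the coefficient of \<open>t ^ y\<close> in \<open>Q(M)\<close> is, up to a
  relative error of order \<open>q ^ (- r)\<close>,
  \<open>q ^ (r choose 2 - y r)\<close> times \<open>A(y) / ((1 - q ^ (-1)) \<dots> (1 - q ^ (- y)))\<close>, where
  \<open>A(y)\<close> is the number of \<open>y\<close>-dimensional subspaces missing \<open>M\<close>.

  It remains to delete from the projective space a set whose numbers \<open>A(y)\<close> are strongly log-concave
  except at \<open>i\<close>: an \<open>n\<close>-dimensional subspace, where \<open>n = i + d\<close>, together with an affine cone
  containing an enormous number of subspaces of dimension up to \<open>i - 1\<close> but none of dimension \<open>i\<close>.
\<close>

section \<open>Kazhdan--Lusztig polynomials of the minors of a matroid\<close>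

text \<open>The factor attached to a subspace whose elements do not span it makes a flat
  \<open>G\<close> contribute with \<open>t\<close> to the power \<open>dim Z - rk M G\<close> in
  every \<open>Z\<close> above it. The sum over all \<open>Z\<close> between the span of
  \<open>G\<close> and \<open>K\<close> is symmetric because Gaussian binomials are; palindromicity
  comes from this. The degree bound on the inverse polynomial controls only the upper half of each
  palindromic polynomial, so arguments about it treat degrees at least \<open>dim K / 2\<close> and
  reflect the others.

  When c_j^2 is compared with c_(j-1) c_(j+1), the geometric factor cancels. What is left is A(y)
  times a q-factorial factor that changes each ratio by a factor between 1 and 3/2, even for
  \<open>q = 2\<close>; gaps of a factor 2 in A survive it together with relative errors of 1/32.
  The cone raises A(y) only for 0 < y < i, so its size drives the failure ratio to 0 and leaves the
  degree alone. The deleted set lies in a subspace of codimension at least 3: then two proper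
  subspaces never hold all remaining points, which yields 3-connectedness. The 40 in the rank covers
  the exponents of the error estimate with some slack.\<close>

definition rev_poly :: "nat \<Rightarrow> int poly \<Rightarrow> int poly" where
  "rev_poly n p = (\<Sum>j\<le>n. monom (coeff p (n - j)) j)"

lemma coeff_rev_poly: "coeff (rev_poly n p) j = (if j \<le> n then coeff p (n - j) else 0)"
  by (simp add: rev_poly_def coeff_sum if_distrib cong: if_cong)

lemma rev_poly_add: "rev_poly n (p + p') = rev_poly n p + rev_poly n p'"
  by (rule poly_eqI) (simp add: coeff_rev_poly)

lemma rev_poly_sum: "rev_poly n (sum f A) = (\<Sum>x\<in>A. rev_poly n (f x))"
  by (rule poly_eqI) (simp add: coeff_rev_poly coeff_sum)

lemma coeff_monom_1_mult: "coeff (monom 1 k * p) j = (if k \<le> j then coeff p (j - k) else (0::int))"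
  by (simp add: coeff_monom_mult)

lemma rev_poly_monom_mult:
  assumes "a \<le> n" "degree p \<le> n - a"
  shows "rev_poly n (monom 1 a * p) = rev_poly (n - a) p"
proof (rule poly_eqI)
  fix j
  show "coeff (rev_poly n (monom 1 a * p)) j = coeff (rev_poly (n - a) p) j"
    using assms
    by (auto simp: coeff_rev_poly coeff_monom_1_mult intro!: coeff_eq_0 arg_cong[of _ _ "coeff p"])
qed

lemma rev_poly_mult:
  assumes "degree p \<le> m" "degree p' \<le> n"
  shows "rev_poly (m + n) (p * p') = rev_poly m p * rev_poly n p'"
proof (rule poly_eqI)
  fix j
  show "coeff (rev_poly (m + n) (p * p')) j = coeff (rev_poly m p * rev_poly n p') j"
  proof (cases "j \<le> m + n")
    case True
    have 1: "(\<Sum>i\<le>m + n - j. coeff p i * coeff p' (m + n - j - i)) =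
        (\<Sum>i\<in>{i. i \<le> m \<and> i \<le> m + n - j \<and> m + n - j - i \<le> n}. coeff p i * coeff p' (m + n - j - i))"
    proof (rule sum.mono_neutral_right)
      show "\<forall>i\<in>{..m + n - j} - {i. i \<le> m \<and> i \<le> m + n - j \<and> m + n - j - i \<le> n}.
              coeff p i * coeff p' (m + n - j - i) = 0"
      proof
        fix i assume "i \<in> {..m + n - j} - {i. i \<le> m \<and> i \<le> m + n - j \<and> m + n - j - i \<le> n}"
        then have "m < i \<or> n < m + n - j - i" by auto
        then show "coeff p i * coeff p' (m + n - j - i) = 0"
          using assms coeff_eq_0 by (metis le_less_trans mult_eq_0_iff)
      qed
    qed auto
    have 2: "(\<Sum>i\<le>j. coeff (rev_poly m p) i * coeff (rev_poly n p') (j - i)) =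
        (\<Sum>i\<in>{i. i \<le> j \<and> i \<le> m \<and> j - i \<le> n}. coeff p (m - i) * coeff p' (n - (j - i)))"
      by (subst sum.mono_neutral_right[of _ "{i. i \<le> j \<and> i \<le> m \<and> j - i \<le> n}"])
        (auto simp: coeff_rev_poly)
    have 3: "(\<Sum>i\<in>{i. i \<le> j \<and> i \<le> m \<and> j - i \<le> n}. coeff p (m - i) * coeff p' (n - (j - i))) =
       (\<Sum>i\<in>{i. i \<le> m \<and> i \<le> m + n - j \<and> m + n - j - i \<le> n}. coeff p i * coeff p' (m + n - j - i))"
      by (rule sum.reindex_bij_witness[of _ "\<lambda>i. m - i" "\<lambda>i. m - i"])
        (use True in \<open>auto intro!: arg_cong2[of _ _ _ _ "(*)"] arg_cong[of _ _ "coeff p'"]\<close>)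
    show ?thesis
      using True 1 2 3 by (simp add: coeff_rev_poly coeff_mult)
  next
    case False
    have "coeff (rev_poly m p) i * coeff (rev_poly n p') (j - i) = 0" if "i \<le> j" for i
      using False that by (auto simp: coeff_rev_poly)
    then have "coeff (rev_poly m p * rev_poly n p') j = 0"
      unfolding coeff_mult by (intro sum.neutral) auto
    then show ?thesis using False by (simp add: coeff_rev_poly[of "m + n"])
  qed
qed

text \<open>\<open>reverse_poly\<close> refers to the degree of its argument and is not additive.
  \<open>rev_poly\<close> depends linearly on the coefficients, so all work is done with it and
  carried over here.\<close>

lemma reverse_poly_eq_rev_poly:
  assumes "degree p \<le> n"
  shows "reverse_poly n p = rev_poly n p"
proof (rule poly_eqI)
  fix j
  have "coeff (reflect_poly p) (j - (n - degree p)) = coeff p (n - j)" if "n - degree p \<le> j" "j \<le> n"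
    using that assms by (auto simp: coeff_reflect_poly intro!: arg_cong[of _ _ "coeff p"])
  moreover have "coeff (reflect_poly p) (j - (n - degree p)) = 0" if "n < j"
    using that assms by (auto simp: coeff_reflect_poly)
  ultimately show "coeff (reverse_poly n p) j = coeff (rev_poly n p) j"
    using assms by (auto simp: reverse_poly_def coeff_rev_poly coeff_monom_1_mult coeff_eq_0 not_le)
qed

text \<open>Reversal pairs the degrees \<open>j\<close> and \<open>n - j\<close>. Each lower
  coefficient of \<open>p\<close> is free to cancel the asymmetry of \<open>T\<close> on one such
  pair; a middle degree is paired with itself and is symmetric already.\<close>

lemma ex1_symmetric_completion:
  assumes "degree T \<le> n" "0 < n"
  obtains p where "2 * degree p < n" "rev_poly n (p + T) = p + T"
proof -
  define p where "p = (\<Sum>j\<in>{j. 2 * j < n}. monom (coeff T (n - j) - coeff T j) j)"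
  have fin: "finite {j. 2 * j < n}" by (rule finite_subset[of _ "{..n}"]) auto
  have c: "coeff p j = (if 2 * j < n then coeff T (n - j) - coeff T j else 0)" for j
    using fin by (simp add: p_def coeff_sum if_distrib cong: if_cong)
  have "degree p \<le> (n - 1) div 2"
    by (rule degree_le) (use c in auto)
  then have 1: "2 * degree p < n" using assms(2) by linarith
  have "rev_poly n (p + T) = p + T"
  proof (rule poly_eqI)
    fix j
    show "coeff (rev_poly n (p + T)) j = coeff (p + T) j"
    proof (cases "j \<le> n")
      case True
      then consider "2 * j < n" | "2 * j > n" | "2 * j = n" by linarith
      then show ?thesis
      proof cases
        case 3
        then have "n - j = j" by simp
        then show ?thesis using True by (simp add: coeff_rev_poly)
      qed (use True in \<open>auto simp: coeff_rev_poly c\<close>)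
    next
      case False
      then show ?thesis using assms(1) by (auto simp: coeff_rev_poly c coeff_eq_0)
    qed
  qed
  with 1 that show ?thesis by blast
qed

text \<open>The reversal of a polynomial of degree below \<open>n / 2\<close> has no terms below
  \<open>n / 2\<close>, so \<open>p\<close> can be read off the lower half of
  \<open>rev_poly n p - p\<close>.\<close>

lemma symmetric_completion_unique:
  assumes "2 * degree p < n" "2 * degree p' < n" "rev_poly n p - p = rev_poly n p' - p'"
  shows "p = p'"
proof (rule poly_eqI)
  fix j
  show "coeff p j = coeff p' j"
  proof (cases "2 * j < n")
    case True
    have "coeff (rev_poly n p - p) j = coeff (rev_poly n p' - p') j" using assms(3) by simp
    moreover have "coeff p (n - j) = 0" "coeff p' (n - j) = 0"
      using True assms by (auto intro!: coeff_eq_0)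
    ultimately show ?thesis using True by (simp add: coeff_rev_poly)
  next
    case False
    then show ?thesis using assms coeff_eq_0[of p j] coeff_eq_0[of p' j] by simp
  qed
qed

lemma sum_const_poly: "(\<Sum>x\<in>A. [:f x:]) = [:\<Sum>x\<in>A. f x:]"
  by (induction A rule: infinite_finite_induct) auto

section \<open>Moebius inversion over families of finite sets\<close>

lemma moebius_sum:
  assumes "finite L" "A \<in> L" "B \<in> L" "A \<subseteq> B" "finite B"
  shows "(\<Sum>C \<in> {C \<in> L. A \<subseteq> C \<and> C \<subseteq> B}. moebius L A C) = (if A = B then 1 else 0)"
proof (cases "A = B")
  case True
  then have "{C \<in> L. A \<subseteq> C \<and> C \<subseteq> B} = {A}" using assms by auto
  then show ?thesis using True by (simp add: moebius.simps)
next
  case False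
  have eq: "{C \<in> L. A \<subseteq> C \<and> C \<subseteq> B} = insert B {C \<in> L. A \<subseteq> C \<and> C \<subset> B}" using assms by auto
  have "moebius L A B = - (\<Sum>C \<in> {C \<in> L. A \<subseteq> C \<and> C \<subset> B}. moebius L A C)"
    using False assms by (subst moebius.simps) auto
  then show ?thesis unfolding eq using False assms by (subst sum.insert) auto
qed

text \<open>The recursion looks only at members strictly below \<open>B\<close>. Hence an interval
  of flats and the family of all flats above its lower end have the same Moebius values.\<close>

lemma moebius_cong:
  assumes "\<And>C. C \<subset> B \<Longrightarrow> C \<in> L \<longleftrightarrow> C \<in> L'"
  shows "moebius L A B = moebius L' A B"
  using assms
proof (induction "card B" arbitrary: B rule: less_induct)
  case less
  show ?case
  proof (cases "A \<noteq> B \<and> A \<subset> B \<and> finite B")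
    case True
    have eq: "{C \<in> L. A \<subseteq> C \<and> C \<subset> B} = {C \<in> L'. A \<subseteq> C \<and> C \<subset> B}" using less.prems by auto
    have "moebius L A C = moebius L' A C" if "C \<in> {C \<in> L. A \<subseteq> C \<and> C \<subset> B}" for C
      using that True less.prems by (intro less.hyps) (auto intro: psubset_card_mono)
    then have "(\<Sum>C \<in> {C \<in> L. A \<subseteq> C \<and> C \<subset> B}. moebius L A C) =
        (\<Sum>C \<in> {C \<in> L'. A \<subseteq> C \<and> C \<subset> B}. moebius L' A C)" unfolding eq by simp
    then show ?thesis using True by (simp add: moebius.simps)
  next
    case False
    then show ?thesis by (auto simp: moebius.simps)
  qed
qed


text \<open>Associativity in the incidence algebra gives \<open>(Q * P) * Q = Q\<close>. By
  induction, all terms of this product below \<open>H\<close> vanish apart from the one at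
  \<open>A\<close>, and the unit diagonal of \<open>Q\<close> then isolates the value of
  \<open>Q * P\<close> at \<open>H\<close>.\<close>

lemma mult_inverse_commute:
  fixes P Q :: "'a set \<Rightarrow> 'a set \<Rightarrow> 'b::comm_ring_1"
  assumes "finite L" "A \<in> L"
    and unit: "\<And>F. F \<in> L \<Longrightarrow> Q F F = 1"
    and PQ: "\<And>F H. F \<in> L \<Longrightarrow> H \<in> L \<Longrightarrow> F \<subseteq> H \<Longrightarrow>
      (\<Sum>G \<in> {G \<in> L. F \<subseteq> G \<and> G \<subseteq> H}. P F G * Q G H) = (if F = H then 1 else 0)"
    and "H \<in> L" "A \<subseteq> H" "finite H"
  shows "(\<Sum>G \<in> {G \<in> L. A \<subseteq> G \<and> G \<subseteq> H}. Q A G * P G H) = (if A = H then 1 else 0)"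
  using \<open>H \<in> L\<close> \<open>A \<subseteq> H\<close> \<open>finite H\<close>
proof (induction "card H" arbitrary: H rule: less_induct)
  case less
  define h where "h G = (\<Sum>B \<in> {B \<in> L. A \<subseteq> B \<and> B \<subseteq> G}. Q A B * P B G)" for G
  have "(\<Sum>G \<in> {G \<in> L. A \<subseteq> G \<and> G \<subseteq> H}. h G * Q G H) =
      (\<Sum>G \<in> {G \<in> L. A \<subseteq> G \<and> G \<subseteq> H}. \<Sum>B \<in> {B \<in> {B \<in> L. A \<subseteq> B \<and> B \<subseteq> H}. B \<subseteq> G}. Q A B * P B G * Q G H)"
    unfolding h_def sum_distrib_right by (intro sum.cong refl) auto
  also have "\<dots> = (\<Sum>B \<in> {B \<in> L. A \<subseteq> B \<and> B \<subseteq> H}. \<Sum>G \<in> {G \<in> {G \<in> L. A \<subseteq> G \<and> G \<subseteq> H}. B \<subseteq> G}. Q A B * P B G * Q G H)"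
    by (rule sum.swap_restrict) (use assms(1) in auto)
  also have "\<dots> = (\<Sum>B \<in> {B \<in> L. A \<subseteq> B \<and> B \<subseteq> H}. Q A B * (\<Sum>G \<in> {G \<in> L. B \<subseteq> G \<and> G \<subseteq> H}. P B G * Q G H))"
    unfolding sum_distrib_left by (intro sum.cong refl) (auto simp: mult.assoc)
  also have "\<dots> = (\<Sum>B \<in> {B \<in> L. A \<subseteq> B \<and> B \<subseteq> H}. if B = H then Q A B else 0)"
    using less.prems by (intro sum.cong refl) (auto simp: PQ)
  also have "\<dots> = Q A H"
    using less.prems assms(1) by (subst sum.delta) auto
  finally have 1: "(\<Sum>G \<in> {G \<in> L. A \<subseteq> G \<and> G \<subseteq> H}. h G * Q G H) = Q A H" .
  have eq: "{G \<in> L. A \<subseteq> G \<and> G \<subseteq> H} = insert H {G \<in> L. A \<subseteq> G \<and> G \<subset> H}" using less.prems by auto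
  have "h G = (if A = G then 1 else 0)" if "G \<in> L" "A \<subseteq> G" "G \<subset> H" for G
    unfolding h_def using that less.prems
    by (intro less.hyps) (auto intro: psubset_card_mono finite_subset)
  then have "(\<Sum>G \<in> {G \<in> L. A \<subseteq> G \<and> G \<subset> H}. h G * Q G H) =
      (\<Sum>G \<in> {G \<in> L. A \<subseteq> G \<and> G \<subset> H}. if G = A then Q A H else 0)"
    by (intro sum.cong refl) auto
  also have "\<dots> = (if A \<subset> H then Q A H else 0)"
    using assms(1,2) by (subst sum.delta) auto
  finally have "h H * Q H H = (if A = H then Q A H else 0)"
    using 1 less.prems assms(1) unfolding eq by (subst (asm) sum.insert) (auto split: if_splits)
  then show ?case using unit[OF less.prems(1)] by (auto simp: h_def)
qed

lemma flat_subset: "F \<in> flats M \<Longrightarrow> F \<subseteq> ground M"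
  by (auto simp: flats_def)

text \<open>The rank hypothesis makes the iterated truncated subtractions exact.\<close>

lemma contraction_contraction:
  assumes "rk M F \<le> rk M (F \<union> G)" "F \<inter> G = {}"
  shows "contraction (contraction M F) G = contraction M (F \<union> G)"
  using assms by (auto simp: contraction_def fun_eq_iff ac_simps)

section \<open>Minors indexed by pairs of flats\<close>

locale loopless_matroid =
  fixes M :: "'a matroid"
  assumes is_matroid: "is_matroid M" and empty_flat: "{} \<in> flats M"
begin

abbreviation "L \<equiv> flats M"
abbreviation "r \<equiv> rk M"
abbreviation "interval F H \<equiv> {G \<in> L. F \<subseteq> G \<and> G \<subseteq> H}"
definition "minor F H = contraction (restriction M H) F"
definition "P F H = KL_poly (minor F H)"
definition "Q F H = inverse_KL_poly (minor F H)"
definition "chi F H = char_poly (minor F H)"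
text \<open>The family is cut off below at \<open>F\<close> but not above at \<open>H\<close>, so
  that one function serves every minor with lower end \<open>F\<close>.\<close>

definition "mu F H = moebius ((\<lambda>G. G - F) ` {G \<in> L. F \<subseteq> G}) {} (H - F)"

lemma finite_ground: "finite (ground M)"
  using is_matroid by (simp add: is_matroid_def)

lemma finite_flats [simp]: "finite L"
  by (rule finite_subset[of _ "Pow (ground M)"]) (auto simp: flats_def finite_ground)

lemma finite_flat: "F \<in> L \<Longrightarrow> finite F"
  using finite_ground flat_subset finite_subset by metis

lemma rank_mono: "A \<subseteq> B \<Longrightarrow> B \<subseteq> ground M \<Longrightarrow> r A \<le> r B"
  using is_matroid by (simp add: is_matroid_def)

lemma rank_submodular: "A \<subseteq> ground M \<Longrightarrow> B \<subseteq> ground M \<Longrightarrow> r (A \<union> B) + r (A \<inter> B) \<le> r A + r B"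
  using is_matroid by (simp add: is_matroid_def)

lemma rank_empty [simp]: "r {} = 0"
  using is_matroid unfolding is_matroid_def by (metis card.empty empty_subsetI le_zero_eq)

lemma rank_flat_mono: "F \<subseteq> G \<Longrightarrow> G \<in> L \<Longrightarrow> r F \<le> r G"
  by (rule rank_mono) (auto dest: flat_subset)

lemma rank_flat_strict_mono:
  assumes "F \<in> L" "G \<in> L" "F \<subset> G"
  shows "r F < r G"
proof -
  obtain e where e: "e \<in> G - F" using assms by auto
  then have "r F < r (insert e F)" using assms flat_subset[of G M] by (auto simp: flats_def)
  also have "\<dots> \<le> r G" using e assms by (intro rank_flat_mono) auto
  finally show ?thesis .
qed

lemma ground_minor [simp]: "ground (minor F H) = H - F"
  by (simp add: minor_def contraction_def restriction_def)

lemma rk_minor: "rk (minor F H) A = r (A \<union> F) - r F"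
  by (simp add: minor_def contraction_def restriction_def)

lemma matroid_rank_minor: "F \<subseteq> H \<Longrightarrow> matroid_rank (minor F H) = r H - r F"
  by (simp add: matroid_rank_def rk_minor Un_absorb2)

lemma flats_minor:
  assumes "F \<in> L" "H \<in> L" "F \<subseteq> H"
  shows "flats (minor F H) = (\<lambda>G. G - F) ` interval F H"
proof (intro equalityI subsetI)
  fix A assume A: "A \<in> flats (minor F H)"
  then have AH: "A \<subseteq> H - F" by (auto simp: flats_def)
  have HG: "H \<subseteq> ground M" using assms flat_subset by auto
  have fl: "r (A \<union> F) < r (insert e (A \<union> F))" if "e \<in> ground M - (A \<union> F)" for e
  proof (cases "e \<in> H")
    case True
    then have "rk (minor F H) A < rk (minor F H) (insert e A)" using A that by (auto simp: flats_def)
    then show ?thesis by (simp add: rk_minor)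
  next
    case False
    \<comment> \<open>An element outside the flat \<open>H\<close> raises the rank of
      \<open>H\<close>; submodularity passes the increase down to the subset
      \<open>A \<union> F\<close> of \<open>H\<close>.\<close>
    have eq: "H \<union> insert e (A \<union> F) = insert e H" "H \<inter> insert e (A \<union> F) = A \<union> F"
      using AH assms False by auto
    have "r (insert e H) + r (A \<union> F) \<le> r H + r (insert e (A \<union> F))"
      using rank_submodular[of H "insert e (A \<union> F)"] AH HG assms that unfolding eq by auto
    moreover have "r H < r (insert e H)" using assms(2) that False by (auto simp: flats_def)
    ultimately show ?thesis by linarith
  qed
  then have "A \<union> F \<in> interval F H" using AH HG assms by (auto simp: flats_def)
  then show "A \<in> (\<lambda>G. G - F) ` interval F H" using AH by (intro image_eqI[of _ _ "A \<union> F"]) auto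
next
  fix A assume "A \<in> (\<lambda>G. G - F) ` interval F H"
  then obtain G where G: "G \<in> L" "F \<subseteq> G" "G \<subseteq> H" and A: "A = G - F" by auto
  have "rk (minor F H) A < rk (minor F H) (insert e A)" if "e \<in> H - F - A" for e
  proof -
    have "e \<in> ground M - G" using that A G flat_subset[OF assms(2)] by auto
    then have *: "r G < r (insert e G)" using G by (auto simp: flats_def)
    have eq: "A \<union> F = G" "insert e A \<union> F = insert e G" using A G by auto
    show ?thesis unfolding rk_minor eq using * rank_flat_mono[OF G(2,1)] by linarith
  qed
  then show "A \<in> flats (minor F H)" using A G by (auto simp: flats_def)
qed

lemma inj_on_minus: "inj_on (\<lambda>G. G - F) {G. F \<subseteq> G}"
  by (auto simp: inj_on_def)

lemma inj_on_minus_interval: "inj_on (\<lambda>G. G - F) (interval F H)"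
  by (rule inj_on_subset[OF inj_on_minus]) auto

lemma restriction_minor: "G \<subseteq> H \<Longrightarrow> restriction (minor F H) (G - F) = minor F G"
  by (simp add: minor_def contraction_def restriction_def)

lemma contraction_minor:
  assumes "F \<in> L" "G \<in> L" "F \<subseteq> G"
  shows "contraction (minor F H) (G - F) = minor G H"
  unfolding minor_def using assms rank_flat_mono[of F G]
  by (subst contraction_contraction) (auto simp: restriction_def Un_absorb1)

lemma mu_eq:
  assumes "F \<in> L" "H \<in> L" "F \<subseteq> H" "G \<in> interval F H"
  shows "moebius (flats (minor F H)) {} (G - F) = mu F G"
  unfolding mu_def flats_minor[OF assms(1-3)]
proof (rule moebius_cong)
  fix C assume C: "C \<subset> G - F"
  have "A \<subseteq> H" if "C = A - F" "F \<subseteq> A" for A using that C assms by blast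
  then show "C \<in> (\<lambda>G. G - F) ` interval F H \<longleftrightarrow> C \<in> (\<lambda>G. G - F) ` {G \<in> L. F \<subseteq> G}"
    by auto
qed

lemma sum_mu:
  assumes "F \<in> L" "H \<in> L" "F \<subseteq> H"
  shows "(\<Sum>G \<in> interval F H. mu F G) = (if F = H then 1 else 0)"
proof -
  let ?N = "flats (minor F H)"
  have "(\<Sum>G \<in> interval F H. mu F G) = (\<Sum>G \<in> interval F H. moebius ?N {} (G - F))"
    using mu_eq[OF assms] by (intro sum.cong refl) auto
  also have "\<dots> = (\<Sum>C \<in> ?N. moebius ?N {} C)"
    unfolding flats_minor[OF assms] by (subst sum.reindex[OF inj_on_minus_interval]) simp
  also have "\<dots> = (\<Sum>C \<in> {C \<in> ?N. {} \<subseteq> C \<and> C \<subseteq> H - F}. moebius ?N {} C)"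
    by (intro sum.cong refl) (auto simp: flats_def)
  also have "\<dots> = (if {} = H - F then 1 else 0)"
  proof (rule moebius_sum)
    show "{} \<in> ?N" "H - F \<in> ?N" unfolding flats_minor[OF assms] using assms by auto
    show "finite ?N" unfolding flats_minor[OF assms] by simp
  qed (use finite_flat assms in auto)
  finally show ?thesis using assms by auto
qed

lemma chi_eq:
  assumes "F \<in> L" "H \<in> L" "F \<subseteq> H"
  shows "chi F H = (\<Sum>G \<in> interval F H. monom (mu F G) (r H - r G))"
proof -
  have "chi F H = (\<Sum>G \<in> interval F H. monom (moebius (flats (minor F H)) {} (G - F))
      (matroid_rank (minor F H) - rk (minor F H) (G - F)))"
    unfolding chi_def char_poly_def flats_minor[OF assms] by (subst sum.reindex[OF inj_on_minus_interval]) simp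
  also have "\<dots> = (\<Sum>G \<in> interval F H. monom (mu F G) (r H - r G))"
  proof (intro sum.cong refl)
    fix G assume G: "G \<in> interval F H"
    then have "G - F \<union> F = G" by auto
    moreover have "r F \<le> r G" "r G \<le> r H" using G assms by (auto intro: rank_flat_mono)
    ultimately show "monom (moebius (flats (minor F H)) {} (G - F))
      (matroid_rank (minor F H) - rk (minor F H) (G - F)) = monom (mu F G) (r H - r G)"
      using mu_eq[OF assms G] assms by (simp add: matroid_rank_minor rk_minor)
  qed
  finally show ?thesis .
qed

lemma sum_interval_swap:
  "(\<Sum>B \<in> interval F H. \<Sum>G \<in> interval B H. h B G) = (\<Sum>G \<in> interval F H. \<Sum>B \<in> interval F G. h B G)"
proof -
  have "(\<Sum>B \<in> interval F H. \<Sum>G \<in> interval B H. h B G) = (\<Sum>B \<in> interval F H. \<Sum>G \<in> {G \<in> interval F H. B \<subseteq> G}. h B G)"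
    by (intro sum.cong refl) auto
  also have "\<dots> = (\<Sum>G \<in> interval F H. \<Sum>B \<in> {B \<in> interval F H. B \<subseteq> G}. h B G)"
    by (rule sum.swap_restrict) auto
  also have "\<dots> = (\<Sum>G \<in> interval F H. \<Sum>B \<in> interval F G. h B G)"
    by (intro sum.cong refl) auto
  finally show ?thesis .
qed

lemma P_refl: "F \<in> L \<Longrightarrow> P F F = 1"
  unfolding P_def by (subst KL_poly.simps) (simp add: matroid_rank_minor)

lemma P_unfold:
  assumes "F \<in> L" "H \<in> L" "F \<subset> H"
  shows "P F H = (THE p. 2 * degree p < r H - r F \<and>
    reverse_poly (r H - r F) p = (\<Sum>G \<in> interval F H. chi F G * (if G = F then p else P G H)))"
proof -
  have FH: "F \<subseteq> H" using assms by auto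
  have "(\<Sum>A \<in> flats (minor F H). char_poly (restriction (minor F H) A) *
          (if A = {} then p else KL_poly (contraction (minor F H) A))) =
      (\<Sum>G \<in> interval F H. chi F G * (if G = F then p else P G H))" for p
    unfolding flats_minor[OF assms(1,2) FH]
    by (subst sum.reindex[OF inj_on_minus_interval])
      (auto simp: restriction_minor contraction_minor assms chi_def P_def intro!: sum.cong)
  then show ?thesis
    unfolding P_def using rank_flat_strict_mono[OF assms] finite_flat[OF assms(2)] FH
    by (subst KL_poly.simps) (simp add: matroid_rank_minor)
qed

text \<open>The sum on the left is the Z-polynomial. Given the polynomials of the proper contractions, a
  unique polynomial of degree less than half the rank makes it palindromic; Moebius inversion
  translates palindromicity into the defining identity.\<close>

lemma P_properties:
  assumes "F \<in> L" "H \<in> L" "F \<subseteq> H"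
  shows "(F \<noteq> H \<longrightarrow> 2 * degree (P F H) < r H - r F) \<and>
    (\<Sum>G \<in> interval F H. monom 1 (r G - r F) * P G H) = (\<Sum>G \<in> interval F H. rev_poly (r H - r G) (P G H))"
  using assms
proof (induction "card (H - F)" arbitrary: F rule: less_induct)
  case less
  note F = less.prems(1) and H = less.prems(2) and FH = less.prems(3)
  show ?case
  proof (cases "F = H")
    case True
    then have "interval F H = {F}" using F by auto
    then show ?thesis using True F by (simp add: P_refl rev_poly_def monom_0 one_pCons)
  next
    case False
    then have sub: "F \<subset> H" using FH by auto
    let ?n = "r H - r F"
    have n: "0 < ?n" using rank_flat_strict_mono[OF F H sub] by simp
    define J where "J = {G \<in> L. F \<subset> G \<and> G \<subseteq> H}"
    have J: "interval F H = insert F J" "F \<notin> J" "finite J" using F FH by (auto simp: J_def)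
    have IH: "(G \<noteq> H \<longrightarrow> 2 * degree (P G H) < r H - r G) \<and>
      (\<Sum>B \<in> interval G H. monom 1 (r B - r G) * P B H) = (\<Sum>B \<in> interval G H. rev_poly (r H - r B) (P B H))"
      if "G \<in> J" for G
      using that finite_flat[OF H] H by (intro less.hyps) (auto simp: J_def intro!: psubset_card_mono)
    have rk: "r F \<le> r G" "r G \<le> r H" if "G \<in> J" for G
      using that F H by (auto simp: J_def intro: rank_flat_mono)
    have dP: "degree (P G H) \<le> r H - r G" if "G \<in> J" for G
      using IH[OF that] H by (cases "G = H") (auto simp: P_refl)
    define T where "T = (\<Sum>G \<in> J. monom 1 (r G - r F) * P G H)"
    have "degree T \<le> ?n" unfolding T_def
    proof (rule degree_sum_le[OF J(3)])
      fix G assume G: "G \<in> J"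
      have "degree (monom 1 (r G - r F) * P G H) \<le> (r G - r F) + degree (P G H)"
        by (metis degree_mult_le degree_monom_eq one_neq_zero)
      then show "degree (monom 1 (r G - r F) * P G H) \<le> ?n"
        using rk[OF G] dP[OF G] by linarith
    qed
    then obtain p where p: "2 * degree p < ?n" "rev_poly ?n (p + T) = p + T"
      using ex1_symmetric_completion n by blast
    \<comment> \<open>\<open>f\<close> carries the candidate \<open>p\<close> at \<open>F\<close>,
      where \<open>P F H\<close> is not yet known, so that palindromicity can be stated uniformly
      for all flats of the interval.\<close>
    define f where "f G = (if G = F then p else P G H)" for G
    have u: "(\<Sum>B \<in> interval G H. monom 1 (r B - r G) * f B) = (\<Sum>B \<in> interval G H. rev_poly (r H - r B) (f B))"
      if "G \<in> interval F H" for G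
    proof (cases "G = F")
      case False
      then have G: "G \<in> J" using that J by auto
      then have "f B = P B H" if "B \<in> interval G H" for B using that by (auto simp: f_def J_def)
      then show ?thesis using IH[OF G] by (simp cong: sum.cong_simp)
    next
      case True
      have "rev_poly ?n T = (\<Sum>B \<in> J. rev_poly (r H - r B) (P B H))"
        unfolding T_def rev_poly_sum
      proof (intro sum.cong refl)
        fix B assume B: "B \<in> J"
        have eq: "?n - (r B - r F) = r H - r B" using rk[OF B] by simp
        have "rev_poly ?n (monom 1 (r B - r F) * P B H) = rev_poly (?n - (r B - r F)) (P B H)"
          using rk[OF B] dP[OF B] by (intro rev_poly_monom_mult) (auto simp: eq)
        then show "rev_poly ?n (monom 1 (r B - r F) * P B H) = rev_poly (r H - r B) (P B H)"
          unfolding eq .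
      qed
      moreover have "(\<Sum>B \<in> J. rev_poly (r H - r B) (f B)) = (\<Sum>B \<in> J. rev_poly (r H - r B) (P B H))"
        "(\<Sum>B \<in> J. monom 1 (r B - r F) * f B) = T"
        unfolding T_def using J by (auto simp: f_def intro!: sum.cong)
      ultimately show ?thesis using p(2) J True
        by (simp add: rev_poly_add) (simp add: f_def)
    qed
    \<comment> \<open>Moebius inversion isolates the term at \<open>F\<close>. Palindromicity then
      replaces reversed terms by shifted ones, and the factors collected at each \<open>G\<close>
      form \<open>chi F G\<close>.\<close>
    have "rev_poly ?n p = (\<Sum>G \<in> interval F H. if G = F then rev_poly (r H - r G) (f G) else 0)"
      using F FH by (subst sum.delta) (auto simp: f_def)
    also have "\<dots> = (\<Sum>G \<in> interval F H. \<Sum>B \<in> interval F G. [:mu F B:] * rev_poly (r H - r G) (f G))"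
    proof (intro sum.cong refl)
      fix G assume "G \<in> interval F H"
      then have "(\<Sum>B \<in> interval F G. mu F B) = (if F = G then 1 else 0)"
        using F by (intro sum_mu) auto
      then have "(\<Sum>B \<in> interval F G. [:mu F B:]) = (if F = G then 1 else 0)"
        by (simp add: sum_const_poly one_pCons)
      then show "(if G = F then rev_poly (r H - r G) (f G) else 0) =
        (\<Sum>B \<in> interval F G. [:mu F B:] * rev_poly (r H - r G) (f G))"
        unfolding sum_distrib_right[symmetric] by auto
    qed
    also have "\<dots> = (\<Sum>B \<in> interval F H. [:mu F B:] * (\<Sum>G \<in> interval B H. rev_poly (r H - r G) (f G)))"
      unfolding sum_distrib_left by (rule sum_interval_swap[symmetric])
    also have "\<dots> = (\<Sum>B \<in> interval F H. [:mu F B:] * (\<Sum>G \<in> interval B H. monom 1 (r G - r B) * f G))"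
      using u by (intro sum.cong refl) auto
    also have "\<dots> = (\<Sum>G \<in> interval F H. \<Sum>B \<in> interval F G. [:mu F B:] * (monom 1 (r G - r B) * f G))"
      unfolding sum_distrib_left by (rule sum_interval_swap)
    also have "\<dots> = (\<Sum>G \<in> interval F H. chi F G * f G)"
    proof (intro sum.cong refl)
      fix G assume "G \<in> interval F H"
      then have "chi F G = (\<Sum>B \<in> interval F G. monom (mu F B) (r G - r B))"
        using F by (intro chi_eq) auto
      then show "(\<Sum>B \<in> interval F G. [:mu F B:] * (monom 1 (r G - r B) * f G)) = chi F G * f G"
        by (simp add: sum_distrib_right smult_monom mult.assoc[symmetric] del: mult_smult_left)
    qed
    finally have eq: "rev_poly ?n p = (\<Sum>G \<in> interval F H. chi F G * f G)" .
    have chiF: "chi F F = 1"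
      using chi_eq[OF F F] sum_mu[OF F F] F
      by (auto simp: monom_0 one_pCons sum.delta Collect_conv_if conj_commute cong: conj_cong split: if_splits)
    have "P F H = p"
      unfolding P_unfold[OF F H sub]
    proof (rule the_equality)
      show "2 * degree p < ?n \<and> reverse_poly ?n p = (\<Sum>G \<in> interval F H. chi F G * (if G = F then p else P G H))"
        using p(1) eq by (simp add: reverse_poly_eq_rev_poly f_def)
    next
      \<comment> \<open>A second solution has the same difference to its reversal, since only the
        term at \<open>F\<close> involves the unknown.\<close>
      fix p' assume p': "2 * degree p' < ?n \<and> reverse_poly ?n p' = (\<Sum>G \<in> interval F H. chi F G * (if G = F then p' else P G H))"
      have 1: "(\<Sum>G \<in> J. chi F G * (if G = F then p' else P G H)) = (\<Sum>G \<in> J. chi F G * f G)"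
        using J by (intro sum.cong refl) (auto simp: f_def)
      have "rev_poly ?n p' = (\<Sum>G \<in> interval F H. chi F G * (if G = F then p' else P G H))"
        using p' reverse_poly_eq_rev_poly[of p' ?n] by (metis (no_types, lifting) le_trans less_imp_le mult_le_mono1 nat_mult_1 one_le_numeral)
      also have "\<dots> = p' + (\<Sum>G \<in> J. chi F G * f G)"
        unfolding J(1) 1[symmetric] using J(2,3) chiF by simp
      finally have "rev_poly ?n p' - p' = (\<Sum>G \<in> J. chi F G * f G)" by simp
      moreover have "rev_poly ?n p = p + (\<Sum>G \<in> J. chi F G * f G)"
        unfolding eq J(1) using J(2,3) chiF by (simp add: f_def)
      ultimately have "rev_poly ?n p' - p' = rev_poly ?n p - p" by simp
      then show "p' = p" 
        by (rule symmetric_completion_unique[OF conjunct1[OF p'] p(1)])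
    qed
    then have "f = (\<lambda>G. P G H)" by (auto simp: f_def)
    then show ?thesis using u[of F] p(1) F FH unfolding \<open>P F H = p\<close> by blast
  qed
qed


section \<open>Inverse polynomials in the incidence algebra of flats\<close>

lemma Q_refl: "F \<in> L \<Longrightarrow> Q F F = 1"
  unfolding Q_def by (subst inverse_KL_poly.simps) (simp add: matroid_rank_minor)

lemma Q_unfold:
  assumes "F \<in> L" "H \<in> L" "F \<subset> H"
  shows "Q F H = (\<Sum>G \<in> interval F H - {F}. (-1) ^ (r G - r F + 1) * P F G * Q G H)"
proof -
  have FH: "F \<subseteq> H" using assms by auto
  have img: "(\<lambda>G. G - F) ` interval F H - {{}} = (\<lambda>G. G - F) ` (interval F H - {F})" by auto
  have "(\<Sum>A \<in> flats (minor F H) - {{}}. (-1) ^ (rk (minor F H) A + 1) *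
          KL_poly (restriction (minor F H) A) * inverse_KL_poly (contraction (minor F H) A)) =
      (\<Sum>G \<in> interval F H - {F}. (-1) ^ (r G - r F + 1) * P F G * Q G H)"
    unfolding flats_minor[OF assms(1,2) FH] img
    by (subst sum.reindex[OF inj_on_subset[OF inj_on_minus_interval]])
      (auto simp: restriction_minor contraction_minor assms Q_def P_def rk_minor Un_absorb2 intro!: sum.cong)
  then show ?thesis
    unfolding Q_def using rank_flat_strict_mono[OF assms] finite_flat[OF assms(2)] FH
    by (subst inverse_KL_poly.simps) (simp add: matroid_rank_minor)
qed

text \<open>This is the recursion for \<open>Q\<close> with its left side read as the term at
  \<open>F\<close>. The sign is made to depend on the pair \<open>G\<close>, \<open>H\<close> alone,
  which turns the recursion into a product identity in the incidence algebra.\<close>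

lemma sum_P_Q:
  assumes "F \<in> L" "H \<in> L" "F \<subseteq> H"
  shows "(\<Sum>G \<in> interval F H. P F G * ((-1) ^ (r H - r G) * Q G H)) = (if F = H then 1 else 0)"
proof (cases "F = H")
  case True
  then have "interval F H = {F}" using assms by auto
  then show ?thesis using True assms by (simp add: P_refl Q_refl)
next
  case False
  then have sub: "F \<subset> H" using assms by auto
  have eq: "interval F H = insert F (interval F H - {F})" using assms by auto
  have "P F G * ((-1) ^ (r H - r G) * Q G H) =
     - ((-1) ^ (r H - r F)) * ((-1) ^ (r G - r F + 1) * P F G * Q G H)"
    if "G \<in> interval F H - {F}" for G
  proof -
    have "r F \<le> r G" "r G \<le> r H" using that assms by (auto intro: rank_flat_mono)
    then have "r H - r F = (r H - r G) + (r G - r F)" by simp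
    then have "(-1) ^ (r H - r F) * (-1) ^ (r G - r F) = ((-1) ^ (r H - r G) :: int poly)"
      by (metis (no_types, lifting) minus_one_mult_self mult.assoc mult.right_neutral power_add)
    then show ?thesis by (simp add: algebra_simps)
  qed
  then have "(\<Sum>G \<in> interval F H - {F}. P F G * ((-1) ^ (r H - r G) * Q G H)) =
      - ((-1) ^ (r H - r F)) * Q F H"
    unfolding Q_unfold[OF assms(1,2) sub] sum_distrib_left by (rule sum.cong[OF refl])
  then show ?thesis using False assms
    by (subst eq, subst sum.insert) (auto simp: P_refl)
qed

lemma degree_P: "F \<in> L \<Longrightarrow> H \<in> L \<Longrightarrow> F \<subset> H \<Longrightarrow> 2 * degree (P F H) < r H - r F"
  using P_properties[of F H] by auto

lemma degree_P_le: "F \<in> L \<Longrightarrow> H \<in> L \<Longrightarrow> F \<subseteq> H \<Longrightarrow> 2 * degree (P F H) \<le> r H - r F"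
  using degree_P[of F H] P_refl[of F] by (cases "F = H") (auto simp: psubset_eq)

text \<open>Every summand of the recursion has a factor \<open>P F G\<close> with \<open>F\<close>
  strictly below \<open>G\<close>, whose degree is strictly below half the rank; this keeps the
  total strictly below half.\<close>

lemma degree_Q:
  assumes "F \<in> L" "H \<in> L" "F \<subset> H"
  shows "2 * degree (Q F H) < r H - r F"
  using assms
proof (induction "card (H - F)" arbitrary: F rule: less_induct)
  case less
  note F = less.prems(1) and H = less.prems(2) and FH = less.prems(3)
  have n: "0 < r H - r F" using rank_flat_strict_mono[OF F H FH] by simp
  have "degree (Q F H) \<le> (r H - r F - 1) div 2"
    unfolding Q_unfold[OF F H FH]
  proof (rule degree_sum_le)
    fix G assume G: "G \<in> interval F H - {F}"
    then have G': "G \<in> L" "F \<subset> G" "G \<subseteq> H" by auto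
    have dP: "2 * degree (P F G) < r G - r F" using G' F by (intro degree_P) auto
    have dQ: "2 * degree (Q G H) \<le> r H - r G"
    proof (cases "G = H")
      case True then show ?thesis using H by (simp add: Q_refl)
    next
      case False
      then have "2 * degree (Q G H) < r H - r G"
        using G' H FH finite_flat[OF H] by (intro less.hyps) (auto intro!: psubset_card_mono)
      then show ?thesis by simp
    qed
    have "degree ((-1) ^ (r G - r F + 1) * P F G * Q G H) \<le> degree (P F G) + degree (Q G H)"
    proof -
      have "degree ((-1) ^ k * p) = degree p" for k and p :: "int poly"
        by (cases "even k") auto
      then show ?thesis
        using degree_mult_le[of "(-1) ^ (r G - r F + 1) * P F G" "Q G H"] by simp
    qed
    moreover have "r F \<le> r G" "r G \<le> r H" using G' F H by (auto intro: rank_flat_mono)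
    ultimately show "degree ((-1) ^ (r G - r F + 1) * P F G * Q G H) \<le> (r H - r F - 1) div 2"
      using dP dQ by linarith
  qed simp
  then show ?case using n by linarith
qed

lemma minor_empty: "minor {} H = restriction M H"
  by (simp add: minor_def contraction_def restriction_def)

text \<open>The row at \<open>{}\<close> of the signed function that is inverse to
  \<open>P\<close>.\<close>

definition "g H = (-1) ^ r H * inverse_KL_poly (restriction M H)"

lemma g_eq: "g H = (-1) ^ (r H - r {}) * Q {} H"
  by (simp add: g_def Q_def minor_empty)

text \<open>\<open>sum_P_Q\<close> has \<open>P\<close> as its left factor;
  \<open>mult_inverse_commute\<close> supplies the opposite order.\<close>

lemma sum_g_P:
  assumes "H \<in> L"
  shows "(\<Sum>G \<in> interval {} H. g G * P G H) = (if {} = H then 1 else 0)"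
proof -
  have "(\<Sum>G \<in> interval {} H. ((-1) ^ (r G - r {}) * Q {} G) * P G H) = (if {} = H then 1 else 0)"
    by (rule mult_inverse_commute[where L = L and Q = "\<lambda>F H. (-1) ^ (r H - r F) * Q F H"])
      (use assms empty_flat sum_P_Q finite_flat[OF assms] in \<open>auto simp: Q_refl\<close>)
  then show ?thesis unfolding g_eq .
qed

lemma degree_g:
  assumes "H \<in> L"
  shows "2 * degree (g H) \<le> r H" "H \<noteq> {} \<Longrightarrow> 2 * degree (g H) < r H" "g {} = 1"
proof -
  have d: "degree (g H) = degree (Q {} H)"
    unfolding g_eq by (cases "even (r H - r {})") auto
  show 1: "g {} = 1" using empty_flat by (simp add: g_eq Q_refl)
  show 2: "2 * degree (g H) < r H" if "H \<noteq> {}"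
    using degree_Q[OF empty_flat assms] that d by auto
  show "2 * degree (g H) \<le> r H" using 1 2 by (cases "H = {}") auto
qed

text \<open>Let zeta stand for plain summation over flats and zeta_t for summation weighted by
  \<open>t\<close> to the rank difference. As zeta_t is invertible by Moebius inversion, some
  \<open>v\<close> satisfies g = v zeta_t. The palindromicity in \<open>P_properties\<close> reads
  zeta_t P = zeta P', with P' the reversed \<open>P\<close>. Hence v zeta P' = g P is the identity
  at \<open>{}\<close>. The reversed \<open>g\<close> satisfies the same equation, and P' has unit
  diagonal, so v zeta is the reversed \<open>g\<close>.\<close>

lemma exists_palindromic_decomposition:
  obtains v where "\<And>H. H \<in> L \<Longrightarrow> g H = (\<Sum>G \<in> {G \<in> L. G \<subseteq> H}. monom 1 (r H - r G) * v G)"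
    and "\<And>H. H \<in> L \<Longrightarrow> rev_poly (r H) (g H) = (\<Sum>G \<in> {G \<in> L. G \<subseteq> H}. v G)"
proof -
  define v where "v F = (\<Sum>G \<in> interval {} F. g G * (monom 1 (r F - r G) * [:mu G F:]))" for F
  have 1: "g H = (\<Sum>F \<in> interval {} H. monom 1 (r H - r F) * v F)" if H: "H \<in> L" for H
  proof -
    have "(\<Sum>F \<in> interval {} H. monom 1 (r H - r F) * v F) =
      (\<Sum>F \<in> interval {} H. \<Sum>G \<in> interval {} F. monom 1 (r H - r G) * g G * [:mu G F:])"
      unfolding v_def sum_distrib_left
    proof (intro sum.cong refl)
      fix F G assume FG: "F \<in> interval {} H" "G \<in> interval {} F"
      then have "r G \<le> r F" "r F \<le> r H" using H by (auto intro: rank_flat_mono)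
      then have "monom (1::int) (r H - r G) = monom 1 (r H - r F) * monom 1 (r F - r G)"
        by (simp add: mult_monom)
      then show "monom 1 (r H - r F) * (g G * (monom 1 (r F - r G) * [:mu G F:])) =
          monom 1 (r H - r G) * g G * [:mu G F:]" by (simp only: ac_simps)
    qed
    also have "\<dots> = (\<Sum>G \<in> interval {} H. \<Sum>F \<in> interval G H. monom 1 (r H - r G) * g G * [:mu G F:])"
      by (rule sum_interval_swap[symmetric])
    also have "\<dots> = (\<Sum>G \<in> interval {} H. if G = H then g H else 0)"
    proof (intro sum.cong refl)
      fix G assume "G \<in> interval {} H"
      then show "(\<Sum>F \<in> interval G H. monom 1 (r H - r G) * g G * [:mu G F:]) = (if G = H then g H else 0)"
        unfolding sum_distrib_left[symmetric] sum_const_poly using H sum_mu[of G H]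
        by (auto simp: monom_0 one_pCons)
    qed
    also have "\<dots> = g H" using H by (subst sum.delta) auto
    finally show ?thesis by simp
  qed
  define g' where "g' H = (\<Sum>F \<in> interval {} H. v F)" for H
  have g'_P: "(\<Sum>F \<in> interval {} H. g' F * rev_poly (r H - r F) (P F H)) = (if {} = H then 1 else 0)"
    if H: "H \<in> L" for H
  proof -
    have "(\<Sum>F \<in> interval {} H. g' F * rev_poly (r H - r F) (P F H)) =
      (\<Sum>G \<in> interval {} H. \<Sum>F \<in> interval G H. v G * rev_poly (r H - r F) (P F H))"
      unfolding g'_def sum_distrib_right by (rule sum_interval_swap[symmetric])
    also have "\<dots> = (\<Sum>G \<in> interval {} H. \<Sum>F \<in> interval G H. v G * (monom 1 (r F - r G) * P F H))"
      unfolding sum_distrib_left[symmetric] using P_properties H by (intro sum.cong refl) auto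
    also have "\<dots> = (\<Sum>F \<in> interval {} H. \<Sum>G \<in> interval {} F. v G * (monom 1 (r F - r G) * P F H))"
      by (rule sum_interval_swap)
    also have "\<dots> = (\<Sum>F \<in> interval {} H. g F * P F H)"
      by (intro sum.cong refl) (auto simp: 1 sum_distrib_right sum_distrib_left ac_simps)
    finally show ?thesis using sum_g_P[OF H] by simp
  qed
  have g_P: "(\<Sum>F \<in> interval {} H. rev_poly (r F) (g F) * rev_poly (r H - r F) (P F H)) = (if {} = H then 1 else 0)"
    if H: "H \<in> L" for H
  proof -
    have "rev_poly (r F) (g F) * rev_poly (r H - r F) (P F H) = rev_poly (r H) (g F * P F H)"
      if "F \<in> interval {} H" for F
    proof -
      have "r F \<le> r H" using that H by (auto intro: rank_flat_mono)
      then have "r H = r F + (r H - r F)" by simp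
      moreover have "degree (g F) \<le> r F" "degree (P F H) \<le> r H - r F"
        using degree_g(1)[of F] degree_P_le[of F H] that H by auto
      ultimately show ?thesis by (metis rev_poly_mult)
    qed
    then have "(\<Sum>F \<in> interval {} H. rev_poly (r F) (g F) * rev_poly (r H - r F) (P F H)) =
        rev_poly (r H) (\<Sum>F \<in> interval {} H. g F * P F H)"
      unfolding rev_poly_sum by (rule sum.cong[OF refl])
    then show ?thesis unfolding sum_g_P[OF H]
      by (auto simp: rev_poly_def monom_0 one_pCons)
  qed
  have "g' H = rev_poly (r H) (g H)" if "H \<in> L" for H
    using that
  proof (induction "card H" arbitrary: H rule: less_induct)
    case less
    have eq: "interval {} H = insert H {G \<in> L. G \<subset> H}" using less.prems by auto
    have "g' F * rev_poly (r H - r F) (P F H) = rev_poly (r F) (g F) * rev_poly (r H - r F) (P F H)"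
      if "F \<in> {G \<in> L. G \<subset> H}" for F
      using that less.hyps[of F] finite_flat[OF less.prems] by (auto intro: psubset_card_mono)
    then have "(\<Sum>F \<in> {G \<in> L. G \<subset> H}. g' F * rev_poly (r H - r F) (P F H)) =
      (\<Sum>F \<in> {G \<in> L. G \<subset> H}. rev_poly (r F) (g F) * rev_poly (r H - r F) (P F H))"
      by (rule sum.cong[OF refl])
    moreover have "rev_poly (r H - r H) (P H H) = 1"
      using less.prems by (simp add: P_refl rev_poly_def monom_0 one_pCons)
    ultimately show ?case
      using g'_P[OF less.prems] g_P[OF less.prems] unfolding eq by (subst (asm) (1 2) sum.insert) auto
  qed
  with 1 show ?thesis
    by (intro that[of v]) (auto simp: g'_def)
qed

end

section \<open>Subspaces over a finite field\<close>

definition gbinom :: "real \<Rightarrow> nat \<Rightarrow> nat \<Rightarrow> real" where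
  "gbinom q n k = (\<Prod>l<k. (q ^ (n - l) - 1) / (q ^ (l + 1) - 1))"

lemma gbinom_0 [simp]: "gbinom q n 0 = 1"
  by (simp add: gbinom_def)

text \<open>The factor at \<open>l = n\<close> is \<open>q ^ 0 - 1\<close>.\<close>

lemma gbinom_eq_0: "n < k \<Longrightarrow> gbinom q n k = 0"
  unfolding gbinom_def by (rule prod_zero) (auto intro!: bexI[of _ n])

lemma gbinom_Suc: "gbinom q n (Suc k) = gbinom q n k * ((q ^ (n - k) - 1) / (q ^ (k + 1) - 1))"
  by (simp add: gbinom_def)

lemma gbinom_Suc_Suc:
  "gbinom q (Suc n) (Suc k) = (q ^ Suc n - 1) / (q ^ Suc k - 1) * gbinom q n k"
proof -
  have "(\<Prod>l<Suc k. q ^ (Suc n - l) - 1) = (q ^ Suc n - 1) * (\<Prod>l<k. q ^ (n - l) - 1)"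
    by (subst prod.lessThan_Suc_shift) simp
  then show ?thesis by (simp add: gbinom_def prod_dividef)
qed

lemma gbinom_pascal:
  assumes "q > 1" "k \<le> n"
  shows "gbinom q (Suc n) (Suc k) = gbinom q n (Suc k) + q ^ (n - k) * gbinom q n k"
proof -
  have ne: "q ^ Suc k - 1 \<noteq> 0" using assms(1) by (metis less_irrefl one_less_power zero_less_Suc right_minus_eq)
  have "q ^ Suc n = q ^ (n - k) * q ^ Suc k"
    using assms(2) by (simp add: power_add[symmetric])
  then have "q ^ Suc n - 1 = (q ^ (n - k) - 1) + q ^ (n - k) * (q ^ Suc k - 1)"
    by (simp add: algebra_simps)
  then have "(q ^ Suc n - 1) / (q ^ Suc k - 1) = (q ^ (n - k) - 1) / (q ^ Suc k - 1) + q ^ (n - k)"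
    by (simp only: add_divide_distrib nonzero_mult_div_cancel_right[OF ne])
  then show ?thesis
    unfolding gbinom_Suc_Suc gbinom_Suc[of q n k] by (simp add: algebra_simps)
qed

lemma gbinom_fact:
  assumes "q > 1" "k \<le> n"
  shows "gbinom q n k * ((\<Prod>l<k. q ^ Suc l - 1) * (\<Prod>l<n - k. q ^ Suc l - 1)) = (\<Prod>l<n. q ^ Suc l - 1)"
  using assms(2)
proof (induction k)
  case (Suc k)
  obtain m where m: "n - k = Suc m" using Suc.prems by (metis Suc_diff_le diff_Suc_Suc)
  then have m': "n - Suc k = m" by simp
  have ne: "q ^ Suc k - 1 \<noteq> 0" using assms(1) by (metis less_irrefl one_less_power zero_less_Suc right_minus_eq)
  have "gbinom q n (Suc k) * ((\<Prod>l<Suc k. q ^ Suc l - 1) * (\<Prod>l<n - Suc k. q ^ Suc l - 1)) =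
    gbinom q n k * ((\<Prod>l<k. q ^ Suc l - 1) * (\<Prod>l<n - k. q ^ Suc l - 1))"
    unfolding gbinom_Suc m m' using ne by (simp add: field_simps)
  also have "\<dots> = (\<Prod>l<n. q ^ Suc l - 1)" using Suc by simp
  finally show ?case .
qed simp

lemma gbinom_symmetric:
  assumes "q > 1" "k \<le> n"
  shows "gbinom q n (n - k) = gbinom q n k"
proof -
  have ne: "(\<Prod>l<m. q ^ Suc l - 1) \<noteq> 0" for m
    using assms(1) by (simp add: prod_zero_iff) (metis less_irrefl one_less_power zero_less_Suc power_Suc)
  have "gbinom q n (n - k) * ((\<Prod>l<k. q ^ Suc l - 1) * (\<Prod>l<n - k. q ^ Suc l - 1)) =
      gbinom q n k * ((\<Prod>l<k. q ^ Suc l - 1) * (\<Prod>l<n - k. q ^ Suc l - 1))"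
    using gbinom_fact[OF assms] gbinom_fact[OF assms(1), of "n - k" n] assms(2)
    by (simp add: ac_simps)
  then show ?thesis using ne by simp
qed

text \<open>The q-analogue of the partial alternating sums of binomial coefficients, telescoping by
  the Pascal rule. For \<open>k = Suc n\<close> it is the vanishing sum behind Moebius inversion of
  subspaces; truncated sums produce the main term of the coefficients.\<close>

lemma gbinom_alternating_sum:
  assumes "q > 1" "k \<le> Suc n"
  shows "(\<Sum>j\<le>k. (-1) ^ j * gbinom q (Suc n) j * q ^ ((Suc n - j) choose 2)) =
    (-1) ^ k * gbinom q n k * q ^ ((Suc n - k) choose 2)"
  using assms(2)
proof (induction k)
  case (Suc k)
  then have k: "k \<le> n" by simp
  then obtain m where m: "n = k + m" using le_Suc_ex by blast
  have c: "Suc m choose 2 = m + (m choose 2)" by (simp add: numeral_2_eq_2)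
  have e: "Suc n - k = Suc m" "Suc n - Suc k = m" "n - k = m" using m by auto
  show ?case
    unfolding sum.atMost_Suc Suc.IH[OF le_SucI[OF k]] gbinom_pascal[OF assms(1) k] e c power_add
    by (simp add: algebra_simps)
qed simp

text \<open>The bound with exponent \<open>n * k\<close> serves for plain counting. The one with
  exponent \<open>k * (n - k) + k\<close> is for sums in which quadratic exponents compete.\<close>

lemma gbinom_mono_bound:
  assumes "q \<ge> 2"
  shows "0 \<le> gbinom q n k" "gbinom q n k \<le> (q ^ n) ^ k" "k \<le> n \<Longrightarrow> 1 \<le> gbinom q n k"
    "gbinom q n k \<le> q ^ (k * (n - k) + k)"
proof -
  have p: "q ^ m \<ge> 1" for m using assms by (simp add: one_le_power)
  have p1: "q ^ Suc m - 1 \<ge> 1" for m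
  proof -
    have "2 * 1 \<le> q * q ^ m" using assms p[of m] by (intro mult_mono) auto
    then show ?thesis by simp
  qed
  have nn: "0 \<le> (q ^ (n - l) - 1) / (q ^ (l + 1) - 1)" for n l
    using p[of "n - l"] p1[of l] by (intro divide_nonneg_nonneg) auto
  show nonneg: "0 \<le> gbinom q n k" for n k
    unfolding gbinom_def by (intro prod_nonneg nn)
  have "gbinom q n k \<le> (\<Prod>l<k. q ^ n)" unfolding gbinom_def
  proof (rule prod_mono, intro conjI)
    fix l assume "l \<in> {..<k}"
    have "(q ^ (n - l) - 1) / (q ^ (l + 1) - 1) \<le> (q ^ (n - l) - 1) / 1"
      using p p1[of l] by (intro divide_left_mono) auto
    also have "\<dots> \<le> q ^ n"
    proof -
      have "q ^ (n - l) \<le> q ^ n" using assms by (intro power_increasing) auto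
      then show ?thesis by simp
    qed
    finally show "(q ^ (n - l) - 1) / (q ^ (l + 1) - 1) \<le> q ^ n" .
    show "0 \<le> (q ^ (n - l) - 1) / (q ^ (l + 1) - 1)" by (rule nn)
  qed
  then show "gbinom q n k \<le> (q ^ n) ^ k" by simp
  show "1 \<le> gbinom q n k" if "k \<le> n" using that
  proof (induction k arbitrary: n)
    case (Suc k)
    then obtain m where m: "n = Suc m" by (cases n) auto
    then have "1 \<le> gbinom q m k" using Suc by simp
    moreover have "1 \<le> (q ^ Suc m - 1) / (q ^ Suc k - 1)"
      using p1[of k] power_increasing[of "Suc k" "Suc m" q] Suc.prems m assms by (simp add: le_divide_eq)
    ultimately show ?case unfolding m gbinom_Suc_Suc
      using mult_mono[of 1 "(q ^ Suc m - 1) / (q ^ Suc k - 1)" 1 "gbinom q m k"] by linarith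
  qed simp
  show "gbinom q n k \<le> q ^ (k * (n - k) + k)"
  proof (cases "k \<le> n")
    case False
    then show ?thesis using p by (simp add: gbinom_eq_0 order_trans[OF zero_le_one p])
  next
    case True
    have "gbinom q n k \<le> q ^ (k * (Suc (n - k)))" using True
    proof (induction k arbitrary: n)
      case (Suc k)
      then obtain m where m: "n = Suc m" by (cases n) auto
      have IH: "gbinom q m k \<le> q ^ (k * Suc (m - k))" using Suc m by simp
      have km: "k \<le> m" using Suc m by simp
      have "q ^ Suc m - 1 \<le> q ^ (Suc (m - k)) * (q ^ Suc k - 1)"
      proof -
        have "q ^ (Suc (m - k)) * q ^ Suc k = q * q ^ Suc m"
          unfolding power_add[symmetric] power_Suc[symmetric] using km by simp
        then have "q ^ (Suc (m - k)) * (q ^ Suc k - 1) = q * q ^ Suc m - q ^ Suc (m - k)"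
          by (simp only: right_diff_distrib mult_1_right)
        moreover have "q ^ Suc (m - k) \<le> q ^ Suc m" using assms by (intro power_increasing) auto
        moreover have "2 * q ^ Suc m \<le> q * q ^ Suc m" using assms by (intro mult_right_mono) auto
        ultimately show ?thesis using p[of "Suc m"] by linarith
      qed
      then have "(q ^ Suc m - 1) / (q ^ Suc k - 1) \<le> q ^ Suc (m - k)"
        using p1[of k] by (simp add: divide_le_eq)
      then have "gbinom q n (Suc k) \<le> q ^ Suc (m - k) * q ^ (k * Suc (m - k))"
        unfolding m gbinom_Suc_Suc using IH assms p[of "Suc m"] p1[of k]
        by (intro mult_mono nonneg) (auto simp: order_trans[OF zero_le_one p])
      also have "\<dots> = q ^ (Suc k * Suc (n - Suc k))" by (simp add: m power_add[symmetric] ac_simps)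
      finally show ?case .
    qed simp
    then show ?thesis by (simp add: add.commute)
  qed
qed

section \<open>Dimension and counting for finite subspaces\<close>

locale vector_space_over_finite_field = vector_space scale
  for scale :: "'k::{field,finite} \<Rightarrow> 'v::ab_group_add \<Rightarrow> 'v" (infixr \<open>*s\<close> 75) +
  fixes q :: nat
  assumes card_field: "card (UNIV :: 'k set) = q"
begin

lemma q_ge_2: "q \<ge> 2"
proof -
  have "card {0, 1 :: 'k} \<le> q" unfolding card_field[symmetric] by (rule card_mono) auto
  then show ?thesis by simp
qed

lemma card_span_independent:
  assumes "finite B" "independent B"
  shows "finite (span B)" "card (span B) = q ^ card B"
proof -
  have "finite (span B) \<and> card (span B) = q ^ card B"
    using assms
  proof (induction B rule: finite_induct)
    case (insert b B)
    have ind: "independent B" "b \<notin> span B" using insert by (auto simp: independent_insert)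
    have eq: "span (insert b B) = (\<lambda>(k, x). k *s b + x) ` (UNIV \<times> span B)"
    proof (intro equalityI subsetI)
      fix x assume "x \<in> span (insert b B)"
      then obtain k where "x - k *s b \<in> span B" using span_breakdown_eq by blast
      then show "x \<in> (\<lambda>(k, x). k *s b + x) ` (UNIV \<times> span B)"
        by (intro image_eqI[of _ _ "(k, x - k *s b)"]) auto
    next
      fix x assume "x \<in> (\<lambda>(k, x). k *s b + x) ` (UNIV \<times> span B)"
      then obtain k y where "x = k *s b + y" "y \<in> span B" by auto
      then show "x \<in> span (insert b B)"
        unfolding span_breakdown_eq by (intro exI[of _ k]) simp
    qed
    have "inj_on (\<lambda>(k, x). k *s b + x) (UNIV \<times> span B)"
    proof (clarsimp simp: inj_on_def)
      fix k k' x x' assume x: "x \<in> span B" "x' \<in> span B" and e: "k *s b + x = k' *s b + x'"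
      then have e': "(k - k') *s b = x' - x" by (simp add: scale_left_diff_distrib algebra_simps)
      have "k = k'"
      proof (rule ccontr)
        assume "k \<noteq> k'"
        then have "b = inverse (k - k') *s ((k - k') *s b)" by simp
        also have "\<dots> \<in> span B" unfolding e' using x by (intro span_scale span_diff)
        finally show False using ind by simp
      qed
      then show "k = k' \<and> x = x'" using e by simp
    qed
    then show ?case unfolding eq using insert ind
      by (simp add: card_image card_cartesian_product card_field)
  qed simp
  then show "finite (span B)" "card (span B) = q ^ card B" by auto
qed

text \<open>The ambient space may be infinite, so dimensions of finite subspaces are compared
  through cardinalities: as \<open>q\<close> is at least 2, \<open>q ^ dim K\<close> determines
  \<open>dim K\<close>.\<close>

lemma card_subspace:
  assumes "subspace K" "finite K"
  shows "card K = q ^ dim K"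
proof -
  obtain B where B: "B \<subseteq> K" "independent B" "K \<subseteq> span B" "card B = dim K"
    using basis_exists by blast
  then have "span B = K" using assms(1) span_subspace by blast
  then show ?thesis using card_span_independent(2)[of B] B assms(2) finite_subset by metis
qed

lemma dim_le_iff_card_le:
  assumes "subspace A" "finite A" "subspace B" "finite B"
  shows "dim A \<le> dim B \<longleftrightarrow> card A \<le> card B"
  using assms q_ge_2 by (simp add: card_subspace power_increasing_iff)

lemma dim_mono_finite:
  assumes "subspace A" "subspace B" "A \<subseteq> B" "finite B"
  shows "dim A \<le> dim B"
  using assms finite_subset card_mono by (metis dim_le_iff_card_le)

lemma dim_eq_imp_eq:
  assumes "subspace A" "subspace B" "A \<subseteq> B" "finite B" "dim B \<le> dim A"
  shows "A = B"
  using assms finite_subset card_seteq by (metis dim_le_iff_card_le)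

lemma dim_strict_mono:
  assumes "subspace A" "subspace B" "A \<subset> B" "finite B"
  shows "dim A < dim B"
  using assms dim_eq_imp_eq[of A B] by (metis not_le psubset_eq)

lemma finite_span: "finite B \<Longrightarrow> finite (span B)"
  by (metis card_span_independent(1) finite_subset maximal_independent_subset span_eq span_superset subset_trans)

lemma dim_zero [simp]: "dim {0} = 0"
  by (metis card.empty dim_span_eq_card_independent independent_empty span_empty)

lemma dim_eq_0_iff:
  assumes "subspace A" "finite A"
  shows "dim A = 0 \<longleftrightarrow> A = {0}"
proof
  assume "dim A = 0"
  then have "card A = 1" using assms by (simp add: card_subspace)
  then show "A = {0}" using subspace_0[OF assms(1)] by (auto simp: card_1_singleton_iff)
qed simp

lemma span_Un_subspaces:
  assumes "subspace A" "subspace B"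
  shows "span (A \<union> B) = {x + y |x y. x \<in> A \<and> y \<in> B}"
  using assms by (simp add: span_Un span_eq_iff[THEN iffD2])

text \<open>Addition maps \<open>A \<times> B\<close> onto the span, and each fibre is a translate
  of the antidiagonal copy of \<open>A \<inter> B\<close>. Counting pairs then compares powers of
  \<open>q\<close>.\<close>

lemma dim_sum_Int:
  assumes "subspace A" "finite A" "subspace B" "finite B"
  shows "dim (span (A \<union> B)) + dim (A \<inter> B) = dim A + dim B"
proof -
  let ?S = "span (A \<union> B)"
  let ?f = "\<lambda>(x, y). x + y"
  have S: "?S = ?f ` (A \<times> B)" using span_Un_subspaces[OF assms(1,3)] by auto
  have finS: "finite ?S" using assms by (simp add: finite_span)
  have fib: "card {p \<in> A \<times> B. ?f p = s} = card (A \<inter> B)" if "s \<in> ?S" for s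
  proof -
    have "s \<in> ?f ` (A \<times> B)" using that S by simp
    then obtain a b where ab: "a \<in> A" "b \<in> B" "s = a + b" by auto
    have "bij_betw (\<lambda>x. (a + x, b - x)) (A \<inter> B) {p \<in> A \<times> B. ?f p = s}"
    proof (rule bij_betw_byWitness[where f' = "\<lambda>(x, y). x - a"])
      have "a + x \<in> A" "b - x \<in> B" "(a + x) + (b - x) = s" if "x \<in> A \<inter> B" for x
        using ab that assms(1,3) subspace_add[of A a x] subspace_diff[of B b x] by simp_all
      then show "(\<lambda>x. (a + x, b - x)) ` (A \<inter> B) \<subseteq> {p \<in> A \<times> B. ?f p = s}"
        by fastforce
      have e: "x - a = b - y" if "x + y = a + b" for x y
      proof -
        have "x = a + b - y" using that by (simp add: eq_diff_eq)
        then show ?thesis by simp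
      qed
      have "x - a \<in> A" "x - a \<in> B" "a + (x - a) = x" "b - (x - a) = y"
        if "x \<in> A" "y \<in> B" "x + y = s" for x y
      proof -
        show "x - a \<in> A" using that ab assms by (intro subspace_diff)
        have "x - a = b - y" using e that ab by simp
        moreover have "b - y \<in> B" using that ab assms by (intro subspace_diff)
        ultimately show "x - a \<in> B" "b - (x - a) = y" by simp_all
      qed simp
      then show "(\<lambda>(x, y). x - a) ` {p \<in> A \<times> B. ?f p = s} \<subseteq> A \<inter> B"
        "\<forall>p\<in>{p \<in> A \<times> B. ?f p = s}. (a + (case p of (x, y) \<Rightarrow> x - a), b - (case p of (x, y) \<Rightarrow> x - a)) = p"
        by fastforce+
    qed simp
    then show ?thesis by (simp add: bij_betw_same_card)
  qed
  have "card (A \<times> B) = (\<Sum>s\<in>?S. card {p \<in> A \<times> B. ?f p = s})"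
    using sum.group[of "A \<times> B" ?S ?f "\<lambda>_. 1::nat"] assms finS S by simp
  also have "\<dots> = card ?S * card (A \<inter> B)" using fib by simp
  finally have "card A * card B = card ?S * card (A \<inter> B)" by (simp add: card_cartesian_product)
  then have "q ^ (dim A + dim B) = q ^ (dim ?S + dim (A \<inter> B))"
    using assms finS by (simp add: card_subspace subspace_inter power_add)
  then show ?thesis using q_ge_2 by (simp add: power_inject_exp)
qed

text \<open>Take \<open>X\<close> maximal with the prescribed intersection with \<open>R\<close>. A
  vector of \<open>Z\<close> outside the span of \<open>X \<union> R\<close> could be adjoined
  without enlarging that intersection, so there is none.\<close>

lemma exists_relative_complement:
  assumes Z: "subspace Z" "finite Z" and R: "subspace R" "R \<subseteq> Z" and X0: "subspace X0" "X0 \<subseteq> Z"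
  obtains X where "subspace X" "X0 \<subseteq> X" "X \<subseteq> Z" "X \<inter> R = X0 \<inter> R" "span (X \<union> R) = Z"
    "dim X + dim R = dim (X0 \<inter> R) + dim Z"
proof -
  define S where "S = {X. subspace X \<and> X0 \<subseteq> X \<and> X \<subseteq> Z \<and> X \<inter> R = X0 \<inter> R}"
  have "finite S" "X0 \<in> S" using assms by (auto simp: S_def intro: finite_subset[of _ "Pow Z"])
  then obtain X where X: "X \<in> S" and max: "\<And>Y. Y \<in> S \<Longrightarrow> X \<subseteq> Y \<Longrightarrow> Y = X"
    using finite_has_maximal2[of S X0] by metis
  have XS: "subspace X" "X0 \<subseteq> X" "X \<subseteq> Z" "X \<inter> R = X0 \<inter> R" using X by (auto simp: S_def)
  have sub: "span (X \<union> R) \<subseteq> Z" using XS R Z by (intro span_minimal) auto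
  have "Z \<subseteq> span (X \<union> R)"
  proof
    fix v assume v: "v \<in> Z"
    show "v \<in> span (X \<union> R)"
    proof (rule ccontr)
      assume nv: "v \<notin> span (X \<union> R)"
      have "span (insert v X) \<inter> R \<subseteq> X \<inter> R"
      proof
        fix w assume w: "w \<in> span (insert v X) \<inter> R"
        then obtain k where "w - k *s v \<in> span X" using span_breakdown_eq by blast
        then have k: "w - k *s v \<in> X" using XS by (simp add: span_eq_iff[THEN iffD2])
        have "k = 0"
        proof (rule ccontr)
          assume "k \<noteq> 0"
          have "k *s v = w - (w - k *s v)" by simp
          also have "\<dots> \<in> span (X \<union> R)" using w k by (intro span_diff span_base) auto
          finally have "inverse k *s (k *s v) \<in> span (X \<union> R)" by (rule span_scale)
          then show False using nv \<open>k \<noteq> 0\<close> by simp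
        qed
        then show "w \<in> X \<inter> R" using k w by simp
      qed
      moreover have "X \<subseteq> span (insert v X)" by (auto intro: span_base)
      moreover have "span (insert v X) \<subseteq> Z" using v XS Z by (intro span_minimal) auto
      ultimately have "span (insert v X) \<in> S" using XS by (auto simp: S_def)
      then have "span (insert v X) = X" using max \<open>X \<subseteq> span (insert v X)\<close> by blast
      then have "v \<in> X" by (metis insertI1 span_base)
      then show False using nv by (auto intro: span_base)
    qed
  qed
  then have "span (X \<union> R) = Z" using sub by auto
  moreover have "finite X" "finite R" using XS(3) R(2) Z(2) by (auto intro: finite_subset)
  ultimately show ?thesis
    using that[of X] XS dim_sum_Int[of X R] R by (metis add.commute)
qed

definition "subspaces_between K Z = {Y. subspace Y \<and> K \<subseteq> Y \<and> Y \<subseteq> Z}"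

lemma finite_subspaces_between: "finite Z \<Longrightarrow> finite (subspaces_between K Z)"
  by (rule finite_subset[of _ "Pow Z"]) (auto simp: subspaces_between_def)

text \<open>The complement \<open>C\<close> plays the role of the quotient of \<open>Z\<close> by
  \<open>K\<close>; by the modular law, \<open>Y \<inter> C\<close> and
  \<open>span (K \<union> Y)\<close> are mutually inverse.\<close>

lemma card_subspaces_between_complement:
  assumes K: "subspace K" and Z: "subspace Z" "finite Z" and C: "subspace C" "C \<subseteq> Z"
    and KC: "K \<subseteq> Z" "K \<inter> C = {0}" "span (K \<union> C) = Z"
  shows "card {Y \<in> subspaces_between K Z. dim Y = dim K + k} = card {Y \<in> subspaces_between {0} C. dim Y = k}"
proof (rule bij_betw_same_card[where f = "\<lambda>Y. Y \<inter> C"], rule bij_betw_byWitness[where f' = "\<lambda>Y. span (K \<union> Y)"])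
  have fin: "finite K" "finite C" "\<And>Y. Y \<subseteq> Z \<Longrightarrow> finite Y" "\<And>Y. Y \<subseteq> C \<Longrightarrow> finite Y"
    using Z C KC finite_subset by (auto dest: finite_subset)
  have mod: "span (K \<union> (Y \<inter> C)) = Y" if "Y \<in> subspaces_between K Z" for Y
  proof
    have Y: "subspace Y" "K \<subseteq> Y" "Y \<subseteq> Z" using that by (auto simp: subspaces_between_def)
    show "span (K \<union> (Y \<inter> C)) \<subseteq> Y" using Y by (intro span_minimal) auto
    show "Y \<subseteq> span (K \<union> (Y \<inter> C))"
    proof
      fix y assume y: "y \<in> Y"
      then obtain a b where ab: "a \<in> K" "b \<in> C" "y = a + b"
        using Y KC span_Un_subspaces[OF K C(1)] by auto
      have "y - a \<in> Y" using y ab Y by (intro subspace_diff) auto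
      then have "b \<in> Y" using ab by simp
      then show "y \<in> span (K \<union> (Y \<inter> C))" using ab by (auto intro: span_add span_base)
    qed
  qed
  then show "\<forall>Y\<in>{Y \<in> subspaces_between K Z. dim Y = dim K + k}. span (K \<union> (Y \<inter> C)) = Y" by auto
  have mod': "span (K \<union> Y) \<inter> C = Y" if "Y \<in> subspaces_between {0} C" for Y
  proof
    have Y: "subspace Y" "Y \<subseteq> C" using that by (auto simp: subspaces_between_def)
    show "Y \<subseteq> span (K \<union> Y) \<inter> C" using Y by (auto intro: span_base)
    show "span (K \<union> Y) \<inter> C \<subseteq> Y"
    proof
      fix y assume y: "y \<in> span (K \<union> Y) \<inter> C"
      then obtain a b where ab: "a \<in> K" "b \<in> Y" "y = a + b"
        using span_Un_subspaces[OF K Y(1)] by auto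
      have "y - b \<in> C" using y ab Y C by (intro subspace_diff) auto
      then have "a \<in> C" using ab by simp
      then have "a = 0" using ab KC by auto
      then show "y \<in> Y" using ab by simp
    qed
  qed
  then show "\<forall>Y\<in>{Y \<in> subspaces_between {0} C. dim Y = k}. span (K \<union> Y) \<inter> C = Y" by auto
  have dim: "dim (span (K \<union> Y)) = dim K + dim Y" if "Y \<in> subspaces_between {0} C" for Y
  proof -
    have Y: "subspace Y" "Y \<subseteq> C" using that by (auto simp: subspaces_between_def)
    then have "K \<inter> Y = {0}" using KC K subspace_0 by blast
    then show ?thesis using dim_sum_Int[of K Y] K Y fin by (simp add: dim_eq_0_iff)
  qed
  show "(\<lambda>Y. Y \<inter> C) ` {Y \<in> subspaces_between K Z. dim Y = dim K + k} \<subseteq> {Y \<in> subspaces_between {0} C. dim Y = k}"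
  proof safe
    fix Y assume Y: "Y \<in> subspaces_between K Z" "dim Y = dim K + k"
    show *: "Y \<inter> C \<in> subspaces_between {0} C"
      using Y C by (auto simp: subspaces_between_def intro: subspace_inter subspace_0)
    show "dim (Y \<inter> C) = k" using dim[OF *] mod[OF Y(1)] Y(2) by simp
  qed
  show "(\<lambda>Y. span (K \<union> Y)) ` {Y \<in> subspaces_between {0} C. dim Y = k} \<subseteq> {Y \<in> subspaces_between K Z. dim Y = dim K + k}"
  proof safe
    fix Y assume Y: "Y \<in> subspaces_between {0} C"
    then have "span (K \<union> Y) \<subseteq> Z" using KC C Z by (intro span_minimal) (auto simp: subspaces_between_def)
    then show "span (K \<union> Y) \<in> subspaces_between K Z" by (auto simp: subspaces_between_def intro: span_base)
    show "dim (span (K \<union> Y)) = dim K + dim Y" by (rule dim[OF Y])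
  qed
qed

lemma exists_complement:
  assumes "subspace K" "subspace Z" "finite Z" "K \<subseteq> Z"
  obtains C where "subspace C" "C \<subseteq> Z" "K \<inter> C = {0}" "span (K \<union> C) = Z" "dim Z = dim K + dim C"
proof -
  have z: "{0} \<inter> K = {0}" using assms subspace_0 by auto
  obtain C where C: "subspace C" "C \<subseteq> Z" "C \<inter> K = {0} \<inter> K" "span (C \<union> K) = Z"
      "dim C + dim K = dim ({0} \<inter> K) + dim Z"
    using exists_relative_complement[OF assms(2,3,1,4), of "{0}"] assms subspace_0 subspace_single_0
    by (metis empty_subsetI insert_subset)
  show ?thesis
    by (rule that[of C]) (use C z dim_eq_0_iff[of "{0}"] in \<open>auto simp: Int_commute Un_commute\<close>)
qed

text \<open>Count pairs of a subspace and a nonzero vector in it. The subspaces containing a fixed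
  vector correspond to those of one dimension less in a complement of its line, which gives the
  recursion \<open>gbinom_Suc_Suc\<close>.\<close>

lemma card_subspaces:
  assumes "subspace Z" "finite Z"
  shows "real (card {Y \<in> subspaces_between {0} Z. dim Y = k}) = gbinom q (dim Z) k"
  using assms
proof (induction k arbitrary: Z)
  case 0
  have "{Y \<in> subspaces_between {0} Z. dim Y = 0} = {{0}}"
    using 0 dim_eq_0_iff[of "{0}"] subspace_0[OF 0(1)]
    by (auto simp: subspaces_between_def dim_eq_0_iff[OF _ finite_subset[OF _ 0(2)]])
  then show ?case by simp
next
  case (Suc k)
  let ?S = "{Y \<in> subspaces_between {0} Z. dim Y = Suc k}"
  have finS: "finite ?S" using Suc finite_subspaces_between by simp
  have zero: "0 \<in> Z" using Suc subspace_0 by auto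
  show ?case
  proof (cases "dim Z")
    case 0
    then have "Z = {0}" using dim_eq_0_iff Suc by blast
    then have "?S = {}" using dim_eq_0_iff[of "{0}"] subspace_0
      by (auto simp: subspaces_between_def subset_singleton_iff)
    then have "card ?S = 0" by (simp only: card.empty)
    then show ?thesis unfolding 0 by (simp only: gbinom_eq_0[OF zero_less_Suc] of_nat_0)
  next
    case (Suc m)
    have cnt: "real (card {Y \<in> ?S. v \<in> Y}) = gbinom q m k" if v: "v \<in> Z - {0}" for v
    proof -
      have svZ: "span {v} \<subseteq> Z" using v Suc.prems by (intro span_minimal) auto
      have dv: "dim (span {v}) = 1" using v by (simp add: dim_eq_card_independent)
      obtain C where C: "subspace C" "C \<subseteq> Z" "span {v} \<inter> C = {0}" "span (span {v} \<union> C) = Z"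
          "dim Z = dim (span {v}) + dim C"
        using exists_complement[OF subspace_span Suc.prems svZ] by blast
      have eq: "{Y \<in> ?S. v \<in> Y} = {Y \<in> subspaces_between (span {v}) Z. dim Y = dim (span {v}) + k}"
        unfolding dv using span_minimal[of "{v}"] span_base[of v "{v}"] subspace_0
        by (auto simp: subspaces_between_def)
      show ?thesis unfolding eq
        using card_subspaces_between_complement[OF subspace_span Suc.prems C(1,2) svZ C(3,4)]
          Suc.IH[of C] C Suc.prems Suc dv finite_subset[of C Z] by simp
    qed
    have "(\<Sum>Y\<in>?S. card {v \<in> Z - {0}. v \<in> Y}) = (\<Sum>v\<in>Z - {0}. card {Y \<in> ?S. v \<in> Y})"
      by (rule sum_multicount_gen) (use finS Suc.prems in auto)
    moreover have "card {v \<in> Z - {0}. v \<in> Y} = q ^ Suc k - 1" if "Y \<in> ?S" for Y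
    proof -
      have Y: "subspace Y" "Y \<subseteq> Z" "dim Y = Suc k" using that by (auto simp: subspaces_between_def)
      then have "{v \<in> Z - {0}. v \<in> Y} = Y - {0}" by auto
      moreover have "finite Y" using Y Suc.prems finite_subset by auto
      ultimately show ?thesis using Y subspace_0[OF Y(1)] by (simp add: card_subspace)
    qed
    ultimately have "card ?S * (q ^ Suc k - 1) = (\<Sum>v\<in>Z - {0}. card {Y \<in> ?S. v \<in> Y})" by simp
    then have "real (card ?S) * real (q ^ Suc k - 1) = (\<Sum>v\<in>Z - {0}. real (card {Y \<in> ?S. v \<in> Y}))"
      unfolding of_nat_mult[symmetric] of_nat_sum[symmetric] by (rule arg_cong)
    also have "\<dots> = real (card (Z - {0})) * gbinom q m k" using cnt by simp
    also have "card (Z - {0}) = q ^ Suc m - 1" using Suc zero Suc.prems by (simp add: card_subspace)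
    finally have "real (card ?S) * real (q ^ Suc k - 1) = real (q ^ Suc m - 1) * gbinom q m k" .
    moreover have "real (q ^ l - 1) = real q ^ l - 1" for l
      using q_ge_2 by (subst of_nat_diff) auto
    ultimately have "real (card ?S) * (real q ^ Suc k - 1) = (real q ^ Suc m - 1) * gbinom q m k"
      by (simp only:)
    moreover have "1 < real q ^ Suc k" using q_ge_2 by (intro one_less_power) auto
    ultimately show ?thesis unfolding Suc gbinom_Suc_Suc by (simp add: field_simps)
  qed
qed

lemma card_subspaces_between:
  assumes "subspace K" "subspace Z" "finite Z" "K \<subseteq> Z"
  shows "real (card {Y \<in> subspaces_between K Z. dim Y = dim K + k}) = gbinom q (dim Z - dim K) k"
proof -
  obtain C where C: "subspace C" "C \<subseteq> Z" "K \<inter> C = {0}" "span (K \<union> C) = Z" "dim Z = dim K + dim C"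
    using exists_complement[OF assms] by blast
  then show ?thesis
    using card_subspaces_between_complement[OF assms(1-3) C(1,2) assms(4) C(3,4)]
      card_subspaces[of C k] finite_subset[OF C(2) assms(3)] by simp
qed

lemma sum_subspaces_between:
  fixes h :: "nat \<Rightarrow> real"
  assumes "subspace K" "subspace Z" "finite Z" "K \<subseteq> Z"
  shows "(\<Sum>Y \<in> subspaces_between K Z. h (dim Y - dim K)) = (\<Sum>j\<le>dim Z - dim K. gbinom q (dim Z - dim K) j * h j)"
proof -
  have le: "dim K \<le> dim Y" "dim Y \<le> dim Z" if "Y \<in> subspaces_between K Z" for Y
    using that assms finite_subset[of Y Z] by (auto simp: subspaces_between_def intro!: dim_mono_finite)
  have "(\<Sum>Y \<in> subspaces_between K Z. h (dim Y - dim K)) =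
      (\<Sum>j\<le>dim Z - dim K. \<Sum>Y \<in> {Y \<in> subspaces_between K Z. dim Y - dim K = j}. h (dim Y - dim K))"
    using le by (intro sum.group[symmetric] finite_subspaces_between assms) (auto intro!: diff_le_mono)
  also have "\<dots> = (\<Sum>j\<le>dim Z - dim K. gbinom q (dim Z - dim K) j * h j)"
  proof (intro sum.cong refl)
    fix j
    have "{Y \<in> subspaces_between K Z. dim Y - dim K = j} = {Y \<in> subspaces_between K Z. dim Y = dim K + j}"
      using le by auto
    then show "(\<Sum>Y \<in> {Y \<in> subspaces_between K Z. dim Y - dim K = j}. h (dim Y - dim K)) =
        gbinom q (dim Z - dim K) j * h j"
      using card_subspaces_between[OF assms, of j] by simp
  qed
  finally show ?thesis .
qed

end

section \<open>The inverse Kazhdan--Lusztig polynomial of a vector matroid\<close>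

locale vector_matroid = vector_space_over_finite_field scale q
  for scale :: "'k::{field,finite} \<Rightarrow> 'v::ab_group_add \<Rightarrow> 'v" (infixr \<open>*s\<close> 75) and q :: nat +
  fixes V :: "'v set" and E :: "'a set" and vec :: "'a \<Rightarrow> 'v"
  assumes subspace_V: "subspace V" and finite_V: "finite V" and finite_E: "finite E"
    and vec_in_V: "vec ` E \<subseteq> V" and vec_nonzero: "\<And>e. e \<in> E \<Longrightarrow> vec e \<noteq> 0"
begin

definition M :: "'a matroid" where "M = Matroid E (\<lambda>X. dim (vec ` X))"
definition elems :: "'v set \<Rightarrow> 'a set" where "elems Z = {e \<in> E. vec e \<in> Z}"

lemma ground_M [simp]: "ground M = E" and rk_M: "rk M X = dim (vec ` X)"
  by (simp_all add: M_def)

lemma finite_vec_span: "X \<subseteq> E \<Longrightarrow> finite (span (vec ` X))"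
  using finite_E finite_subset by (intro finite_span) auto

lemma is_matroid_M: "is_matroid M"
  unfolding is_matroid_def
proof (intro conjI allI impI)
  fix X assume X: "X \<subseteq> ground M"
  then have fin: "finite X" using finite_E finite_subset by auto
  then have "dim (vec ` X) \<le> card (vec ` X)" by (intro dim_le_card) (auto intro: span_base)
  also have "\<dots> \<le> card X" using fin by (rule card_image_le)
  finally show "rk M X \<le> card X" by (simp add: rk_M)
next
  fix X Y assume XY: "X \<subseteq> Y \<and> Y \<subseteq> ground M"
  then have "dim (span (vec ` X)) \<le> dim (span (vec ` Y))"
    by (intro dim_mono_finite span_mono finite_vec_span) auto
  then show "rk M X \<le> rk M Y" by (simp add: rk_M)
next
  fix X Y assume XY: "X \<subseteq> ground M \<and> Y \<subseteq> ground M"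
  let ?A = "span (vec ` X)" and ?B = "span (vec ` Y)"
  have fin: "finite ?A" "finite ?B" using XY by (auto intro: finite_vec_span)
  have "span (vec ` (X \<union> Y)) = span (?A \<union> ?B)"
    by (simp add: image_Un span_Un span_span)
  moreover have "dim (span (vec ` (X \<inter> Y))) \<le> dim (?A \<inter> ?B)"
    using fin span_mono[of "vec ` (X \<inter> Y)" "vec ` X"] span_mono[of "vec ` (X \<inter> Y)" "vec ` Y"]
    by (intro dim_mono_finite subspace_inter) auto
  ultimately show "rk M (X \<union> Y) + rk M (X \<inter> Y) \<le> rk M X + rk M Y"
    using dim_sum_Int[of ?A ?B] fin unfolding rk_M by (metis add_left_mono dim_span subspace_span)
qed (use finite_E in auto)

lemma elems_flat:
  assumes "subspace Z"
  shows "elems Z \<in> flats M"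
  unfolding flats_def
proof (intro CollectI conjI ballI)
  fix e assume e: "e \<in> ground M - elems Z"
  have sub: "span (vec ` elems Z) \<subseteq> Z" using assms by (intro span_minimal) (auto simp: elems_def)
  have "span (vec ` elems Z) \<subset> span (vec ` insert e (elems Z))"
  proof
    show "span (vec ` elems Z) \<subseteq> span (vec ` insert e (elems Z))" by (intro span_mono) auto
    have "vec e \<in> span (vec ` insert e (elems Z))" by (intro span_base) auto
    then show "span (vec ` elems Z) \<noteq> span (vec ` insert e (elems Z))"
      using e sub by (auto simp: elems_def)
  qed
  moreover have "finite (span (vec ` insert e (elems Z)))"
    using e by (intro finite_vec_span) (auto simp: elems_def)
  ultimately have "dim (span (vec ` elems Z)) < dim (span (vec ` insert e (elems Z)))"
    by (intro dim_strict_mono) auto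
  then show "rk M (elems Z) < rk M (insert e (elems Z))" by (simp add: rk_M)
qed (auto simp: elems_def)

lemma elems_span_flat:
  assumes "F \<in> flats M"
  shows "elems (span (vec ` F)) = F"
proof
  show "elems (span (vec ` F)) \<subseteq> F"
  proof
    fix e assume e: "e \<in> elems (span (vec ` F))"
    then have "span (vec ` insert e F) = span (vec ` F)"
      by (auto simp: elems_def span_redundant)
    then have "rk M (insert e F) = rk M F" unfolding rk_M by (metis dim_span)
    then show "e \<in> F" using assms e by (force simp: flats_def elems_def)
  qed
  show "F \<subseteq> elems (span (vec ` F))" using assms by (auto simp: flats_def elems_def intro: span_base)
qed

lemma subset_elems_iff: "F \<subseteq> E \<Longrightarrow> subspace Z \<Longrightarrow> F \<subseteq> elems Z \<longleftrightarrow> span (vec ` F) \<subseteq> Z"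
  using span_minimal[of "vec ` F" Z] span_superset[of "vec ` F"] by (auto simp: elems_def)

lemma elems_0: "elems {0} = {}"
  using vec_nonzero by (auto simp: elems_def)

sublocale mat: loopless_matroid M
  using is_matroid_M elems_flat[of "{0}"] elems_0 by unfold_locales auto

lemma rk_flat: "rk M F = dim (span (vec ` F))"
  by (simp add: rk_M)

section \<open>Transfer to the lattice of subspaces\<close>

abbreviation "subs Z \<equiv> subspaces_between {0} Z"

lemma subs_iff: "Y \<in> subs Z \<longleftrightarrow> subspace Y \<and> Y \<subseteq> Z"
  by (auto simp: subspaces_between_def subspace_0)

lemma subs_V: "Z \<in> subs V \<Longrightarrow> Y \<in> subs Z \<Longrightarrow> Y \<in> subs V"
  by (auto simp: subs_iff)

lemma finite_sub: "Z \<in> subs V \<Longrightarrow> finite Z"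
  using finite_V finite_subset by (auto simp: subs_iff)

lemma finite_subs [simp]: "Z \<in> subs V \<Longrightarrow> finite (subs Z)"
  by (simp add: finite_sub finite_subspaces_between)

lemma finite_subs_V [simp]: "finite (subs V)"
  by (simp add: finite_V finite_subspaces_between)

definition \<rho> :: "'v set \<Rightarrow> nat" where "\<rho> Z = rk M (elems Z)"

definition core :: "'v set \<Rightarrow> 'v set" where "core Z = span (vec ` elems Z)"

lemma \<rho>_core: "\<rho> Z = dim (core Z)"
  by (simp add: \<rho>_def core_def rk_M)

lemma core_subset: "subspace Z \<Longrightarrow> core Z \<subseteq> Z"
  unfolding core_def by (rule span_minimal) (auto simp: elems_def)

lemma subspace_core [simp]: "subspace (core Z)"
  by (simp add: core_def)

lemma core_in_subs: "Z \<in> subs V \<Longrightarrow> core Z \<in> subs Z" "Z \<in> subs V \<Longrightarrow> core Z \<in> subs V"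
  using core_subset by (auto simp: subs_iff)

lemma elems_core: "subspace Z \<Longrightarrow> elems (core Z) = elems Z"
  unfolding core_def by (intro elems_span_flat elems_flat)

lemma \<rho>_le_dim: "Z \<in> subs V \<Longrightarrow> \<rho> Z \<le> dim Z"
  unfolding \<rho>_core using finite_sub[of Z] core_subset[of Z]
  by (intro dim_mono_finite) (auto simp: subs_iff)

lemma dim_subs: "Z \<in> subs V \<Longrightarrow> Y \<in> subs Z \<Longrightarrow> dim Y \<le> dim Z"
  using finite_sub[of Z] by (intro dim_mono_finite) (auto simp: subs_iff)

text \<open>In terms of \<open>S\<close> and \<open>p\<close> above, \<open>T Z = (-1) ^ dim Z * S(Z)\<close> and \<open>pal K = (-1) ^ dim K * p(K)\<close>;
  with these signs the two are related by plain summation and Moebius inversion.\<close>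

definition T :: "'v set \<Rightarrow> int poly" where
  "T Z = monom 1 (dim Z - \<rho> Z) * mat.g (elems Z)"

definition pal :: "'v set \<Rightarrow> int poly" where
  "pal K = (\<Sum>Z \<in> subs K. T Z)"

definition subspace_mu :: "nat \<Rightarrow> int" where "subspace_mu n = (-1) ^ n * int q ^ (n choose 2)"

lemma sum_subspace_mu:
  assumes "subspace Y" "subspace Z" "finite Z" "Y \<subseteq> Z"
  shows "(\<Sum>K \<in> subspaces_between Y Z. subspace_mu (dim Z - dim K)) = (if Y = Z then 1 else 0)"
proof (cases "Y = Z")
  case True
  then have "subspaces_between Y Z = {Z}" using assms by (auto simp: subspaces_between_def)
  then show ?thesis using True by (simp add: subspace_mu_def numeral_2_eq_2)
next
  case False
  define n where "n = dim Z - dim Y"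
  have "n > 0" using dim_strict_mono[of Y Z] assms False by (auto simp: n_def)
  then obtain m where m: "n = Suc m" by (cases n) auto
  have le: "dim Y \<le> dim K" if "K \<in> subspaces_between Y Z" for K
    using that assms finite_subset[of K Z] by (auto simp: subspaces_between_def intro!: dim_mono_finite)
  have "real_of_int (\<Sum>K \<in> subspaces_between Y Z. subspace_mu (dim Z - dim K)) =
      (\<Sum>K \<in> subspaces_between Y Z. real_of_int (subspace_mu (n - (dim K - dim Y))))"
    unfolding of_int_sum using le by (intro sum.cong refl) (auto simp: n_def)
  also have "\<dots> = (\<Sum>j\<le>n. gbinom q n j * real_of_int (subspace_mu (n - j)))"
    unfolding n_def by (rule sum_subspaces_between[OF assms])
  also have "\<dots> = (-1) ^ n * (\<Sum>j\<le>n. (-1) ^ j * gbinom q n j * q ^ ((n - j) choose 2))"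
  proof -
    have "gbinom q n j * real_of_int (subspace_mu (n - j)) = (-1) ^ n * ((-1) ^ j * gbinom q n j * q ^ ((n - j) choose 2))"
      if "j \<le> n" for j
    proof -
      have "(-1::real) ^ n * (-1) ^ j = (-1) ^ (n - j)"
        using that by (simp add: power_add[symmetric] minus_one_power_iff)
      then show ?thesis by (simp add: subspace_mu_def algebra_simps)
    qed
    then show ?thesis unfolding sum_distrib_left by (intro sum.cong refl) auto
  qed
  \<comment> \<open>The full sum is the case \<open>k = n\<close> of the truncated formula, whose
    right side then contains a Gaussian binomial with lower index above the upper one.\<close>
  also have "(\<Sum>j\<le>n. (-1) ^ j * gbinom q n j * q ^ ((n - j) choose 2)) = 0"
    unfolding m of_nat_power using q_ge_2 by (subst gbinom_alternating_sum) (auto simp: gbinom_eq_0)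
  finally show ?thesis using False by (simp only: mult_zero_right of_int_eq_0_iff if_False)
qed

lemma sum_subs_swap:
  assumes "Z \<in> subs V"
  shows "(\<Sum>K \<in> subs Z. \<Sum>Y \<in> subs K. h Y K) = (\<Sum>Y \<in> subs Z. \<Sum>K \<in> subspaces_between Y Z. h Y K)"
proof -
  have "(\<Sum>K \<in> subs Z. \<Sum>Y \<in> subs K. h Y K) = (\<Sum>K \<in> subs Z. \<Sum>Y \<in> {Y \<in> subs Z. Y \<subseteq> K}. h Y K)"
  proof (rule sum.cong[OF refl])
    fix K assume "K \<in> subs Z"
    then have "subs K = {Y \<in> subs Z. Y \<subseteq> K}" unfolding subs_iff set_eq_iff mem_Collect_eq by blast
    then show "(\<Sum>Y \<in> subs K. h Y K) = (\<Sum>Y \<in> {Y \<in> subs Z. Y \<subseteq> K}. h Y K)" by simp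
  qed
  also have "\<dots> = (\<Sum>Y \<in> subs Z. \<Sum>K \<in> {K \<in> subs Z. Y \<subseteq> K}. h Y K)"
    using assms by (intro sum.swap_restrict) auto
  also have "\<dots> = (\<Sum>Y \<in> subs Z. \<Sum>K \<in> subspaces_between Y Z. h Y K)"
    by (intro sum.cong refl) (auto simp: subs_iff subspaces_between_def)
  finally show ?thesis .
qed

lemma T_eq_sum:
  assumes "Z \<in> subs V"
  shows "T Z = (\<Sum>K \<in> subs Z. [:subspace_mu (dim Z - dim K):] * pal K)"
proof -
  have Z: "subspace Z" "finite Z" using assms finite_sub by (auto simp: subs_iff)
  have "(\<Sum>K \<in> subs Z. [:subspace_mu (dim Z - dim K):] * pal K) =
      (\<Sum>K \<in> subs Z. \<Sum>Y \<in> subs K. [:subspace_mu (dim Z - dim K):] * T Y)"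
    unfolding pal_def sum_distrib_left ..
  also have "\<dots> = (\<Sum>Y \<in> subs Z. \<Sum>K \<in> subspaces_between Y Z. [:subspace_mu (dim Z - dim K):] * T Y)"
    by (rule sum_subs_swap[OF assms])
  also have "\<dots> = (\<Sum>Y \<in> subs Z. if Y = Z then T Z else 0)"
    unfolding sum_distrib_right[symmetric] sum_const_poly
    using sum_subspace_mu Z by (intro sum.cong refl) (auto simp: subs_iff one_pCons[symmetric])
  also have "\<dots> = T Z" using Z assms by (subst sum.delta) (auto simp: subs_iff)
  finally show ?thesis ..
qed

lemma sum_monom_symmetric:
  assumes "subspace Y" "subspace Z" "finite Z" "Y \<subseteq> Z"
  shows "(\<Sum>K \<in> subspaces_between Y Z. monom (1::int) (dim K - dim Y)) =
    (\<Sum>K \<in> subspaces_between Y Z. monom 1 (dim Z - dim K))"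
proof (rule poly_eqI)
  fix j
  let ?I = "subspaces_between Y Z"
  have fin: "finite ?I" using assms finite_subspaces_between by auto
  have le: "dim Y \<le> dim K" "dim K \<le> dim Z" if "K \<in> ?I" for K
    using that assms finite_subset[of K Z] by (auto simp: subspaces_between_def intro!: dim_mono_finite)
  have YZ: "dim Y \<le> dim Z" using assms by (intro dim_mono_finite)
  have "card {K \<in> ?I. dim K - dim Y = j} = card {K \<in> ?I. dim Z - dim K = j}"
  proof (cases "j \<le> dim Z - dim Y")
    case True
    have "{K \<in> ?I. dim K - dim Y = j} = {K \<in> ?I. dim K = dim Y + j}" using le by auto
    moreover have "{K \<in> ?I. dim Z - dim K = j} = {K \<in> ?I. dim K = dim Y + (dim Z - dim Y - j)}"
      using le True YZ by force
    moreover have "real (card {K \<in> ?I. dim K = dim Y + (dim Z - dim Y - j)}) = real (card {K \<in> ?I. dim K = dim Y + j})"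
      unfolding card_subspaces_between[OF assms] using q_ge_2 True by (intro gbinom_symmetric) auto
    ultimately show ?thesis by simp
  next
    case False
    then have "{K \<in> ?I. dim K - dim Y = j} = {}" "{K \<in> ?I. dim Z - dim K = j} = {}"
      using le diff_le_mono diff_le_mono2 by fastforce+
    then show ?thesis by (simp only: card.empty)
  qed
  moreover have "(\<Sum>K \<in> ?I. if f K = j then 1 else 0) = int (card {K \<in> ?I. f K = j})" for f :: "'v set \<Rightarrow> nat"
    using fin by (simp add: sum.If_cases Collect_conj_eq[symmetric] Int_def conj_commute)
  ultimately show "coeff (\<Sum>K \<in> ?I. monom (1::int) (dim K - dim Y)) j = coeff (\<Sum>K \<in> ?I. monom 1 (dim Z - dim K)) j"
    by (simp add: coeff_sum)
qed

text \<open>By the decomposition of \<open>mat.g\<close>, \<open>T Z\<close> is the sum over the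
  flats \<open>G\<close> inside \<open>Z\<close> of \<open>v G\<close> times \<open>t\<close> to the
  power \<open>dim Z - rk M G\<close>. After exchanging sums, \<open>v G\<close> is multiplied by a
  sum over the interval from the span of \<open>G\<close> to \<open>K\<close>. Reversal replaces the
  exponent by \<open>dim K - dim Z\<close>, which permutes the terms of this inner sum.\<close>

lemma rev_poly_pal:
  assumes "K \<in> subs V"
  shows "rev_poly (dim K) (pal K) = pal K"
proof -
  obtain v where v: "\<And>H. H \<in> flats M \<Longrightarrow> mat.g H = (\<Sum>G \<in> {G \<in> flats M. G \<subseteq> H}. monom 1 (rk M H - rk M G) * v G)"
    and v': "\<And>H. H \<in> flats M \<Longrightarrow> rev_poly (rk M H) (mat.g H) = (\<Sum>G \<in> {G \<in> flats M. G \<subseteq> H}. v G)"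
    using mat.exists_palindromic_decomposition by blast
  have K: "subspace K" "finite K" "elems K \<in> flats M"
    using assms finite_sub elems_flat by (auto simp: subs_iff)
  let ?F = "{G \<in> flats M. G \<subseteq> elems K}"
  let ?h = "\<lambda>G. span (vec ` G)"
  have hG: "subspace (?h G)" "?h G \<subseteq> K" "dim (?h G) = rk M G" if "G \<in> ?F" for G
    using that subset_elems_iff[of G K] K by (auto simp: rk_M flats_def)
  have swap: "(\<Sum>Z \<in> subs K. \<Sum>G \<in> {G \<in> flats M. G \<subseteq> elems Z}. h Z G) = (\<Sum>G \<in> ?F. \<Sum>Z \<in> subspaces_between (?h G) K. h Z G)"
    for h :: "'v set \<Rightarrow> 'a set \<Rightarrow> int poly"
  proof -
    have "(\<Sum>Z \<in> subs K. \<Sum>G \<in> {G \<in> flats M. G \<subseteq> elems Z}. h Z G) =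
        (\<Sum>Z \<in> subs K. \<Sum>G \<in> {G \<in> ?F. G \<subseteq> elems Z}. h Z G)"
      by (intro sum.cong refl) (auto simp: subs_iff elems_def)
    also have "\<dots> = (\<Sum>G \<in> ?F. \<Sum>Z \<in> {Z \<in> subs K. G \<subseteq> elems Z}. h Z G)"
      using assms by (intro sum.swap_restrict) auto
    also have "\<dots> = (\<Sum>G \<in> ?F. \<Sum>Z \<in> subspaces_between (?h G) K. h Z G)"
    proof (intro sum.cong refl)
      fix G Z assume "G \<in> ?F"
      then have "G \<subseteq> E" by (auto simp: flats_def)
      then show "{Z \<in> subs K. G \<subseteq> elems Z} = subspaces_between (?h G) K"
        using subset_elems_iff[of G] by (auto simp: subs_iff subspaces_between_def subspace_0)
    qed
    finally show ?thesis .
  qed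
  have "rev_poly (dim K) (pal K) = (\<Sum>Z \<in> subs K. rev_poly (dim K) (T Z))"
    by (simp add: pal_def rev_poly_sum)
  also have "\<dots> = (\<Sum>Z \<in> subs K. \<Sum>G \<in> {G \<in> flats M. G \<subseteq> elems Z}. v G * monom 1 (dim K - dim Z))"
  proof (intro sum.cong refl)
    fix Z assume Z: "Z \<in> subs K"
    have Z': "Z \<in> subs V" using Z assms subs_V by blast
    have fl: "elems Z \<in> flats M" using Z by (intro elems_flat) (auto simp: subs_iff)
    have le: "\<rho> Z \<le> dim Z" "dim Z \<le> dim K" using \<rho>_le_dim[OF Z'] dim_subs[OF assms Z] by auto
    have deg: "degree (mat.g (elems Z)) \<le> \<rho> Z" using mat.degree_g(1)[OF fl] by (simp add: \<rho>_def)
    have e: "dim K - (dim Z - \<rho> Z) = (dim K - dim Z) + \<rho> Z" using le by simp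
    have "rev_poly (dim K) (T Z) = rev_poly ((dim K - dim Z) + \<rho> Z) (1 * mat.g (elems Z))"
      unfolding T_def using le deg by (subst rev_poly_monom_mult) (auto simp: e)
    also have "\<dots> = rev_poly (dim K - dim Z) 1 * rev_poly (\<rho> Z) (mat.g (elems Z))"
      using deg by (intro rev_poly_mult) auto
    also have "rev_poly n 1 = monom 1 n" for n
      by (rule poly_eqI) (auto simp: coeff_rev_poly)
    finally show "rev_poly (dim K) (T Z) = (\<Sum>G \<in> {G \<in> flats M. G \<subseteq> elems Z}. v G * monom 1 (dim K - dim Z))"
      using v'[OF fl] by (simp add: \<rho>_def sum_distrib_left mult.commute)
  qed
  also have "\<dots> = (\<Sum>G \<in> ?F. v G * (\<Sum>Z \<in> subspaces_between (?h G) K. monom 1 (dim K - dim Z)))"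
    unfolding swap sum_distrib_left ..
  also have "\<dots> = (\<Sum>G \<in> ?F. v G * (\<Sum>Z \<in> subspaces_between (?h G) K. monom 1 (dim Z - rk M G)))"
    using sum_monom_symmetric[OF hG(1) K(1,2) hG(2)] hG(3) by (intro sum.cong refl) auto
  also have "\<dots> = (\<Sum>Z \<in> subs K. \<Sum>G \<in> {G \<in> flats M. G \<subseteq> elems Z}. v G * monom 1 (dim Z - rk M G))"
    unfolding swap sum_distrib_left ..
  also have "\<dots> = pal K"
    unfolding pal_def
  proof (intro sum.cong refl)
    fix Z assume Z: "Z \<in> subs K"
    have Z': "Z \<in> subs V" using Z assms subs_V by blast
    have fl: "elems Z \<in> flats M" using Z by (intro elems_flat) (auto simp: subs_iff)
    have "monom (1::int) (dim Z - \<rho> Z) * monom 1 (\<rho> Z - rk M G) = monom 1 (dim Z - rk M G)"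
      if "G \<in> flats M" "G \<subseteq> elems Z" for G
      using \<rho>_le_dim[OF Z'] mat.rank_flat_mono[OF that(2) fl] by (simp add: mult_monom \<rho>_def)
    then show "(\<Sum>G \<in> {G \<in> flats M. G \<subseteq> elems Z}. v G * monom 1 (dim Z - rk M G)) = T Z"
      unfolding T_def v[OF fl] sum_distrib_left
      by (intro sum.cong refl) (auto simp: \<rho>_def mult.assoc[symmetric] mult.commute)
  qed
  finally show ?thesis .
qed

section \<open>Free subspaces and the support of the palindromic polynomials\<close>

definition free_subs :: "nat \<Rightarrow> 'v set \<Rightarrow> 'v set set" where
  "free_subs j Z = {X \<in> subs Z. elems X = {} \<and> dim X = j}"

lemma elems_mono: "X \<subseteq> Y \<Longrightarrow> elems X \<subseteq> elems Y"
  by (auto simp: elems_def)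

text \<open>All elements in \<open>Z\<close> lie in \<open>core Z\<close>, so an extension that
  meets \<open>core Z\<close> no further than \<open>X0\<close> stays free. A free subspace of
  \<open>core Z\<close> thus gains \<open>dim Z - \<rho> Z\<close> dimensions.\<close>

lemma free_extension:
  assumes Z: "Z \<in> subs V" and X0: "X0 \<in> subs Z" "elems X0 = {}"
  obtains X where "X \<in> subs Z" "X0 \<subseteq> X" "elems X = {}" "X \<inter> core Z = X0 \<inter> core Z"
    "span (X \<union> core Z) = Z" "dim X + \<rho> Z = dim (X0 \<inter> core Z) + dim Z"
proof -
  obtain X where X: "subspace X" "X0 \<subseteq> X" "X \<subseteq> Z" "X \<inter> core Z = X0 \<inter> core Z" "span (X \<union> core Z) = Z"
    "dim X + dim (core Z) = dim (X0 \<inter> core Z) + dim Z"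
    using exists_relative_complement[of Z "core Z" X0] assms finite_sub core_in_subs(1)[OF Z]
    by (metis subs_iff)
  have "elems X = {}"
  proof -
    have "elems X \<subseteq> elems (core Z)"
      using X Z elems_mono[of X Z] elems_core[of Z] by (auto simp: subs_iff)
    then have "elems X \<subseteq> elems (X \<inter> core Z)" by (auto simp: elems_def)
    also have "\<dots> \<subseteq> elems X0" unfolding X(4) by (rule elems_mono) auto
    finally show ?thesis using X0 by auto
  qed
  with X that show ?thesis by (auto simp: subs_iff \<rho>_core)
qed

lemma free_subs_smaller:
  assumes "Z \<in> subs V" "X \<in> free_subs j Z" "i \<le> j"
  obtains Y where "Y \<in> free_subs i X" "Y \<in> free_subs i Z"
proof -
  have X: "subspace X" "X \<subseteq> Z" "elems X = {}" "dim X = j" "finite X"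
    using assms finite_sub[of X] subs_V[of Z X] by (auto simp: free_subs_def subs_iff)
  have "1 \<le> gbinom q (dim X) i" using X assms q_ge_2 by (intro gbinom_mono_bound(3)) auto
  then have "card {Y \<in> subs X. dim Y = i} \<noteq> 0"
    using card_subspaces[OF X(1,5), of i] by (metis of_nat_0 not_one_le_zero)
  then have "{Y \<in> subs X. dim Y = i} \<noteq> {}" by (metis card.empty)
  then obtain Y where Y: "Y \<in> subs X" "dim Y = i" by blast
  then have "elems Y = {}" using X elems_mono[of Y X] by (auto simp: subs_iff)
  then show ?thesis using that[of Y] X Y by (auto simp: free_subs_def subs_iff)
qed

text \<open>Here the shifting factor of \<open>T\<close> is 1, so \<open>T Z\<close> is up to sign
  the inverse polynomial of the elements in \<open>Z\<close> and inherits its strict degree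
  bound.\<close>

lemma core_eq_imp_degree_T:
  assumes Z: "Z \<in> subs V" and "core Z = Z" "Z \<noteq> {0}"
  shows "2 * degree (T Z) < dim Z"
proof -
  have fl: "elems Z \<in> flats M" using Z by (intro elems_flat) (auto simp: subs_iff)
  have \<rho>: "\<rho> Z = dim Z" by (simp add: \<rho>_core assms)
  have "dim Z \<noteq> 0" using dim_eq_0_iff[of Z] Z finite_sub[OF Z] assms(3) by (auto simp: subs_iff)
  then have "elems Z \<noteq> {}" using \<rho> mat.rank_empty by (auto simp: \<rho>_def)
  then show ?thesis using mat.degree_g(2)[OF fl] \<rho> by (simp add: T_def monom_0 one_pCons[symmetric] \<rho>_def)
qed

lemma T_0: "T {0} = 1"
proof -
  have "\<rho> {0} = 0" by (simp add: \<rho>_def elems_0 mat.rank_empty)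
  then show ?thesis using mat.degree_g(3)[OF mat.empty_flat] by (simp add: T_def elems_0 monom_0 one_pCons)
qed

lemma pal_0: "pal {0} = 1"
proof -
  have "subs {0} = {{0}}" by (auto simp: subs_iff subspace_0)
  then show ?thesis by (simp add: pal_def T_0)
qed

lemma T_eq_T_core:
  assumes Z: "Z \<in> subs V"
  shows "T Z = monom 1 (dim Z - \<rho> Z) * T (core Z)"
proof -
  have "elems (core Z) = elems Z" using Z by (intro elems_core) (auto simp: subs_iff)
  then have "core (core Z) = core Z" "\<rho> (core Z) = \<rho> Z" by (simp_all add: core_def \<rho>_def)
  then have "T (core Z) = mat.g (elems Z)"
    using \<open>elems (core Z) = elems Z\<close> by (simp add: T_def \<rho>_core[symmetric] monom_0 one_pCons[symmetric])
  then show ?thesis by (simp add: T_def)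
qed

lemma coeff_T:
  assumes "Z \<in> subs V"
  shows "coeff (T Z) j = (\<Sum>K \<in> subs Z. subspace_mu (dim Z - dim K) * coeff (pal K) j)"
  by (simp add: T_eq_sum[OF assms] coeff_sum)

lemma coeff_pal_eq:
  assumes Z: "Z \<in> subs V"
  shows "coeff (pal Z) j = coeff (T Z) j - (\<Sum>K \<in> subs Z - {Z}. subspace_mu (dim Z - dim K) * coeff (pal K) j)"
proof -
  have "Z \<in> subs Z" using Z by (auto simp: subs_iff)
  then have "(\<Sum>K \<in> subs Z. subspace_mu (dim Z - dim K) * coeff (pal K) j) =
      coeff (pal Z) j + (\<Sum>K \<in> subs Z - {Z}. subspace_mu (dim Z - dim K) * coeff (pal K) j)"
    using Z by (subst sum.remove[of _ Z]) (auto simp: subspace_mu_def numeral_2_eq_2)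
  then show ?thesis by (simp add: coeff_T[OF Z])
qed

lemma coeff_pal_symmetric:
  assumes "Z \<in> subs V"
  shows "coeff (pal Z) j = (if j \<le> dim Z then coeff (pal Z) (dim Z - j) else 0)"
  using rev_poly_pal[OF assms] by (metis coeff_rev_poly)

lemma coeff_T_core:
  assumes Z: "Z \<in> subs V"
  shows "coeff (T Z) j = (if dim Z - \<rho> Z \<le> j then coeff (T (core Z)) (j - (dim Z - \<rho> Z)) else 0)"
  by (simp only: T_eq_T_core[OF Z] coeff_monom_1_mult)

lemma proper_sub_dim:
  assumes "Z \<in> subs V" "K \<in> subs Z - {Z}"
  shows "dim K < dim Z" "K \<in> subs V"
  using assms finite_sub[OF assms(1)] by (auto simp: subs_iff intro!: dim_strict_mono)

text \<open>In degrees at least \<open>dim Z / 2\<close> the degree bound on \<open>Q\<close> expresses the coefficients of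
  \<open>pal Z\<close> by those of proper subspaces; the lower degrees follow by symmetry. If the elements in
  \<open>Z\<close> do not span \<open>Z\<close>, free subspaces of their span \<open>core Z\<close> extend to larger ones in \<open>Z\<close>,
  which accounts for the factor \<open>t ^ (dim Z - \<rho> Z)\<close>.\<close>

lemma coeff_pal_nonzero_imp_free_subs:
  assumes "Z \<in> subs V" "coeff (pal Z) j \<noteq> 0"
  shows "free_subs j Z \<noteq> {}"
  using assms
proof (induction "dim Z" arbitrary: Z j rule: less_induct)
  case less
  note Z = less.prems(1)
  have IH: "free_subs j K \<noteq> {}" if "K \<in> subs Z - {Z}" "coeff (pal K) j \<noteq> 0" for K j
    using less.hyps[of K j] that proper_sub_dim[OF Z that(1)] by blast
  have sub: "free_subs j K \<subseteq> free_subs j Z" if "K \<in> subs Z" for K j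
    using that by (auto simp: free_subs_def subs_iff)
  show ?case
  proof (cases "Z = {0}")
    case True
    then have "j = 0" using less.prems by (auto simp: pal_0 coeff_eq_0 split: if_splits)
    then have "{0} \<in> free_subs j Z" using True by (auto simp: free_subs_def subs_iff elems_0)
    then show ?thesis by auto
  next
    case False
    have T: "free_subs j Z \<noteq> {}" if "dim Z \<le> 2 * j" "coeff (T Z) j \<noteq> 0" for j
    proof (cases "core Z = Z")
      case True
      then show ?thesis using core_eq_imp_degree_T[OF Z True False] that coeff_eq_0[of "T Z" j] by simp
    next
      case neq: False
      define i where "i = j - (dim Z - \<rho> Z)"
      have i: "dim Z - \<rho> Z \<le> j" "coeff (T (core Z)) i \<noteq> 0"
        using that(2) by (auto simp: coeff_T_core[OF Z] i_def split: if_splits)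
      have cV: "core Z \<in> subs V" "core Z \<in> subs Z" using core_in_subs[OF Z] by auto
      obtain K where K: "K \<in> subs (core Z)" "coeff (pal K) i \<noteq> 0"
        using i(2) unfolding coeff_T[OF cV(1)] by (metis (no_types, lifting) mult_zero_right sum.neutral)
      have "K \<in> subs Z - {Z}" using K neq cV(2) by (auto simp: subs_iff)
      then obtain X0 where X0: "X0 \<in> free_subs i K" using IH[OF _ K(2)] by auto
      then have X0': "X0 \<in> subs Z" "elems X0 = {}" "X0 \<inter> core Z = X0" "dim X0 = i"
        using K cV by (auto simp: free_subs_def subs_iff)
      obtain X where X: "X \<in> subs Z" "elems X = {}" "dim X + \<rho> Z = dim (X0 \<inter> core Z) + dim Z"
        using free_extension[OF Z X0'(1,2)] by metis
      then have "dim X = j" using X0' i \<rho>_le_dim[OF Z] by (simp add: i_def)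
      then show ?thesis using X by (auto simp: free_subs_def)
    qed
    have high: "free_subs j Z \<noteq> {}" if ge: "dim Z \<le> 2 * j" and ne: "coeff (pal Z) j \<noteq> 0" for j
    proof (cases "coeff (T Z) j = 0")
      case True
      then obtain K where "K \<in> subs Z - {Z}" "coeff (pal K) j \<noteq> 0"
        using ne unfolding coeff_pal_eq[OF Z] by (metis (no_types, lifting) mult_zero_right sum.neutral diff_self)
      then show ?thesis using IH[of K j] sub[of K j] by auto
    qed (use T ge in blast)
    show ?thesis
    proof (cases "dim Z \<le> 2 * j")
      case True
      then show ?thesis using high less.prems by blast
    next
      case False
      then have "coeff (pal Z) (dim Z - j) \<noteq> 0"
        using less.prems(2) coeff_pal_symmetric[OF Z, of j] by (auto split: if_splits)
      moreover have "dim Z \<le> 2 * (dim Z - j)" using False by linarith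
      ultimately obtain X where "X \<in> free_subs (dim Z - j) Z" using high by blast
      then show ?thesis using free_subs_smaller[OF Z, of X "dim Z - j" j] False by force
    qed
  qed
qed

text \<open>All subspaces \<open>X\<close> of \<open>Y\<close> have
  \<open>T X = monom 1 (dim X)\<close>, so only \<open>Y\<close> itself reaches the top
  degree.\<close>

lemma pal_free:
  assumes Y: "Y \<in> subs V" "elems Y = {}"
  shows "coeff (pal Y) (dim Y) = 1"
proof -
  have T: "T X = monom 1 (dim X)" if "X \<in> subs Y" for X
  proof -
    have "elems X = {}" using that Y elems_mono[of X Y] by (auto simp: subs_iff)
    moreover from this have "\<rho> X = 0" by (simp add: \<rho>_def mat.rank_empty)
    ultimately show ?thesis using mat.degree_g(3)[OF mat.empty_flat] by (simp add: T_def)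
  qed
  have "coeff (pal Y) (dim Y) = (\<Sum>X \<in> subs Y. if X = Y then 1 else 0)"
    unfolding pal_def coeff_sum
  proof (intro sum.cong refl)
    fix X assume X: "X \<in> subs Y"
    then show "coeff (T X) (dim Y) = (if X = Y then 1 else 0)"
      using proper_sub_dim[OF Y(1), of X] by (cases "X = Y") (auto simp: T)
  qed
  also have "\<dots> = 1" using Y by (subst sum.delta) (auto simp: subs_iff)
  finally show ?thesis .
qed

text \<open>Two facts enter \<open>coeff_pal_eq\<close> when \<open>Z\<close> is larger than
  \<open>Y\<close>. The coefficient of \<open>T Z\<close> vanishes, because a nonzero one would let
  a free subspace of \<open>core Z\<close> be extended in two ways. By induction, a proper subspace
  contributes its Moebius value exactly if it contains \<open>Y\<close>, and these values sum to -1,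
  being those of the interval above \<open>Y\<close> without its top.\<close>

lemma coeff_pal_unique_free_sub:
  assumes "Z \<in> subs V" "free_subs y Z = {Y}" "dim Z \<le> 2 * y"
  shows "coeff (pal Z) y = 1"
  using assms
proof (induction "dim Z" arbitrary: Z rule: less_induct)
  case less
  note Z = less.prems(1)
  have Y: "Y \<in> subs Z" "elems Y = {}" "dim Y = y" "Y \<in> subs V"
    using less.prems subs_V[OF Z, of Y] by (auto simp: free_subs_def)
  show ?case
  proof (cases "Z = Y")
    case True
    then show ?thesis using pal_free[of Y] Y by simp
  next
    case False
    have Z0: "Z \<noteq> {0}" using False Y subspace_0 by (auto simp: subs_iff)
    have "coeff (T Z) y = 0"
    proof (cases "core Z = Z")
      case True
      then show ?thesis using core_eq_imp_degree_T[OF Z True Z0] less.prems(3) by (intro coeff_eq_0) simp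
    next
      case neq: False
      show ?thesis
      proof (rule ccontr)
        assume ne: "coeff (T Z) y \<noteq> 0"
        define i where "i = y - (dim Z - \<rho> Z)"
        have i: "dim Z - \<rho> Z \<le> y" "coeff (T (core Z)) i \<noteq> 0"
          using ne by (auto simp: coeff_T_core[OF Z] i_def split: if_splits)
        have cV: "core Z \<in> subs V" "core Z \<in> subs Z" using core_in_subs[OF Z] by auto
        obtain K where K: "K \<in> subs (core Z)" "coeff (pal K) i \<noteq> 0"
          using i(2) unfolding coeff_T[OF cV(1)] by (metis (no_types, lifting) mult_zero_right sum.neutral)
        have KV: "K \<in> subs V" using K cV by (auto simp: subs_iff)
        obtain X0 where X0: "X0 \<in> free_subs i K" using coeff_pal_nonzero_imp_free_subs[OF KV K(2)] by auto
        then have X0': "X0 \<in> subs Z" "elems X0 = {}" "X0 \<inter> core Z = X0" "dim X0 = i"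
          using K cV by (auto simp: free_subs_def subs_iff)
        obtain X where X: "X \<in> subs Z" "X0 \<subseteq> X" "elems X = {}" "X \<inter> core Z = X0 \<inter> core Z"
          "span (X \<union> core Z) = Z" "dim X + \<rho> Z = dim (X0 \<inter> core Z) + dim Z"
          using free_extension[OF Z X0'(1,2)] by metis
        have dX: "dim X = y" using X X0' i \<rho>_le_dim[OF Z] by (simp add: i_def)
        then have XY: "X = Y" using less.prems(2) X by (auto simp: free_subs_def)
        \<comment> \<open>The extension \<open>X\<close> is forced to be \<open>Y\<close>. Take
          \<open>v\<close> in \<open>Y\<close> outside the core and \<open>u\<close> in the core
          outside \<open>X0\<close>: the sum \<open>v + u\<close> lies neither in \<open>Y\<close>
          nor in the core, and adjoining it to \<open>X0\<close> starts a second extension of the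
          same dimension.\<close>
        obtain v where v: "v \<in> Y" "v \<notin> core Z"
        proof -
          have "\<not> Y \<subseteq> core Z"
          proof
            assume "Y \<subseteq> core Z"
            then have "Z = core Z" using X XY by (metis Un_absorb1 subspace_core span_eq_iff)
            then show False using neq by simp
          qed
          then show ?thesis using that by blast
        qed
        obtain u where u: "u \<in> core Z" "u \<notin> X0"
        proof -
          have "\<not> core Z \<subseteq> X0"
          proof
            assume "core Z \<subseteq> X0"
            then have "core Z \<subseteq> Y" using X XY by auto
            then have "Z = Y" using X(5) XY Y by (metis Un_absorb2 span_eq_iff subs_iff)
            then show False using False by simp
          qed
          then show ?thesis using that by blast
        qed
        have sX0: "subspace X0" "subspace Y" "subspace Z" "subspace (core Z)"
          using X0' Y Z by (auto simp: subs_iff)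
        have vu: "v + u \<notin> core Z"
        proof
          assume "v + u \<in> core Z"
          then have "v + u - u \<in> core Z" using u sX0 subspace_diff by blast
          then show False using v by simp
        qed
        have vuY: "v + u \<notin> Y"
        proof
          assume "v + u \<in> Y"
          then have "v + u - v \<in> Y" using v sX0 subspace_diff by blast
          then have "u \<in> Y \<inter> core Z" using u by simp
          then show False using u X XY X0' by auto
        qed
        let ?X1 = "span (insert (v + u) X0)"
        have X1: "?X1 \<in> subs Z"
        proof -
          have "v + u \<in> Z" using v u Y cV sX0 by (intro subspace_add) (auto simp: subs_iff)
          then show ?thesis using X0' sX0 span_minimal[of "insert (v + u) X0" Z] by (auto simp: subs_iff)
        qed
        have X1c: "?X1 \<inter> core Z = X0"
        proof
          show "X0 \<subseteq> ?X1 \<inter> core Z" using X0' by (auto intro: span_base)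
          show "?X1 \<inter> core Z \<subseteq> X0"
          proof
            fix w assume w: "w \<in> ?X1 \<inter> core Z"
            then obtain k where "w - k *s (v + u) \<in> span X0" using span_breakdown_eq by blast
            then have k: "w - k *s (v + u) \<in> X0" using sX0 by (simp add: span_eq_iff[THEN iffD2])
            have "k = 0"
            proof (rule ccontr)
              assume "k \<noteq> 0"
              have "w \<in> core Z" "w - k *s (v + u) \<in> core Z" using w k X0'(3) by blast+
              from subspace_diff[OF sX0(4) this] have "w - (w - k *s (v + u)) \<in> core Z" .
              moreover have "w - (w - a) = a" for a by (metis add_diff_cancel_left' diff_add_cancel)
              ultimately have "k *s (v + u) \<in> core Z" by (simp only:)
              then have "inverse k *s (k *s (v + u)) \<in> core Z" by (rule subspace_scale[OF sX0(4)])
              moreover have "inverse k *s (k *s (v + u)) = v + u"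
                using \<open>k \<noteq> 0\<close> by (simp only: scale_scale left_inverse scale_one not_False_eq_True)
              ultimately show False using vu by metis
            qed
            then show "w \<in> X0" using k by simp
          qed
        qed
        have "elems ?X1 = {}"
        proof -
          have "elems ?X1 \<subseteq> elems (core Z)"
            using X1 Z elems_mono[of ?X1 Z] elems_core[of Z] by (auto simp: subs_iff)
          then have "elems ?X1 \<subseteq> elems (?X1 \<inter> core Z)" by (auto simp: elems_def)
          then show ?thesis using X1c X0' by simp
        qed
        then obtain X2 where X2: "X2 \<in> subs Z" "?X1 \<subseteq> X2" "elems X2 = {}"
          "dim X2 + \<rho> Z = dim (?X1 \<inter> core Z) + dim Z"
          using free_extension[OF Z X1] by metis
        then have "dim X2 = y" using X1c X0' i \<rho>_le_dim[OF Z] by (simp add: i_def)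
        then have "X2 = Y" using less.prems(2) X2 by (auto simp: free_subs_def)
        moreover have "v + u \<in> ?X1" by (intro span_base) auto
        ultimately show False using vuY X2 by auto
      qed
    qed
    moreover have "(\<Sum>K \<in> subs Z - {Z}. subspace_mu (dim Z - dim K) * coeff (pal K) y) = -1"
    proof -
      have K: "coeff (pal K) y = (if Y \<subseteq> K then 1 else 0)" if "K \<in> subs Z - {Z}" for K
      proof -
        have fK: "free_subs y K = {X \<in> free_subs y Z. X \<subseteq> K}"
          using that by (auto simp: free_subs_def subs_iff)
        show ?thesis
      proof (cases "Y \<subseteq> K")
        case True
        then have "free_subs y K = {Y}" unfolding fK less.prems(2) by auto
        then show ?thesis using True less.hyps[of K] proper_sub_dim[OF Z that] less.prems(3) by simp
      next
        case False
        then have "free_subs y K = {}" unfolding fK less.prems(2) by auto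
        then show ?thesis using coeff_pal_nonzero_imp_free_subs[of K y] proper_sub_dim(2)[OF Z that] False by auto
      qed
      qed
      have eq: "{K \<in> subs Z - {Z}. Y \<subseteq> K} = subspaces_between Y Z - {Z}"
        by (auto simp: subs_iff subspaces_between_def subspace_0)
      have "(\<Sum>K \<in> subs Z - {Z}. subspace_mu (dim Z - dim K) * coeff (pal K) y) =
          (\<Sum>K \<in> subs Z - {Z}. if Y \<subseteq> K then subspace_mu (dim Z - dim K) else 0)"
        using K by (intro sum.cong refl) auto
      also have "\<dots> = (\<Sum>K \<in> subspaces_between Y Z - {Z}. subspace_mu (dim Z - dim K))"
        unfolding eq[symmetric] using Z by (intro sum.inter_filter[symmetric]) auto
      also have "\<dots> = (\<Sum>K \<in> subspaces_between Y Z. subspace_mu (dim Z - dim K)) - subspace_mu 0"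
        using Y finite_subspaces_between[OF finite_sub[OF Z]] Z
        by (subst sum_diff1) (auto simp: subspaces_between_def subs_iff)
      also have "\<dots> = -1" using sum_subspace_mu[of Y Z] Y Z finite_sub[OF Z] False
        by (auto simp: subs_iff subspace_mu_def numeral_2_eq_2)
      finally show ?thesis .
    qed
    ultimately show ?thesis by (simp add: coeff_pal_eq[OF Z])
  qed
qed

end

section \<open>Estimates for exponents of \<open>q\<close>\<close>

lemma double_choose_two: "2 * (n choose 2) = n * (n - 1)"
proof -
  have "even (n * (n - 1))" by (cases n) auto
  then show ?thesis by (simp add: choose_two)
qed

text \<open>Designed for the induction in \<open>coeff_pal_bound\<close>, where the sum occurs
  twice. Every summand is at most \<open>q ^ (2 * z\<^sup>2 - 2 * z)\<close>, and the
  \<open>z\<close> summands, counted twice, are absorbed by \<open>q ^ (2 * z)\<close>.\<close>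

lemma gbinom_weighted_sum_bound:
  fixes q :: real
  assumes q: "q \<ge> 2" and z: "z \<ge> 1"
  shows "2 * (\<Sum>k<z. gbinom q z k * (q ^ ((z - k) choose 2) * q ^ (2 * k\<^sup>2))) \<le> q ^ (2 * z\<^sup>2)"
proof -
  have bnd: "gbinom q z k * (q ^ ((z - k) choose 2) * q ^ (2 * k\<^sup>2)) \<le> q ^ (2 * z\<^sup>2 - 2 * z)"
    if k: "k < z" for k
  proof -
    obtain m where m: "z = k + Suc m" using k less_imp_Suc_add by auto
    have e: "k * (z - k) + k + (((z - k) choose 2) + 2 * k\<^sup>2) \<le> 2 * z\<^sup>2 - 2 * z"
    proof -
      have zk: "z - k = Suc m" using m by simp
      have *: "2 * (k * Suc m + k + 2 * k\<^sup>2) + 2 * (Suc m choose 2) + 2 * (2 * z) \<le> 2 * (2 * z\<^sup>2)"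
        unfolding double_choose_two m power2_eq_square by (simp add: algebra_simps)
      have "2 * (a + b + c) + 2 * d + 2 * (2 * z) \<le> 2 * (2 * w) \<Longrightarrow> a + b + (d + c) \<le> 2 * w - 2 * z"
        for a b c d w :: nat by presburger
      from this[OF *] show ?thesis unfolding zk .
    qed
    have "gbinom q z k * (q ^ ((z - k) choose 2) * q ^ (2 * k\<^sup>2)) \<le>
        q ^ (k * (z - k) + k) * (q ^ ((z - k) choose 2) * q ^ (2 * k\<^sup>2))"
      using q gbinom_mono_bound(4)[OF q] by (intro mult_right_mono) auto
    also have "\<dots> = q ^ (k * (z - k) + k + (((z - k) choose 2) + 2 * k\<^sup>2))" by (simp only: power_add)
    also have "\<dots> \<le> q ^ (2 * z\<^sup>2 - 2 * z)" using q e by (intro power_increasing) auto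
    finally show ?thesis .
  qed
  have "2 * (\<Sum>k<z. gbinom q z k * (q ^ ((z - k) choose 2) * q ^ (2 * k\<^sup>2))) \<le>
      2 * (\<Sum>k<z. q ^ (2 * z\<^sup>2 - 2 * z))"
    using bnd by (intro mult_left_mono sum_mono) auto
  also have "\<dots> = real (2 * z) * q ^ (2 * z\<^sup>2 - 2 * z)" by simp
  also have "real (2 * z) \<le> q ^ (2 * z)"
  proof -
    have "real (2 * z) \<le> 2 ^ (2 * z)" using less_exp[of "2 * z"] by (metis less_imp_le of_nat_le_iff of_nat_numeral of_nat_power)
    also have "\<dots> \<le> q ^ (2 * z)" using q by (intro power_mono) auto
    finally show ?thesis .
  qed
  then have "real (2 * z) * q ^ (2 * z\<^sup>2 - 2 * z) \<le> q ^ (2 * z) * q ^ (2 * z\<^sup>2 - 2 * z)"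
    using q by (intro mult_right_mono) auto
  also have "\<dots> = q ^ (2 * z\<^sup>2)"
  proof -
    have "2 * z \<le> 2 * z\<^sup>2" by (simp add: power2_eq_square)
    then show ?thesis by (simp add: power_add[symmetric])
  qed
  finally show ?thesis .
qed

text \<open>Trades \<open>q ^ ((r - k) choose 2)\<close> for
  \<open>q ^ (r choose 2) / q ^ (k * r)\<close> up to a factor depending on \<open>k\<close> only;
  the geometric factor of the coefficients originates here.\<close>

lemma choose_two_complement:
  assumes "k \<le> r"
  shows "((r - k) choose 2) + k * r = (r choose 2) + (Suc k choose 2)"
proof -
  obtain m where m: "r = k + m" using assms le_Suc_ex by blast
  have sq: "2 * (n choose 2) + n = n * n" for n
    by (cases n) (auto simp: double_choose_two)
  have "2 * ((k + m) choose 2) + (k + m) = k * k + 2 * (k * m) + m * m"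
    "2 * (Suc k choose 2) + Suc k = k * k + 2 * k + 1"
    unfolding sq by (simp_all add: algebra_simps)
  then have "(m choose 2) + (k * k + k * m) = ((k + m) choose 2) + (Suc k choose 2)"
    using sq[of m] by linarith
  then show ?thesis by (simp add: m distrib_left)
qed

section \<open>Size of the palindromic coefficients and the coefficient estimate\<close>

context vector_matroid
begin

lemma abs_subspace_mu: "\<bar>real_of_int (subspace_mu n)\<bar> = real q ^ (n choose 2)"
  by (simp add: subspace_mu_def abs_mult power_abs)

lemma sum_proper_subs:
  fixes h :: "nat \<Rightarrow> real"
  assumes Z: "Z \<in> subs V"
  shows "(\<Sum>K \<in> subs Z - {Z}. h (dim K)) = (\<Sum>k<dim Z. gbinom q (dim Z) k * h k)"
proof -
  have Z': "subspace Z" "finite Z" "{0} \<subseteq> Z" using Z finite_sub by (auto simp: subs_iff subspace_0)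
  let ?h = "\<lambda>k. if k < dim Z then h k else 0"
  have "(\<Sum>K \<in> subs Z - {Z}. h (dim K)) = (\<Sum>K \<in> subs Z - {Z}. ?h (dim K - dim {0}))"
    using proper_sub_dim[OF Z] by (intro sum.cong refl) auto
  also have "\<dots> = (\<Sum>K \<in> subs Z. ?h (dim K - dim {0}))"
    using Z by (intro sum.mono_neutral_left) auto
  also have "\<dots> = (\<Sum>j\<le>dim Z. gbinom q (dim Z) j * ?h j)"
    using sum_subspaces_between[OF subspace_single_0 Z', of ?h] by simp
  also have "\<dots> = (\<Sum>k<dim Z. gbinom q (dim Z) k * h k)"
    by (intro sum.mono_neutral_cong_right) auto
  finally show ?thesis .
qed

text \<open>Induction with \<open>coeff_pal_eq\<close> in degrees at least \<open>dim Z / 2\<close>.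
  The coefficient of \<open>T Z\<close> is 0 if the elements span \<open>Z\<close>; otherwise it is
  0 or a coefficient of \<open>T (core Z)\<close>, a combination over subspaces of
  \<open>core Z\<close>, all of them proper in \<open>Z\<close>. So this coefficient and the
  remaining sum are each at most \<open>s\<close>, and \<open>2 * s\<close> fits the bound.\<close>

lemma coeff_pal_bound:
  assumes "Z \<in> subs V"
  shows "\<bar>real_of_int (coeff (pal Z) j)\<bar> \<le> real q ^ (2 * (dim Z)\<^sup>2)"
  using assms
proof (induction "dim Z" arbitrary: Z j rule: less_induct)
  case less
  note Z = less.prems
  show ?case
  proof (cases "Z = {0}")
    case True
    then show ?thesis by (cases "j = 0") (auto simp: pal_0)
  next
    case False
    let ?w = "\<lambda>K. real q ^ ((dim Z - dim K) choose 2) * real q ^ (2 * (dim K)\<^sup>2)"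
    define s where "s = (\<Sum>K \<in> subs Z - {Z}. ?w K)"
    have q1: "real q \<ge> 1" using q_ge_2 by simp
    have IH: "\<bar>real_of_int (coeff (pal K) j)\<bar> \<le> real q ^ (2 * (dim K)\<^sup>2)" if "K \<in> subs Z - {Z}" for K j
      using less.hyps[of K j] proper_sub_dim[OF Z that] by blast
    have "dim Z \<ge> 1" using dim_eq_0_iff[of Z] Z finite_sub[OF Z] False by (auto simp: subs_iff not_less_eq_eq)
    then have s: "2 * s \<le> real q ^ (2 * (dim Z)\<^sup>2)"
      unfolding s_def using sum_proper_subs[OF Z, of "\<lambda>k. real q ^ ((dim Z - k) choose 2) * real q ^ (2 * k\<^sup>2)"]
        gbinom_weighted_sum_bound[of "real q" "dim Z"] q_ge_2 by simp
    have s0: "0 \<le> s" unfolding s_def using q1 by (intro sum_nonneg) auto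
    have T: "\<bar>real_of_int (coeff (T Z) j)\<bar> \<le> s" if j: "dim Z \<le> 2 * j" for j
    proof (cases "core Z = Z")
      case True
      then have "coeff (T Z) j = 0" using core_eq_imp_degree_T[OF Z True False] j by (intro coeff_eq_0) simp
      then show ?thesis using s0 by simp
    next
      case neq: False
      have cV: "core Z \<in> subs V" "core Z \<in> subs Z" using core_in_subs[OF Z] by auto
      have dc: "dim (core Z) \<le> dim Z" using dim_subs[OF Z cV(2)] .
      have sub: "subs (core Z) \<subseteq> subs Z - {Z}" 
    proof
      fix K assume "K \<in> subs (core Z)"
      then have "subspace K" "K \<subseteq> core Z" by (simp_all add: subs_iff)
      moreover have "core Z \<subseteq> Z" using cV(2) by (simp add: subs_iff)
      ultimately show "K \<in> subs Z - {Z}" using neq by (simp add: subs_iff) blast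
    qed
      have "\<bar>real_of_int (coeff (T (core Z)) i)\<bar> \<le> s" for i
      proof -
        have "\<bar>real_of_int (coeff (T (core Z)) i)\<bar> \<le>
            (\<Sum>K \<in> subs (core Z). \<bar>real_of_int (subspace_mu (dim (core Z) - dim K) * coeff (pal K) i)\<bar>)"
          unfolding coeff_T[OF cV(1)] of_int_sum by (rule sum_abs)
        also have "\<dots> \<le> (\<Sum>K \<in> subs (core Z). ?w K)"
        proof (rule sum_mono)
          fix K assume K: "K \<in> subs (core Z)"
          have "real q ^ ((dim (core Z) - dim K) choose 2) \<le> real q ^ ((dim Z - dim K) choose 2)"
            using q1 dc by (intro power_increasing binomial_right_mono diff_le_mono)
          then show "\<bar>real_of_int (subspace_mu (dim (core Z) - dim K) * coeff (pal K) i)\<bar> \<le> ?w K"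
            unfolding of_int_mult abs_mult abs_subspace_mu using IH[of K i] K sub by (intro mult_mono) auto
        qed
        also have "\<dots> \<le> s"
          unfolding s_def using sub Z q1 by (intro sum_mono2) auto
        finally show ?thesis .
      qed
      then show ?thesis using s0 by (auto simp: coeff_T_core[OF Z])
    qed
    have high: "\<bar>real_of_int (coeff (pal Z) j)\<bar> \<le> real q ^ (2 * (dim Z)\<^sup>2)" if j: "dim Z \<le> 2 * j" for j
    proof -
      have "\<bar>\<Sum>K \<in> subs Z - {Z}. real_of_int (subspace_mu (dim Z - dim K) * coeff (pal K) j)\<bar> \<le>
          (\<Sum>K \<in> subs Z - {Z}. \<bar>real_of_int (subspace_mu (dim Z - dim K) * coeff (pal K) j)\<bar>)"
        by (rule sum_abs)
      also have "\<dots> \<le> s"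
        unfolding s_def of_int_mult abs_mult abs_subspace_mu using IH q1 by (intro sum_mono mult_left_mono) auto
      finally show ?thesis using T[OF j] s unfolding coeff_pal_eq[OF Z] of_int_diff of_int_sum by linarith
    qed
    show ?thesis
    proof (cases "dim Z \<le> 2 * j")
      case True
      then show ?thesis by (rule high)
    next
      case False
      then have "dim Z \<le> 2 * (dim Z - j)" by linarith
      then show ?thesis using high[of "dim Z - j"] coeff_pal_symmetric[OF Z, of j] False by simp
    qed
  qed
qed

text \<open>Each dimension of the subspace prescribed inside \<open>K\<close> is worth a factor
  \<open>q ^ dim V\<close>.\<close>

lemma card_subspaces_above:
  assumes "W \<in> subs V" "dim W \<le> k"
  shows "real (card {K \<in> subspaces_between W V. dim K = k}) \<le> (real q ^ dim V) ^ (k - dim W)"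
proof -
  have "real (card {K \<in> subspaces_between W V. dim K = dim W + (k - dim W)}) = gbinom q (dim V - dim W) (k - dim W)"
    using assms subspace_V finite_V by (intro card_subspaces_between) (auto simp: subs_iff)
  also have "\<dots> \<le> (real q ^ (dim V - dim W)) ^ (k - dim W)"
    using q_ge_2 by (intro gbinom_mono_bound) auto
  also have "\<dots> \<le> (real q ^ dim V) ^ (k - dim W)"
    using q_ge_2 by (intro power_mono power_increasing) auto
  finally show ?thesis using assms by simp
qed

lemma V_in_subs: "V \<in> subs V"
  using subspace_V by (simp add: subs_iff)

lemma finite_free_subs: "finite (free_subs j V)"
  by (rule finite_subset[OF _ finite_subs_V]) (auto simp: free_subs_def)

lemma inverse_KL_eq:
  assumes "span (vec ` E) = V"
  shows "inverse_KL_poly M = (-1) ^ dim V * T V"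
proof -
  have EV: "elems V = E" using vec_in_V by (auto simp: elems_def)
  then have "\<rho> V = dim V" using assms by (simp add: \<rho>_core core_def)
  moreover have "restriction M E = M" by (simp add: restriction_def M_def)
  ultimately have "T V = (-1) ^ dim V * inverse_KL_poly M"
    by (simp add: T_def EV mat.g_def monom_0 one_pCons[symmetric] \<rho>_def)
  then show ?thesis by (simp add: mult.assoc[symmetric] power_add[symmetric])
qed

lemma coeff_inverse_KL:
  assumes "span (vec ` E) = V"
  shows "real_of_int (coeff (inverse_KL_poly M) y) =
    (\<Sum>K \<in> subs V. (-1) ^ dim K * real q ^ ((dim V - dim K) choose 2) * real_of_int (coeff (pal K) y))"
proof -
  have coeff_minus: "coeff ((-1) ^ n * f) y = (-1) ^ n * coeff f y" for n and f :: "int poly"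
    by (cases "even n") auto
  have "(-1) ^ dim V * subspace_mu (dim V - dim K) = (-1) ^ dim K * int q ^ ((dim V - dim K) choose 2)"
    if "K \<in> subs V" for K
  proof -
    have "(-1::int) ^ dim V * (-1) ^ (dim V - dim K) = (-1) ^ dim K"
      using dim_subs[OF V_in_subs that] by (simp add: power_add[symmetric] minus_one_power_iff)
    then show ?thesis by (simp add: subspace_mu_def mult.assoc[symmetric])
  qed
  then have "coeff (inverse_KL_poly M) y =
      (\<Sum>K \<in> subs V. (-1) ^ dim K * int q ^ ((dim V - dim K) choose 2) * coeff (pal K) y)"
    unfolding inverse_KL_eq[OF assms] coeff_minus coeff_T[OF V_in_subs] sum_distrib_left
    by (intro sum.cong refl) (simp add: mult.assoc[symmetric])
  then show ?thesis by simp
qed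

lemma coeff_inverse_KL_eq_0:
  assumes "span (vec ` E) = V" "free_subs y V = {}"
  shows "coeff (inverse_KL_poly M) y = 0"
proof -
  have "coeff (pal K) y = 0" if "K \<in> subs V" for K
  proof -
    have "free_subs y K \<subseteq> free_subs y V" using that by (auto simp: free_subs_def subs_iff)
    then show ?thesis using coeff_pal_nonzero_imp_free_subs[OF that, of y] assms by auto
  qed
  then have "real_of_int (coeff (inverse_KL_poly M) y) = 0"
    unfolding coeff_inverse_KL[OF assms(1)] by (intro sum.neutral) auto
  then show ?thesis by simp
qed

text \<open>In terms of \<open>j = dim K - y\<close> the cut \<open>dim K \<le> 2 * y\<close> is
  \<open>j \<le> y\<close>, so this is a truncated alternating sum with a closed form. The cut marks
  the range in which \<open>coeff_pal_unique_free_sub\<close> applies.\<close>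

lemma sum_above_free_sub:
  assumes Y: "Y \<in> free_subs y V" and y: "2 * y < dim V"
  shows "(\<Sum>K \<in> subspaces_between Y V. if dim K \<le> 2 * y then (-1) ^ dim K * real q ^ ((dim V - dim K) choose 2) else 0) =
    gbinom q (dim V - y - 1) y * real q ^ ((dim V - 2 * y) choose 2)"
proof -
  have Y': "subspace Y" "Y \<subseteq> V" "dim Y = y" using Y by (auto simp: free_subs_def subs_iff)
  obtain m where m: "dim V - y = Suc m" using y by (metis Suc_diff_Suc add_lessD1 mult_2)
  let ?h = "\<lambda>j. if j \<le> y then (-1) ^ (y + j) * real q ^ ((Suc m - j) choose 2) else 0"
  have "(\<Sum>K \<in> subspaces_between Y V. if dim K \<le> 2 * y then (-1) ^ dim K * real q ^ ((dim V - dim K) choose 2) else 0) =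
      (\<Sum>K \<in> subspaces_between Y V. ?h (dim K - dim Y))"
  proof (intro sum.cong refl)
    fix K assume "K \<in> subspaces_between Y V"
    then have "y \<le> dim K"
      using Y' finite_V finite_subset[of K V] dim_mono_finite[of Y K] by (auto simp: subspaces_between_def)
    then obtain j where j: "dim K = y + j" using le_Suc_ex by blast
    have "dim V - (y + j) = Suc m - j" using m by simp
    then show "(if dim K \<le> 2 * y then (-1) ^ dim K * real q ^ ((dim V - dim K) choose 2) else 0) =
        ?h (dim K - dim Y)" by (simp add: j Y' mult_2)
  qed
  also have "\<dots> = (\<Sum>j\<le>Suc m. gbinom q (Suc m) j * ?h j)"
    using sum_subspaces_between[OF Y'(1) subspace_V finite_V Y'(2), of ?h] by (simp only: Y'(3) m)
  also have "\<dots> = (\<Sum>j\<le>y. (-1) ^ y * ((-1) ^ j * gbinom q (Suc m) j * real q ^ ((Suc m - j) choose 2)))"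
    using y m by (intro sum.mono_neutral_cong_right) (auto simp: power_add)
  also have "\<dots> = (-1) ^ y * ((-1) ^ y * gbinom q m y * real q ^ ((Suc m - y) choose 2))"
    unfolding sum_distrib_left[symmetric] using q_ge_2 y m by (subst gbinom_alternating_sum) auto
  also have "\<dots> = gbinom q m y * real q ^ ((Suc m - y) choose 2)"
    by (simp add: mult.assoc[symmetric] power_add[symmetric])
  also have "\<dots> = gbinom q (dim V - y - 1) y * real q ^ ((dim V - 2 * y) choose 2)"
  proof -
    have "Suc m - y = dim V - 2 * y" "m = dim V - y - 1" using m by simp_all
    then show ?thesis by simp
  qed
  finally show ?thesis .
qed

text \<open>Subspaces \<open>K\<close> containing exactly one free \<open>y\<close>-dimensional subspace give the main term. The
  error comes from those containing two, and from those with \<open>dim K > 2 y\<close>, which by symmetry contain a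
  free subspace of dimension \<open>dim K - y > y\<close>. In both cases \<open>K\<close> contains one of boundedly many
  subspaces of dimension greater than \<open>y\<close>, which saves a factor \<open>q ^ dim V\<close>.\<close>

theorem coeff_inverse_KL_estimate:
  assumes spans: "span (vec ` E) = V" and n: "2 * n < dim V" "y \<le> n"
    and free: "\<And>j. n < j \<Longrightarrow> free_subs j V = {}"
    and A: "\<And>j. real (card (free_subs j V)) \<le> A" "1 \<le> A"
  shows "\<bar>real_of_int (coeff (inverse_KL_poly M) y) -
      real (card (free_subs y V)) * (gbinom q (dim V - y - 1) y * real q ^ ((dim V - 2 * y) choose 2))\<bar>
    \<le> real q ^ (dim V choose 2) / (real q ^ dim V) ^ (y + 1) * (2 * A\<^sup>2 * (2 * real n + 1) * real q ^ (10 * n\<^sup>2 + n))"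
proof -
  define r where "r = dim V"
  define Q where "Q = real q ^ r"
  have q1: "real q \<ge> 1" using q_ge_2 by simp
  have Q1: "Q \<ge> 1" unfolding Q_def using q1 by (simp add: one_le_power)
  let ?w = "\<lambda>K. (-1) ^ dim K * real q ^ ((r - dim K) choose 2)"
  \<comment> \<open>\<open>?N K\<close> agrees with the coefficient of \<open>pal K\<close> in
    degree \<open>y\<close> unless \<open>dim K \<le> 2 * y\<close> and \<open>K\<close> has at
    least two free subspaces of dimension \<open>y\<close>, or \<open>dim K > 2 * y\<close> and
    \<open>K\<close> has one of dimension \<open>dim K - y\<close>.\<close>
  let ?N = "\<lambda>K. if dim K \<le> 2 * y then real (card (free_subs y K)) else 0"
  have "real (card (free_subs y V)) * (gbinom q (r - y - 1) y * real q ^ ((r - 2 * y) choose 2)) =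
     (\<Sum>Y \<in> free_subs y V. \<Sum>K \<in> subspaces_between Y V. if dim K \<le> 2 * y then ?w K else 0)"
    unfolding r_def using sum_above_free_sub[of _ y] n by simp
  also have "\<dots> = (\<Sum>Y \<in> free_subs y V. \<Sum>K \<in> {K \<in> subs V. Y \<subseteq> K}. if dim K \<le> 2 * y then ?w K else 0)"
    by (intro sum.cong refl) (auto simp: subs_iff subspaces_between_def subspace_0)
  also have "\<dots> = (\<Sum>K \<in> subs V. \<Sum>Y \<in> {Y \<in> free_subs y V. Y \<subseteq> K}. if dim K \<le> 2 * y then ?w K else 0)"
    using finite_free_subs by (intro sum.swap_restrict) auto
  also have "\<dots> = (\<Sum>K \<in> subs V. ?w K * ?N K)"
  proof (intro sum.cong refl)
    fix K assume "K \<in> subs V"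
    then have "{Y \<in> free_subs y V. Y \<subseteq> K} = free_subs y K" by (auto simp: free_subs_def subs_iff)
    then show "(\<Sum>Y \<in> {Y \<in> free_subs y V. Y \<subseteq> K}. if dim K \<le> 2 * y then ?w K else 0) = ?w K * ?N K" by simp
  qed
  finally have eq: "real_of_int (coeff (inverse_KL_poly M) y) -
      real (card (free_subs y V)) * (gbinom q (r - y - 1) y * real q ^ ((r - 2 * y) choose 2)) =
      (\<Sum>K \<in> subs V. ?w K * (real_of_int (coeff (pal K) y) - ?N K))"
    unfolding coeff_inverse_KL[OF spans] by (simp add: sum_subtractf right_diff_distrib r_def)
  have "\<bar>\<Sum>K \<in> subs V. ?w K * (real_of_int (coeff (pal K) y) - ?N K)\<bar> \<le> (\<Sum>K \<in> subs V. \<bar>?w K * (real_of_int (coeff (pal K) y) - ?N K)\<bar>)"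
    by (rule sum_abs)
  also have "\<dots> \<le> (\<Sum>K \<in> subs V. if (dim K \<le> 2 * y \<and> 2 \<le> card (free_subs y K)) \<or> (2 * y < dim K \<and> free_subs (dim K - y) K \<noteq> {})
      then real q ^ ((r - dim K) choose 2) * (2 * real q ^ (2 * (dim K)\<^sup>2)) else 0)"
  proof (rule sum_mono)
    fix K assume K: "K \<in> subs V"
    have K': "subspace K" "finite K" using K finite_sub by (auto simp: subs_iff)
    have cp: "\<bar>real_of_int (coeff (pal K) y)\<bar> \<le> real q ^ (2 * (dim K)\<^sup>2)" by (rule coeff_pal_bound[OF K])
    have fin: "finite (free_subs y K)" using K by (auto simp: free_subs_def)
    have diff: "\<bar>real_of_int (coeff (pal K) y) - ?N K\<bar> \<le>
      (if (dim K \<le> 2 * y \<and> 2 \<le> card (free_subs y K)) \<or> (2 * y < dim K \<and> free_subs (dim K - y) K \<noteq> {})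
      then 2 * real q ^ (2 * (dim K)\<^sup>2) else 0)"
    proof (cases "dim K \<le> 2 * y")
      case True
      consider "card (free_subs y K) = 0" | "card (free_subs y K) = 1" | "2 \<le> card (free_subs y K)" by linarith
      then show ?thesis
      proof cases
        case 1
        then have "free_subs y K = {}" using fin by simp
        then have "coeff (pal K) y = 0" using coeff_pal_nonzero_imp_free_subs[OF K, of y] by auto
        then show ?thesis using True 1 by simp
      next
        case 2
        then obtain Y where "free_subs y K = {Y}" by (auto simp: card_1_singleton_iff)
        then have "coeff (pal K) y = 1" using coeff_pal_unique_free_sub[OF K _ True, of Y] by blast
        then show ?thesis using True 2 by simp
      next
        case 3
        then have "free_subs y K \<noteq> {}" by auto
        then have yk: "y \<le> dim K" using dim_subs[OF K] by (auto simp: free_subs_def)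
        have "real (card (free_subs y K)) \<le> real (card {Y \<in> subs K. dim Y = y})"
          unfolding of_nat_le_iff using K by (intro card_mono) (auto simp: free_subs_def)
        also have "\<dots> \<le> (real q ^ dim K) ^ y"
          unfolding card_subspaces[OF K'] using q_ge_2 by (intro gbinom_mono_bound) auto
        also have "\<dots> \<le> real q ^ (2 * (dim K)\<^sup>2)"
        proof -
          have "dim K * y \<le> dim K * dim K" using yk by (rule mult_le_mono2)
          then have "dim K * y \<le> 2 * (dim K)\<^sup>2" unfolding power2_eq_square by linarith
          then show ?thesis unfolding power_mult[symmetric] using q1 by (rule power_increasing)
        qed
        finally have "\<bar>real_of_int (coeff (pal K) y) - real (card (free_subs y K))\<bar> \<le> 2 * real q ^ (2 * (dim K)\<^sup>2)"
          using cp of_nat_0_le_iff[of "card (free_subs y K)", where 'a = real] unfolding abs_le_iff by linarith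
        then show ?thesis using True 3 by simp
      qed
    next
      case False
      show ?thesis
      proof (cases "coeff (pal K) y = 0")
        case False
        then have "coeff (pal K) (dim K - y) \<noteq> 0" using coeff_pal_symmetric[OF K, of y] by (auto split: if_splits)
        then have "free_subs (dim K - y) K \<noteq> {}" using coeff_pal_nonzero_imp_free_subs[OF K] by blast
        then show ?thesis using \<open>\<not> dim K \<le> 2 * y\<close> cp by simp
      qed (use False in simp)
    qed
    have "\<bar>?w K * (real_of_int (coeff (pal K) y) - ?N K)\<bar> = real q ^ ((r - dim K) choose 2) * \<bar>real_of_int (coeff (pal K) y) - ?N K\<bar>"
      by (simp add: abs_mult power_abs)
    also have "\<dots> \<le> real q ^ ((r - dim K) choose 2) * (if (dim K \<le> 2 * y \<and> 2 \<le> card (free_subs y K)) \<or> (2 * y < dim K \<and> free_subs (dim K - y) K \<noteq> {})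
      then 2 * real q ^ (2 * (dim K)\<^sup>2) else 0)"
      using diff q1 by (intro mult_left_mono) auto
    finally show "\<bar>?w K * (real_of_int (coeff (pal K) y) - ?N K)\<bar> \<le>
      (if (dim K \<le> 2 * y \<and> 2 \<le> card (free_subs y K)) \<or> (2 * y < dim K \<and> free_subs (dim K - y) K \<noteq> {})
      then real q ^ ((r - dim K) choose 2) * (2 * real q ^ (2 * (dim K)\<^sup>2)) else 0)"
      by (auto split: if_splits)
  qed
  also have "\<dots> \<le> real q ^ (r choose 2) / Q ^ (y + 1) * (2 * A\<^sup>2 * (2 * real n + 1) * real q ^ (10 * n\<^sup>2 + n))"
  proof -
    let ?bad = "\<lambda>K. (dim K \<le> 2 * y \<and> 2 \<le> card (free_subs y K)) \<or> (2 * y < dim K \<and> free_subs (dim K - y) K \<noteq> {})"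
    let ?f = "\<lambda>k. real q ^ ((r - k) choose 2) * (2 * real q ^ (2 * k\<^sup>2))"
    have sub: "free_subs j K \<subseteq> free_subs j V" if "K \<in> subs V" for j K
      using that by (auto simp: free_subs_def subs_iff)
    have two: "\<exists>Y Y'. Y \<in> free_subs y K \<and> Y' \<in> free_subs y K \<and> Y \<noteq> Y'" if "2 \<le> card (free_subs y K)" for K
    proof -
      have "\<not> card (free_subs y K) \<le> Suc 0" using that by simp
      then show ?thesis using card_le_Suc0_iff_eq[of "free_subs y K"] card.infinite[of "free_subs y K"] that
        by (metis not_numeral_le_zero)
    qed
    have dim_pair: "span (Y \<union> Y') \<in> subs K" "y < dim (span (Y \<union> Y'))"
      if K: "K \<in> subs V" and Y: "Y \<in> free_subs y K" "Y' \<in> free_subs y K" "Y \<noteq> Y'" for K Y Y'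
    proof -
      have Y': "subspace Y" "subspace Y'" "Y \<subseteq> K" "Y' \<subseteq> K" "dim Y = y" "dim Y' = y"
        using Y by (auto simp: free_subs_def subs_iff)
      show 1: "span (Y \<union> Y') \<in> subs K" 
        using Y' K span_minimal[of "Y \<union> Y'" K] by (auto simp: subs_iff)
      then have fin: "finite (span (Y \<union> Y'))" using finite_sub subs_V K by blast
      have "Y \<subseteq> span (Y \<union> Y')" "Y' \<subseteq> span (Y \<union> Y')" by (auto intro: span_base)
      then have "Y \<subset> span (Y \<union> Y') \<or> Y' \<subset> span (Y \<union> Y')" using Y(3) by blast
      then show "y < dim (span (Y \<union> Y'))"
        using dim_strict_mono[OF _ subspace_span _ fin] Y' by metis
    qed
    have range: "dim K \<in> {y + 1..2 * n}" if K: "K \<in> subs V" and bad: "?bad K" for K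
    proof (cases "dim K \<le> 2 * y")
      case True
      then have "2 \<le> card (free_subs y K)" using bad by simp
      from two[OF this] obtain Y Y' where "Y \<in> free_subs y K" "Y' \<in> free_subs y K" "Y \<noteq> Y'" by blast
      then have "y < dim K" using dim_pair[OF K] dim_subs[OF K] by (meson less_le_trans)
      then show ?thesis using True n by simp
    next
      case False
      then have "free_subs (dim K - y) V \<noteq> {}" using bad sub[OF K] by auto
      then have "dim K - y \<le> n" using free by (metis not_le)
      then show ?thesis using False n by simp
    qed
    \<comment> \<open>\<open>A\<^sup>2\<close> bounds the pairs of free subspaces in the first case
      and, generously, the single free subspaces of dimension \<open>k - y\<close> in the second.
      Either way a subspace of dimension at least \<open>y + 1\<close> is prescribed inside
      \<open>K\<close>.\<close>
    have cnt: "real (card {K \<in> subs V. ?bad K \<and> dim K = k}) \<le> A\<^sup>2 * Q ^ (k - y - 1)" if k: "y < k" for k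
    proof (cases "k \<le> 2 * y")
      case True
      let ?P = "{(Y, Y'). Y \<in> free_subs y V \<and> Y' \<in> free_subs y V \<and> y < dim (span (Y \<union> Y')) \<and> dim (span (Y \<union> Y')) \<le> k}"
      have finP: "finite (free_subs y V \<times> free_subs y V)" using finite_free_subs by simp
      have P: "?P \<subseteq> free_subs y V \<times> free_subs y V" by auto
      have "{K \<in> subs V. ?bad K \<and> dim K = k} \<subseteq> (\<Union>(Y, Y') \<in> ?P. {K \<in> subspaces_between (span (Y \<union> Y')) V. dim K = k})"
      proof
        fix K assume "K \<in> {K \<in> subs V. ?bad K \<and> dim K = k}"
        then have K: "K \<in> subs V" "dim K = k" "2 \<le> card (free_subs y K)" using True by auto
        from two[OF this(3)] obtain Y Y' where Y: "Y \<in> free_subs y K" "Y' \<in> free_subs y K" "Y \<noteq> Y'" by blast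
        note d = dim_pair[OF K(1) Y]
        have "(Y, Y') \<in> ?P" using d dim_subs[OF K(1) d(1)] K Y sub[OF K(1)] by auto
        moreover have "K \<in> subspaces_between (span (Y \<union> Y')) V"
          using d K by (auto simp: subs_iff subspaces_between_def)
        ultimately show "K \<in> (\<Union>(Y, Y') \<in> ?P. {K \<in> subspaces_between (span (Y \<union> Y')) V. dim K = k})"
          using K by auto
      qed
      then have "card {K \<in> subs V. ?bad K \<and> dim K = k} \<le>
          card (\<Union>(Y, Y') \<in> ?P. {K \<in> subspaces_between (span (Y \<union> Y')) V. dim K = k})"
        using finite_subset[OF P finP] finite_subspaces_between[OF finite_V]
        by (intro card_mono) auto
      also have "\<dots> \<le> (\<Sum>(Y, Y') \<in> ?P. card {K \<in> subspaces_between (span (Y \<union> Y')) V. dim K = k})"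
        unfolding case_prod_unfold using finite_subset[OF P finP] by (intro card_UN_le) (simp add: case_prod_unfold)
      finally have "real (card {K \<in> subs V. ?bad K \<and> dim K = k}) \<le>
          (\<Sum>(Y, Y') \<in> ?P. real (card {K \<in> subspaces_between (span (Y \<union> Y')) V. dim K = k}))"
        by (simp add: case_prod_unfold flip: of_nat_sum)
      also have "\<dots> \<le> (\<Sum>x \<in> ?P. Q ^ (k - y - 1))"
      proof (rule sum_mono, clarify)
        fix Y Y' assume Y: "Y \<in> free_subs y V" "Y' \<in> free_subs y V" "y < dim (span (Y \<union> Y'))" "dim (span (Y \<union> Y')) \<le> k"
        then have "span (Y \<union> Y') \<in> subs V"
          using subspace_V span_minimal[of "Y \<union> Y'" V] by (auto simp: free_subs_def subs_iff)
        from card_subspaces_above[OF this Y(4)]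
        have "real (card {K \<in> subspaces_between (span (Y \<union> Y')) V. dim K = k}) \<le> Q ^ (k - dim (span (Y \<union> Y')))"
          by (simp add: Q_def r_def)
        also have "\<dots> \<le> Q ^ (k - y - 1)" using Q1 Y by (intro power_increasing) auto
        finally show "real (card {K \<in> subspaces_between (span (Y \<union> Y')) V. dim K = k}) \<le> Q ^ (k - y - 1)" .
      qed
      also have "\<dots> = real (card ?P) * Q ^ (k - y - 1)" by simp
      also have "\<dots> \<le> A\<^sup>2 * Q ^ (k - y - 1)"
      proof (rule mult_right_mono)
        have "real (card ?P) \<le> real (card (free_subs y V \<times> free_subs y V))"
          using card_mono[OF finP P] by simp
        also have "\<dots> \<le> A * A" unfolding card_cartesian_product of_nat_mult
          using A by (intro mult_mono) auto
        finally show "real (card ?P) \<le> A\<^sup>2" by (simp add: power2_eq_square)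
      qed (use Q1 in simp)
      finally show ?thesis .
    next
      case False
      have "{K \<in> subs V. ?bad K \<and> dim K = k} \<subseteq> (\<Union>W \<in> free_subs (k - y) V. {K \<in> subspaces_between W V. dim K = k})"
      proof
        fix K assume "K \<in> {K \<in> subs V. ?bad K \<and> dim K = k}"
        then have K: "K \<in> subs V" "dim K = k" "free_subs (k - y) K \<noteq> {}" using False by auto
        then obtain W where "W \<in> free_subs (k - y) K" by auto
        then show "K \<in> (\<Union>W \<in> free_subs (k - y) V. {K \<in> subspaces_between W V. dim K = k})"
          using K sub[OF K(1), of "k - y"] by (auto simp: free_subs_def subs_iff subspaces_between_def)
      qed
      then have "card {K \<in> subs V. ?bad K \<and> dim K = k} \<le>
          card (\<Union>W \<in> free_subs (k - y) V. {K \<in> subspaces_between W V. dim K = k})"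
        using finite_free_subs finite_subspaces_between[OF finite_V] by (intro card_mono) auto
      also have "\<dots> \<le> (\<Sum>W \<in> free_subs (k - y) V. card {K \<in> subspaces_between W V. dim K = k})"
        by (intro card_UN_le finite_free_subs)
      finally have "real (card {K \<in> subs V. ?bad K \<and> dim K = k}) \<le>
          (\<Sum>W \<in> free_subs (k - y) V. real (card {K \<in> subspaces_between W V. dim K = k}))"
        by (simp flip: of_nat_sum)
      also have "\<dots> \<le> (\<Sum>W \<in> free_subs (k - y) V. Q ^ y)"
      proof (rule sum_mono)
        fix W assume "W \<in> free_subs (k - y) V"
        then have "W \<in> subs V" "dim W = k - y" by (auto simp: free_subs_def)
        then show "real (card {K \<in> subspaces_between W V. dim K = k}) \<le> Q ^ y"
          using card_subspaces_above[of W k] k by (simp add: Q_def r_def)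
      qed
      also have "\<dots> = real (card (free_subs (k - y) V)) * Q ^ y" by simp
      also have "\<dots> \<le> A\<^sup>2 * Q ^ (k - y - 1)"
      proof (rule mult_mono)
        have "A * 1 \<le> A * A" using A by (intro mult_left_mono) auto
        then show "real (card (free_subs (k - y) V)) \<le> A\<^sup>2" using A(1)[of "k - y"] by (simp add: power2_eq_square)
        show "Q ^ y \<le> Q ^ (k - y - 1)" using Q1 False by (intro power_increasing) auto
      qed (use Q1 in auto)
      finally show ?thesis .
    qed
    have "(\<Sum>K \<in> subs V. if ?bad K then ?f (dim K) else 0) = (\<Sum>K \<in> {K \<in> subs V. ?bad K}. ?f (dim K))"
      by (intro sum.inter_filter[symmetric]) simp
    also have "\<dots> = (\<Sum>k \<in> {y + 1..2 * n}. \<Sum>K \<in> {K \<in> {K \<in> subs V. ?bad K}. dim K = k}. ?f (dim K))"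
    proof (rule sum.group[symmetric])
      show "dim ` {K \<in> subs V. ?bad K} \<subseteq> {y + 1..2 * n}" using range by blast
    qed simp_all
    also have "\<dots> = (\<Sum>k \<in> {y + 1..2 * n}. real (card {K \<in> subs V. ?bad K \<and> dim K = k}) * ?f k)"
      by (intro sum.cong refl) (simp add: conj_assoc)
    also have "\<dots> \<le> (\<Sum>k \<in> {y + 1..2 * n}. real q ^ (r choose 2) / Q ^ (y + 1) * (2 * A\<^sup>2 * real q ^ (10 * n\<^sup>2 + n)))"
    proof (rule sum_mono)
      fix k assume k: "k \<in> {y + 1..2 * n}"
      then have kr: "k \<le> r" using n by (simp add: r_def)
      have "real q ^ ((r - k) choose 2) * Q ^ k = real q ^ (r choose 2) * real q ^ (Suc k choose 2)"
      proof -
        have "real q ^ ((r - k) choose 2) * Q ^ k = real q ^ (((r - k) choose 2) + k * r)"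
          by (simp add: Q_def power_add power_mult[symmetric] mult.commute)
        then show ?thesis unfolding choose_two_complement[OF kr] power_add .
      qed
      moreover have "Q ^ k = Q ^ (k - y - 1) * Q ^ (y + 1)"
        unfolding power_add[symmetric] using k by (intro arg_cong[of _ _ "power Q"]) auto
      moreover have "Q ^ (y + 1) > 0" using Q1 by simp
      ultimately have w: "Q ^ (k - y - 1) * real q ^ ((r - k) choose 2) = real q ^ (r choose 2) / Q ^ (y + 1) * real q ^ (Suc k choose 2)"
      proof -
        have "C * (P * R) = B * S \<Longrightarrow> R > 0 \<Longrightarrow> P * C = B / R * S" for B C P R S :: real
          by (simp add: field_simps)
        then show ?thesis using \<open>Q ^ (y + 1) > 0\<close> \<open>real q ^ ((r - k) choose 2) * Q ^ k = _\<close>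
          unfolding \<open>Q ^ k = _\<close> by blast
      qed
      \<comment> \<open>The left side is \<open>(5 * k\<^sup>2 + k) / 2\<close>; the bound is its
        value at \<open>k = 2 * n\<close>.\<close>
      have e: "(Suc k choose 2) + 2 * k\<^sup>2 \<le> 10 * n\<^sup>2 + n"
      proof -
        have "2 * (Suc k choose 2) + 4 * k\<^sup>2 = 5 * (k * k) + k"
          by (simp add: double_choose_two power2_eq_square)
        moreover have "k * k \<le> (2 * n) * (2 * n)" using k by (intro mult_le_mono) auto
        ultimately show ?thesis using k by (simp add: power2_eq_square)
      qed
      have "real (card {K \<in> subs V. ?bad K \<and> dim K = k}) * ?f k \<le> A\<^sup>2 * Q ^ (k - y - 1) * ?f k"
        using cnt[of k] k by (intro mult_right_mono) auto
      also have "\<dots> = (Q ^ (k - y - 1) * real q ^ ((r - k) choose 2)) * (2 * A\<^sup>2 * real q ^ (2 * k\<^sup>2))"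
        by simp
      also have "\<dots> = real q ^ (r choose 2) / Q ^ (y + 1) * (2 * A\<^sup>2 * real q ^ ((Suc k choose 2) + 2 * k\<^sup>2))"
        unfolding w power_add by simp
      also have "\<dots> \<le> real q ^ (r choose 2) / Q ^ (y + 1) * (2 * A\<^sup>2 * real q ^ (10 * n\<^sup>2 + n))"
        using e q1 Q1 by (intro mult_left_mono power_increasing) auto
      finally show "real (card {K \<in> subs V. ?bad K \<and> dim K = k}) * ?f k \<le>
        real q ^ (r choose 2) / Q ^ (y + 1) * (2 * A\<^sup>2 * real q ^ (10 * n\<^sup>2 + n))" .
    qed
    also have "\<dots> = real (card {y + 1..2 * n}) * (real q ^ (r choose 2) / Q ^ (y + 1) * (2 * A\<^sup>2 * real q ^ (10 * n\<^sup>2 + n)))"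
      by simp
    also have "\<dots> \<le> (2 * real n + 1) * (real q ^ (r choose 2) / Q ^ (y + 1) * (2 * A\<^sup>2 * real q ^ (10 * n\<^sup>2 + n)))"
      using q1 Q1 by (intro mult_right_mono) auto
    finally show ?thesis by (simp only: mult.assoc mult.commute mult.left_commute)
  qed
  finally show ?thesis unfolding eq[symmetric] by (simp only: r_def Q_def)
qed

end

section \<open>Log-concavity of the coefficients\<close>

definition qfac :: "real \<Rightarrow> nat \<Rightarrow> real" where
  "qfac q y = (\<Prod>l<y. q ^ Suc l / (q ^ Suc l - 1))"

lemma qfac_pos_bounds:
  assumes "q \<ge> 2"
  shows "1 \<le> qfac q y" "qfac q y \<le> 2 ^ y"
proof -
  have p: "2 \<le> q ^ Suc l" for l
  proof -
    have "2 * 1 \<le> q * q ^ l" using assms by (intro mult_mono one_le_power) auto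
    then show ?thesis by simp
  qed
  have f: "1 \<le> q ^ Suc l / (q ^ Suc l - 1)" "q ^ Suc l / (q ^ Suc l - 1) \<le> 2" for l
  proof -
    have "1 \<le> x / (x - 1)" "x / (x - 1) \<le> 2" if "2 \<le> x" for x :: real
      using that by (auto simp: divide_simps)
    then show "1 \<le> q ^ Suc l / (q ^ Suc l - 1)" "q ^ Suc l / (q ^ Suc l - 1) \<le> 2" using p by blast+
  qed
  show "1 \<le> qfac q y" unfolding qfac_def by (intro prod_ge_1 f)
  have "qfac q y \<le> (\<Prod>l<y. 2)" unfolding qfac_def using f by (intro prod_mono) (auto intro: order_trans[OF zero_le_one])
  then show "qfac q y \<le> 2 ^ y" by simp
qed

lemma qfac_Suc: "qfac q (Suc y) = qfac q y * (q ^ Suc y / (q ^ Suc y - 1))"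
  by (simp add: qfac_def)

text \<open>The comparison is that of \<open>x / (x - 1)\<close> with
  \<open>q * x / (q * x - 1)\<close>, where \<open>x = q ^ Suc y\<close>. Their quotient lies
  between 1 and 3/2; the upper value is attained for \<open>q = 2\<close> and
  \<open>y = 0\<close>.\<close>

lemma qfac_log_concave:
  assumes q: "q \<ge> 2"
  shows "qfac q y * qfac q (Suc (Suc y)) \<le> (qfac q (Suc y))\<^sup>2"
    "(qfac q (Suc y))\<^sup>2 \<le> 3 / 2 * (qfac q y * qfac q (Suc (Suc y)))"
proof -
  define x where "x = q ^ Suc y"
  have x: "x \<ge> 2"
  proof -
    have "2 * 1 \<le> q * q ^ y" using q by (intro mult_mono one_le_power) auto
    then show ?thesis by (simp add: x_def)
  qed
  have F: "qfac q y > 0" using qfac_pos_bounds(1)[OF q, of y] by linarith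
  have e: "qfac q (Suc y) = qfac q y * (x / (x - 1))"
    "qfac q (Suc (Suc y)) = qfac q y * (x / (x - 1)) * (q * x / (q * x - 1))"
    by (simp_all add: qfac_Suc x_def)
  have qx: "q * x \<ge> 2 * x" using q x by (intro mult_right_mono) auto
  have frac: "x / (x - 1) = 1 + 1 / (x - 1)" "q * x / (q * x - 1) = 1 + 1 / (q * x - 1)"
  proof -
    have "t / (t - 1) = 1 + 1 / (t - 1)" if "t > 1" for t :: real using that by (simp add: field_simps)
    moreover have "2 * 1 \<le> q * x" using q x by (intro mult_mono) auto
    then have "q * x > 1" by linarith
    moreover have "x > 1" using x by linarith
    ultimately show "x / (x - 1) = 1 + 1 / (x - 1)" "q * x / (q * x - 1) = 1 + 1 / (q * x - 1)"
      by blast+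
  qed
  have 1: "q * x / (q * x - 1) \<le> x / (x - 1)"
  proof -
    have "x \<le> q * x" "x > 1" using x qx by linarith+
    then have "x - 1 \<le> q * x - 1" "0 < x - 1" by linarith+
    then have "1 / (q * x - 1) \<le> 1 / (x - 1)" by (intro divide_left_mono mult_pos_pos) linarith+
    then show ?thesis unfolding frac by simp
  qed
  have "x / (x - 1) \<le> 3 / 2 * (q * x / (q * x - 1))"
  proof -
    have "1 / (x - 1) \<le> 1 / 2 + 3 / 2 * (1 / (q * x - 1))"
    proof (cases "x \<ge> 3")
      case True
      then have "1 / (x - 1) \<le> 1 / 2" by (simp add: divide_simps)
      moreover have "0 \<le> q * x - 1" using x qx by linarith
      then have "0 \<le> 1 / (q * x - 1)" by (rule divide_nonneg_nonneg[OF zero_le_one])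
      ultimately show ?thesis by linarith
    next
      case False
      \<comment> \<open>As \<open>q\<close> is at most \<open>x\<close>, it suffices to treat
        \<open>q = x\<close>, where the inequality reduces to
        \<open>(x - 2) * x \<ge> 0\<close>.\<close>
      have "q \<le> x" using q x_def mult_left_mono[of 1 "q ^ y" q] one_le_power[of q y] by auto
      then have "q * x \<le> x * x" using x by (intro mult_right_mono) auto
      moreover have "q * x - 1 > 0" using x qx by linarith
      ultimately have "1 / (x * x - 1) \<le> 1 / (q * x - 1)"
        by (intro divide_left_mono mult_pos_pos) linarith+
      moreover have "1 / (x - 1) \<le> 1 / 2 + 3 / 2 * (1 / (x * x - 1))"
      proof -
        have d: "x * x - 1 = (x - 1) * (x + 1)" by (simp add: algebra_simps)
        have "(x - 2) * x \<ge> 0" using x by simp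
        then have "2 * (x + 1) \<le> (x - 1) * (x + 1) + 3" by (simp add: algebra_simps)
        then have "(2 * (x + 1)) / (2 * ((x - 1) * (x + 1))) \<le> ((x - 1) * (x + 1) + 3) / (2 * ((x - 1) * (x + 1)))"
          using x by (intro divide_right_mono) auto
        moreover have cancel: "(2 * t) / (2 * (s * t)) = 1 / s" "(s * t + 3) / (2 * (s * t)) = 1 / 2 + 3 / 2 * (1 / (s * t))"
          if "s > 0" "t > 0" for s t :: real using that by (simp_all add: field_simps)
        have x': "x - 1 > 0" "x + 1 > 0" using x by linarith+
        moreover note cancel(1)[OF x'] cancel(2)[OF x', folded d]
        moreover note d
        ultimately show ?thesis by simp
      qed
      ultimately show ?thesis by linarith
    qed
    moreover have "u \<le> 1 / 2 + 3 / 2 * t \<Longrightarrow> 1 + u \<le> 3 / 2 * (1 + t)" for u t :: real by (simp add: field_simps)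
    ultimately show ?thesis unfolding frac by blast
  qed
  note 2 = this
  have "0 \<le> qfac q y * (qfac q y * (x / (x - 1)))" using F x by simp
  moreover have "a * (a * u * w) \<le> (a * u)\<^sup>2" "(a * u)\<^sup>2 \<le> 3 / 2 * (a * (a * u * w))"
    if "w \<le> u" "u \<le> 3 / 2 * w" "0 \<le> a * (a * u)" for a u w :: real
    using mult_left_mono[OF that(1,3)] mult_left_mono[OF that(2,3)] by (simp_all add: power2_eq_square mult_ac)
  ultimately show "qfac q y * qfac q (Suc (Suc y)) \<le> (qfac q (Suc y))\<^sup>2"
    "(qfac q (Suc y))\<^sup>2 \<le> 3 / 2 * (qfac q y * qfac q (Suc (Suc y)))"
    unfolding e using 1 2 by blast+
qed

text \<open>Exhibits \<open>qfac\<close> as the limit of normalised Gaussian binomials for growing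
  \<open>m\<close>, with an explicit product in place of the error.\<close>

lemma gbinom_eq_qfac:
  assumes "q \<ge> 2" "y \<le> m"
  shows "gbinom q m y * q ^ (y * y) = qfac q y * (\<Prod>l<y. 1 - 1 / q ^ (m - l)) * q ^ (m * y)"
  using assms(2)
proof (induction y)
  case (Suc y)
  then have y: "y < m" by simp
  have q1: "q ^ Suc y - 1 \<noteq> 0" using assms(1) by (metis less_irrefl one_less_power zero_less_Suc right_minus_eq
      less_le_trans one_less_numeral_iff semiring_norm(76))
  have IH: "gbinom q m y * q ^ (y * y) = qfac q y * (\<Prod>l<y. 1 - 1 / q ^ (m - l)) * q ^ (m * y)"
    using Suc by simp
  have m: "q ^ m = q ^ (m - y) * q ^ y" using y by (simp add: power_add[symmetric])
  have sq: "q ^ (Suc y * Suc y) = q ^ (y * y) * (q ^ y * q ^ Suc y)"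
    by (simp add: power_add[symmetric] algebra_simps)
  have "gbinom q m (Suc y) * q ^ (Suc y * Suc y) =
      (gbinom q m y * q ^ (y * y)) * ((q ^ (m - y) - 1) * q ^ y * (q ^ Suc y / (q ^ Suc y - 1)))"
    unfolding gbinom_Suc sq by simp
  also have "(q ^ (m - y) - 1) * q ^ y = (1 - 1 / q ^ (m - y)) * q ^ m"
    unfolding m using assms(1) by (simp add: field_simps)
  finally show ?case unfolding IH qfac_Suc by (simp add: power_add mult_ac)
qed (simp add: qfac_def)

lemma prod_one_minus_ge:
  fixes x :: "nat \<Rightarrow> real"
  assumes "\<And>l. l < y \<Longrightarrow> 0 \<le> x l \<and> x l \<le> e" "e \<le> 1"
  shows "1 - real y * e \<le> (\<Prod>l<y. 1 - x l)" "(\<Prod>l<y. 1 - x l) \<le> 1" "0 \<le> (\<Prod>l<y. 1 - x l)"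
proof -
  show le1: "(\<Prod>l<y. 1 - x l) \<le> 1" using assms by (intro prod_le_1) (auto, smt (verit))
  show "0 \<le> (\<Prod>l<y. 1 - x l)" using assms by (intro prod_nonneg) (auto, smt (verit))
  show "1 - real y * e \<le> (\<Prod>l<y. 1 - x l)" using assms(1)
  proof (induction y)
    case (Suc y)
    have IH: "1 - real y * e \<le> (\<Prod>l<y. 1 - x l)" using Suc by auto
    have le1: "(\<Prod>l<y. 1 - x l) \<le> 1" "0 \<le> (\<Prod>l<y. 1 - x l)"
      using Suc.prems assms(2) by (auto intro!: prod_le_1 prod_nonneg) (smt (verit) less_Suc_eq)+
    have "x y * (\<Prod>l<y. 1 - x l) \<le> e * 1"
      using Suc.prems[of y] le1 by (intro mult_mono) auto
    then show ?case using IH by (simp add: algebra_simps)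
  qed simp
qed

section \<open>Coefficients normalised by their geometric factor\<close>

context vector_matroid
begin

text \<open>\<open>G\<close> is the normalised contribution of one free subspace. With
  \<open>m = r - y - 1\<close> all powers of \<open>q\<close> cancel, and the Gaussian binomial
  leaves \<open>qfac q y\<close> times a product between 63/64 and 1.\<close>

lemma normalized_main_term:
  assumes "2 * y < dim V" "64 * real n \<le> real q ^ (dim V - 2 * n)" "y \<le> n" "2 * n < dim V"
  defines "G \<equiv> gbinom q (dim V - y - 1) y * real q ^ ((dim V - 2 * y) choose 2) * (real q ^ dim V) ^ y / real q ^ (dim V choose 2)"
  shows "63 / 64 * qfac q y \<le> G" "G \<le> qfac q y"
proof -
  define r where "r = dim V"
  define m where "m = r - y - 1"
  have q2: "real q \<ge> 2" using q_ge_2 by simp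
  have q0: "real q > 0" using q2 by simp
  define Pr where "Pr = (\<Prod>l<y. 1 - 1 / real q ^ (m - l))"
  have r: "2 * y < r" using assms by (simp add: r_def)
  have ym: "y \<le> m" using r by (simp add: m_def)
  have g: "gbinom q m y = qfac q y * Pr * real q ^ (m * y) / real q ^ (y * y)"
    using gbinom_eq_qfac[OF q2 ym] q0 unfolding Pr_def by (simp add: field_simps)
  have "real q ^ ((r - 2 * y) choose 2) * real q ^ (2 * y * r) = real q ^ (r choose 2) * real q ^ (Suc (2 * y) choose 2)"
    unfolding power_add[symmetric] using choose_two_complement[of "2 * y" r] r by simp
  then have w: "real q ^ ((r - 2 * y) choose 2) = real q ^ (r choose 2) * real q ^ (Suc (2 * y) choose 2) / real q ^ (2 * y * r)"
    using q0 by (simp add: field_simps)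
  have "G = qfac q y * Pr * (real q ^ (m * y) * real q ^ (Suc (2 * y) choose 2) * real q ^ (r * y)) / (real q ^ (y * y) * real q ^ (2 * y * r))"
    unfolding G_def r_def[symmetric] m_def[symmetric] g w using q0 by (simp add: power_mult[symmetric])
  also have "real q ^ (m * y) * real q ^ (Suc (2 * y) choose 2) * real q ^ (r * y) = real q ^ (y * y) * real q ^ (2 * y * r)"
  proof -
    have c: "(Suc (2 * y) choose 2) = (2 * y + 1) * y" using double_choose_two[of "Suc (2 * y)"] by simp
    obtain t where t: "r = t + y + 1" "m = t" using r by (metis m_def Suc_eq_plus1 add.assoc add.commute diff_add diff_diff_left
          le_add2 less_imp_le_nat mult_2 Suc_leI le_add_diff_inverse2 trans_le_add2 add_Suc_right le_trans not_less_eq_eq)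
    have "m * y + (Suc (2 * y) choose 2) + r * y = y * y + 2 * y * r"
      unfolding c t by (simp add: algebra_simps)
    then show ?thesis by (simp only: power_add[symmetric])
  qed
  finally have G: "G = qfac q y * Pr" using q0 by simp
  define e where "e = 1 / real q ^ (r - 2 * n)"
  have x: "0 \<le> 1 / real q ^ (m - l) \<and> 1 / real q ^ (m - l) \<le> e" if "l < y" for l
  proof -
    have "r - 2 * n \<le> m - l" using that assms(3) by (simp add: m_def)
    then have "real q ^ (r - 2 * n) \<le> real q ^ (m - l)" using q2 by (intro power_increasing) auto
    then show ?thesis unfolding e_def using q0 by (auto intro!: divide_left_mono)
  qed
  have e1: "e \<le> 1" unfolding e_def using one_le_power[of "real q" "r - 2 * n"] q2 by (simp add: divide_simps)
  have "real y * e \<le> real n * e" using assms(3) q0 by (intro mult_right_mono) (auto simp: e_def)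
  also have "\<dots> \<le> 1 / 64" unfolding e_def using assms(2) q0 by (simp add: field_simps r_def)
  finally have P: "63 / 64 \<le> Pr" "Pr \<le> 1"
    using prod_one_minus_ge(1,2)[of y "\<lambda>l. 1 / real q ^ (m - l)" e, OF x e1] unfolding Pr_def by auto
  have F: "qfac q y \<ge> 0" using qfac_pos_bounds(1)[OF q2, of y] by linarith
  show "63 / 64 * qfac q y \<le> G" "G \<le> qfac q y"
    unfolding G using mult_left_mono[OF P(1) F] mult_left_mono[OF P(2) F] by (simp_all add: mult.commute)
qed

text \<open>Main term and error each deviate by at most 1/64. The error bound is absolute;
  \<open>a \<ge> 1\<close>, which holds because there is a free subspace of dimension
  \<open>y\<close>, makes it relative.\<close>

theorem normalized_coeff_bounds:
  assumes spans: "span (vec ` E) = V" and n: "2 * n < dim V" "y \<le> n"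
    and free: "\<And>j. n < j \<Longrightarrow> free_subs j V = {}"
    and A: "\<And>j. real (card (free_subs j V)) \<le> A" "1 \<le> A"
    and ne: "free_subs y V \<noteq> {}"
    and large: "128 * A\<^sup>2 * (2 * real n + 1) * real q ^ (10 * n\<^sup>2 + n) \<le> real q ^ dim V"
      "64 * real n \<le> real q ^ (dim V - 2 * n)"
  defines "x \<equiv> of_int (coeff (inverse_KL_poly M) y) * (real q ^ dim V) ^ y / real q ^ (dim V choose 2)"
    and "a \<equiv> real (card (free_subs y V)) * qfac q y"
  shows "31 / 32 * a \<le> x" "x \<le> 33 / 32 * a"
proof -
  define N where "N = real (card (free_subs y V))"
  define Q where "Q = real q ^ dim V"
  define B where "B = real q ^ (dim V choose 2)"
  define W where "W = gbinom q (dim V - y - 1) y * real q ^ ((dim V - 2 * y) choose 2)"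
  define err where "err = 2 * A\<^sup>2 * (2 * real n + 1) * real q ^ (10 * n\<^sup>2 + n)"
  have q2: "real q \<ge> 2" using q_ge_2 by simp
  have pos: "Q > 0" "B > 0" using q2 by (simp_all add: Q_def B_def)
  have est: "\<bar>of_int (coeff (inverse_KL_poly M) y) - N * W\<bar> \<le> B / Q ^ (y + 1) * err"
    using coeff_inverse_KL_estimate[OF spans n free A] by (simp add: N_def W_def B_def Q_def err_def)
  have "x - N * (W * Q ^ y / B) = (of_int (coeff (inverse_KL_poly M) y) - N * W) * (Q ^ y / B)"
    unfolding x_def Q_def[symmetric] B_def[symmetric] by (simp add: algebra_simps diff_divide_distrib)
  then have "\<bar>x - N * (W * Q ^ y / B)\<bar> = \<bar>of_int (coeff (inverse_KL_poly M) y) - N * W\<bar> * (Q ^ y / B)"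
    using pos by (simp add: abs_mult)
  also have "\<dots> \<le> B / Q ^ (y + 1) * err * (Q ^ y / B)"
    using est pos by (intro mult_right_mono) auto
  also have "\<dots> = err / Q" using pos by (simp add: field_simps)
  also have "\<dots> \<le> 1 / 64" using large(1) pos by (simp add: field_simps err_def Q_def)
  finally have 1: "\<bar>x - N * (W * Q ^ y / B)\<bar> \<le> 1 / 64" .
  have "card (free_subs y V) \<noteq> 0" using ne finite_free_subs[of y] by simp
  then have N1: "N \<ge> 1" unfolding N_def by linarith
  have y2: "2 * y < dim V" using n by simp
  have F: "1 \<le> qfac q y" using qfac_pos_bounds(1)[OF q2] .
  have a1: "1 \<le> a" unfolding a_def N_def[symmetric] using mult_mono[OF N1 F] N1 by simp
  note G = normalized_main_term[OF y2 large(2) n(2,1), folded W_def Q_def B_def]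
  have "N * (63 / 64 * qfac q y) \<le> N * (W * Q ^ y / B)" "N * (W * Q ^ y / B) \<le> N * qfac q y"
    using mult_left_mono[OF G(1), of N] mult_left_mono[OF G(2), of N] N1 by simp_all
  then have "63 / 64 * a \<le> N * (W * Q ^ y / B)" "N * (W * Q ^ y / B) \<le> a"
    by (simp_all add: a_def N_def)
  then show "31 / 32 * a \<le> x" "x \<le> 33 / 32 * a" using 1 a1 unfolding abs_le_iff by linarith+
qed

end

text \<open>Multiplication by \<open>Q ^ y / B\<close> removes the geometric decay and changes the
  defect at \<open>j\<close> by the square of a positive number, so signs are preserved. The factors
  2 in the hypotheses leave room for \<open>qfac\<close> and for the tolerance 1/32 on both sides.
  Strict decrease comes from \<open>Q\<close> being large against all values of \<open>A\<close> and
  \<open>qfac\<close>.\<close>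

lemma fails_log_concavity_only_atI:
  fixes f :: "int poly" and q Q B :: real and A :: "nat \<Rightarrow> real"
  assumes q: "q \<ge> 2" and pos: "B > 0" and i: "1 \<le> i" "i < n"
    and zero: "\<And>y. n < y \<Longrightarrow> coeff f y = 0"
    and lower: "\<And>y. y \<le> n \<Longrightarrow> 31 / 32 * (A y * qfac q y) \<le> of_int (coeff f y) * Q ^ y / B"
    and upper: "\<And>y. y \<le> n \<Longrightarrow> of_int (coeff f y) * Q ^ y / B \<le> 33 / 32 * (A y * qfac q y)"
    and A1: "\<And>y. y \<le> n \<Longrightarrow> 1 \<le> A y" "\<And>y. y \<le> n \<Longrightarrow> A y \<le> Amax"
    and Q: "2 ^ (n + 1) * Amax < Q"
    and concave: "\<And>j. 1 \<le> j \<Longrightarrow> j < n \<Longrightarrow> j \<noteq> i \<Longrightarrow> 2 * (A (j - 1) * A (j + 1)) \<le> (A j)\<^sup>2"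
    and convex: "2 * (A i)\<^sup>2 \<le> \<delta> * (A (i - 1) * A (i + 1))" "\<delta> \<le> 1"
  shows "fails_log_concavity_only_at f n i"
    and "(of_int (coeff f i))\<^sup>2 / (of_int (coeff f (i - 1)) * of_int (coeff f (i + 1))) < \<delta>"
proof -
  define x where "x y = of_int (coeff f y) * Q ^ y / B" for y
  define a where "a y = A y * qfac q y" for y
  have Amax: "1 \<le> Amax" using A1[of 0] by auto
  have Q0: "Q > 0" using Q Amax by (smt (verit) zero_less_power mult_pos_pos)
  have F: "1 \<le> qfac q y" "qfac q y \<le> 2 ^ y" for y using qfac_pos_bounds[OF q] by auto
  have a1: "1 \<le> a y" if "y \<le> n" for y
    unfolding a_def using mult_mono[OF A1(1)[OF that] F(1)] A1(1)[OF that] by simp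
  have lo: "31 / 32 * a y \<le> x y" and up: "x y \<le> 33 / 32 * a y" if "y \<le> n" for y
    using lower upper that by (auto simp: x_def a_def)
  have xpos: "0 < x y" if "y \<le> n" for y using lo[OF that] a1[OF that] by linarith
  have c: "of_int (coeff f y) = x y * (B / Q ^ y)" for y using pos Q0 by (simp add: x_def)
  have cpos: "0 < coeff f y" if "y \<le> n" for y
  proof -
    have "0 < real_of_int (coeff f y)" unfolding c using xpos[OF that] pos Q0 by simp
    then show ?thesis by simp
  qed
  have deg: "degree f = n"
  proof (rule antisym)
    show "degree f \<le> n" by (rule degree_le) (use zero in auto)
    show "n \<le> degree f" using cpos[of n] by (intro le_degree) auto
  qed
  have dec: "coeff f (j + 1) < coeff f j" if j: "j < n" for j
  proof -
    have "x (j + 1) \<le> 33 / 32 * a (j + 1)" using up j by simp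
    also have "\<dots> \<le> 33 / 32 * (Amax * 2 ^ n)"
    proof -
      have "A (j + 1) * qfac q (j + 1) \<le> Amax * 2 ^ (j + 1)"
        using A1[of "j + 1"] F[of "j + 1"] j Amax by (intro mult_mono) auto
      also have "\<dots> \<le> Amax * 2 ^ n" using j Amax by (intro mult_left_mono power_increasing) auto
      finally show ?thesis by (simp add: a_def)
    qed
    also have "\<dots> < 31 / 32 * Q"
    proof -
      have "2 * (Amax * 2 ^ n) < Q" using Q by (simp add: mult_ac)
      moreover have "0 < Amax * 2 ^ n" using Amax by simp
      ultimately show ?thesis by linarith
    qed
    also have "\<dots> \<le> x j * Q" using lo[of j] a1[of j] j Q0 by (intro mult_right_mono) auto
    finally have "x (j + 1) < x j * Q" .
    then have "x (j + 1) * (B / Q ^ (j + 1)) < x j * Q * (B / Q ^ (j + 1))"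
      using pos Q0 by (intro mult_strict_right_mono) auto
    also have "\<dots> = x j * (B / Q ^ j)" using Q0 by simp
    finally have "real_of_int (coeff f (j + 1)) < real_of_int (coeff f j)" unfolding c .
    then show ?thesis by simp
  qed
  have defect: "real_of_int (log_concavity_defect f j) = (x j)\<^sup>2 * (B / Q ^ j)\<^sup>2 - (x (j - 1) * x (j + 1)) * (B / Q ^ j)\<^sup>2"
    if "1 \<le> j" for j
  proof -
    obtain k where k: "j = Suc k" using \<open>1 \<le> j\<close> by (cases j) auto
    have BQ: "B / Q ^ k * (B / Q ^ Suc (Suc k)) = (B / Q ^ Suc k)\<^sup>2"
      using Q0 by (simp add: power2_eq_square)
    have "(u * w)\<^sup>2 - (u' * w') * (u'' * w'') = u\<^sup>2 * w\<^sup>2 - (u' * u'') * w\<^sup>2"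
      if "w' * w'' = w\<^sup>2" for u u' u'' w w' w'' :: real
      unfolding that[symmetric] by (simp add: power_mult_distrib that)
    from this[OF BQ] show ?thesis
      unfolding log_concavity_defect_def of_int_diff of_int_mult of_int_power c k by simp
  qed
  have prod: "x (j - 1) * x (j + 1) \<le> (33 / 32)\<^sup>2 * (a (j - 1) * a (j + 1))"
    "(31 / 32)\<^sup>2 * (a (j - 1) * a (j + 1)) \<le> x (j - 1) * x (j + 1)"
    "(31 / 32)\<^sup>2 * (a j)\<^sup>2 \<le> (x j)\<^sup>2" "(x j)\<^sup>2 \<le> (33 / 32)\<^sup>2 * (a j)\<^sup>2"
    "1 \<le> a (j - 1) * a (j + 1)"
    if j: "1 \<le> j" "j < n" for j
  proof -
    have le: "j - 1 \<le> n" "j \<le> n" "j + 1 \<le> n" using j by auto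
    note b = a1[OF le(1)] a1[OF le(2)] a1[OF le(3)]
    have "x (j - 1) * x (j + 1) \<le> (33 / 32 * a (j - 1)) * (33 / 32 * a (j + 1))"
      using up[OF le(1)] up[OF le(3)] xpos[OF le(1)] xpos[OF le(3)] b by (intro mult_mono) auto
    then show "x (j - 1) * x (j + 1) \<le> (33 / 32)\<^sup>2 * (a (j - 1) * a (j + 1))" by (simp add: power2_eq_square)
    have "(31 / 32 * a (j - 1)) * (31 / 32 * a (j + 1)) \<le> x (j - 1) * x (j + 1)"
      using lo[OF le(1)] lo[OF le(3)] xpos[OF le(1)] xpos[OF le(3)] b by (intro mult_mono) auto
    then show "(31 / 32)\<^sup>2 * (a (j - 1) * a (j + 1)) \<le> x (j - 1) * x (j + 1)" by (simp add: power2_eq_square)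
    show "(31 / 32)\<^sup>2 * (a j)\<^sup>2 \<le> (x j)\<^sup>2" unfolding power_mult_distrib[symmetric]
      using lo[OF le(2)] b by (intro power_mono) auto
    show "(x j)\<^sup>2 \<le> (33 / 32)\<^sup>2 * (a j)\<^sup>2" unfolding power_mult_distrib[symmetric]
      using up[OF le(2)] xpos[OF le(2)] by (intro power_mono) auto
    show "1 \<le> a (j - 1) * a (j + 1)" using mult_mono[OF b(1,3)] b by simp
  qed
  have qf: "qfac q (j - 1) * qfac q (j + 1) \<le> (qfac q j)\<^sup>2" "(qfac q j)\<^sup>2 \<le> 3 / 2 * (qfac q (j - 1) * qfac q (j + 1))"
    if "1 \<le> j" for j
    using qfac_log_concave[OF q, of "j - 1"] that by simp_all
  have good: "x (j - 1) * x (j + 1) < (x j)\<^sup>2" if j: "1 \<le> j" "j < n" "j \<noteq> i" for j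
  proof -
    have "A (j - 1) \<ge> 1" "A (j + 1) \<ge> 1" using A1 j by auto
    then have "(2 * (A (j - 1) * A (j + 1))) * (qfac q (j - 1) * qfac q (j + 1)) \<le> (A j)\<^sup>2 * (qfac q j)\<^sup>2"
      using concave[OF j] qf(1)[OF j(1)] F[of "j - 1"] F[of "j + 1"] by (intro mult_mono) auto
    then have "2 * (a (j - 1) * a (j + 1)) \<le> (a j)\<^sup>2" unfolding a_def by (simp add: power_mult_distrib mult_ac)
    then show ?thesis using prod[OF j(1,2)] by (simp add: power2_eq_square)
  qed
  have bad: "(x i)\<^sup>2 < \<delta> * (x (i - 1) * x (i + 1))"
  proof -
    have "A (i - 1) \<ge> 1" "A (i + 1) \<ge> 1" "A i \<ge> 1" using A1 i by auto
    then have AA: "1 \<le> A (i - 1) * A (i + 1)" "1 \<le> (A i)\<^sup>2" using mult_mono[of 1 "A (i - 1)" 1 "A (i + 1)"] by auto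
    have "0 < \<delta> * (A (i - 1) * A (i + 1))" using convex(1) AA by linarith
    then have \<delta>0: "0 < \<delta>" using AA by (simp add: zero_less_mult_iff)
    have "(2 * (A i)\<^sup>2) * (qfac q i)\<^sup>2 \<le> (\<delta> * (A (i - 1) * A (i + 1))) * (3 / 2 * (qfac q (i - 1) * qfac q (i + 1)))"
      by (rule mult_mono[OF convex(1) qf(2)[OF i(1)]]) (use AA \<delta>0 in auto)
    \<comment> \<open>Together with the tolerances this leaves
      \<open>3 / 4 * (33 / 31)\<^sup>2 < 1\<close> to be checked.\<close>
    then have "2 * (a i)\<^sup>2 \<le> 3 / 2 * (\<delta> * (a (i - 1) * a (i + 1)))" unfolding a_def by (simp add: power_mult_distrib mult_ac)
    moreover have "\<delta> * ((31 / 32)\<^sup>2 * (a (i - 1) * a (i + 1))) \<le> \<delta> * (x (i - 1) * x (i + 1))"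
      using prod(2)[OF i] \<delta>0 by (intro mult_left_mono) auto
    moreover have "0 < \<delta> * (a (i - 1) * a (i + 1))" using \<delta>0 prod(5)[OF i] by simp
    ultimately show ?thesis using prod(4)[OF i] by (simp add: power2_eq_square)
  qed
  have xx: "0 < x (i - 1) * x (i + 1)" using xpos i by simp
  have "x (i - 1) * x (i + 1) * \<delta> \<le> x (i - 1) * x (i + 1) * 1" using convex(2) xx by (intro mult_left_mono) auto
  then have bad1: "(x i)\<^sup>2 < x (i - 1) * x (i + 1)" using bad by (simp add: mult.commute)
  have posBQ: "0 < (B / Q ^ j)\<^sup>2" for j using pos Q0 by simp
  have "0 < real_of_int (log_concavity_defect f j)" if "1 \<le> j" "j < n" "j \<noteq> i" for j
    unfolding defect[OF that(1)] using mult_strict_right_mono[OF good[OF that] posBQ[of j]] by simp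
  moreover have "real_of_int (log_concavity_defect f i) < 0"
    unfolding defect[OF i(1)] using mult_strict_right_mono[OF bad1 posBQ[of i]] by simp
  ultimately show "fails_log_concavity_only_at f n i"
    unfolding fails_log_concavity_only_at_def using deg dec cpos[of n] by simp
  obtain k where k: "i = Suc k" using i(1) by (cases i) auto
  have BQ: "B / Q ^ k * (B / Q ^ Suc (Suc k)) = (B / Q ^ Suc k)\<^sup>2" using Q0 by (simp add: power2_eq_square)
  have "(of_int (coeff f i))\<^sup>2 / (of_int (coeff f (i - 1)) * of_int (coeff f (i + 1))) =
      ((x i)\<^sup>2 * (B / Q ^ i)\<^sup>2) / ((x (i - 1) * x (i + 1)) * (B / Q ^ i)\<^sup>2)"
  proof -
    have "(u * w)\<^sup>2 / ((u' * w') * (u'' * w'')) = (u\<^sup>2 * w\<^sup>2) / ((u' * u'') * w\<^sup>2)"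
      if "w' * w'' = w\<^sup>2" for u u' u'' w w' w'' :: real
    proof -
      have "(u' * w') * (u'' * w'') = (u' * u'') * w\<^sup>2" unfolding that[symmetric] by simp
      then show ?thesis by (simp only: power_mult_distrib)
    qed
    from this[OF BQ] show ?thesis unfolding c k by simp
  qed
  also have "\<dots> = (x i)\<^sup>2 / (x (i - 1) * x (i + 1))" using posBQ[of i] by simp
  also have "\<dots> < \<delta>" using bad xx by (simp add: divide_less_eq)
  finally show "(of_int (coeff f i))\<^sup>2 / (of_int (coeff f (i - 1)) * of_int (coeff f (i + 1))) < \<delta>" .
qed

text \<open>Each ratio of consecutive terms is at least \<open>q\<^sup>2\<close> times the next one.
  The factor 4, rather than 2, is kept because the counts below are sums of two such
  sequences.\<close>

lemma gbinom_log_concave: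
  assumes q: "q \<ge> 2"
  shows "4 * (gbinom q n k * gbinom q n (Suc (Suc k))) \<le> (gbinom q n (Suc k))\<^sup>2"
proof -
  define u where "u = (q ^ (n - k) - 1) / (q ^ (k + 1) - 1)"
  define w where "w = (q ^ (n - Suc k) - 1) / (q ^ (k + 2) - 1)"
  define g where "g = gbinom q n k"
  have e: "gbinom q n (Suc k) = g * u" "gbinom q n (Suc (Suc k)) = g * u * w"
    by (simp_all add: gbinom_Suc u_def w_def g_def)
  have g0: "0 \<le> g" "0 \<le> g * u" using gbinom_mono_bound(1)[OF q] e g_def by metis+
  have "4 * w \<le> u"
  proof (cases "k < n")
    case False
    then show ?thesis by (simp add: u_def w_def)
  next
    case True
    define a where "a = q ^ (n - Suc k)"
    define b where "b = q ^ (k + 1)"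
    have a: "q ^ (n - k) = q * a" "q ^ (k + 2) = q * b"
      using True by (simp_all add: a_def b_def Suc_diff_Suc flip: power_Suc)
    have ab: "1 \<le> a" "1 < b"
      using q by (auto simp: a_def b_def intro!: one_le_power one_less_power simp del: power_Suc)
    have qb: "q * (b - 1) \<le> q * b - 1" "q * (a - 1) \<le> q * a - 1" using q by (simp_all add: right_diff_distrib)
    have pos: "0 < q * (b - 1)" using q ab by simp
    have "4 * w \<le> q * (q * w)"
    proof -
      have w0: "0 \<le> w" unfolding w_def a a_def[symmetric] using ab qb pos by (intro divide_nonneg_nonneg) auto
      have "2 * w \<le> q * w" using q w0 by (intro mult_right_mono) auto
      moreover have "2 * (q * w) \<le> q * (q * w)" using q w0 by (intro mult_right_mono) auto
      ultimately show ?thesis by linarith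
    qed
    also have "w \<le> (a - 1) / (q * (b - 1))"
      unfolding w_def a a_def[symmetric] using ab qb pos by (intro divide_left_mono) auto
    then have "q * (q * w) \<le> q * (q * ((a - 1) / (q * (b - 1))))" using q by (intro mult_left_mono) auto
    also have "\<dots> = (q * (a - 1)) / (b - 1)" using q ab by (simp add: field_simps)
    also have "\<dots> \<le> u" unfolding u_def a b_def[symmetric] using qb ab by (intro divide_right_mono) auto
    finally show ?thesis .
  qed
  then have "g * (g * u) * (4 * w) \<le> g * (g * u) * u" using g0 by (intro mult_left_mono) auto
  then show ?thesis unfolding e g_def[symmetric] by (simp add: power2_eq_square mult_ac)
qed

text \<open>The values \<open>A(y)\<close> for the deleted set used below. The second summand dominates for
  \<open>1 \<le> y < i\<close> and vanishes for \<open>y \<ge> i\<close>.\<close>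

definition free_count :: "real \<Rightarrow> nat \<Rightarrow> nat \<Rightarrow> nat \<Rightarrow> nat \<Rightarrow> real" where
  "free_count q n i s y =
     gbinom q n y + (if y = 0 then 0 else gbinom q (i - 2) (y - 1) * q ^ (i - 2 + s - y))"

text \<open>For \<open>j < i\<close> the products of like summands have a factor 4 to spare, and the
  mixed products grow like \<open>q ^ s\<close> only, negligible against the square of
  \<open>u j\<close>. For \<open>j > i\<close> the summand \<open>u\<close> is absent from all three
  terms. At \<open>i\<close> itself \<open>u\<close> has vanished while \<open>u (i - 1)\<close> is
  still at least \<open>q ^ (s - 1)\<close>, which breaks log-concavity.\<close>

lemma free_count_bounds:
  assumes q: "q \<ge> 2" and i: "2 \<le> i" "i < n" and s: "5 * n\<^sup>2 \<le> s"
  shows "y \<le> n \<Longrightarrow> 1 \<le> free_count q n i s y"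
    and "y \<le> n \<Longrightarrow> free_count q n i s y \<le> q ^ (n\<^sup>2 + n + s + 1)"
    and "1 \<le> j \<Longrightarrow> j < n \<Longrightarrow> j \<noteq> i \<Longrightarrow>
      2 * (free_count q n i s (j - 1) * free_count q n i s (j + 1)) \<le> (free_count q n i s j)\<^sup>2"
    and "2 * q ^ (2 * n\<^sup>2) \<le> \<delta> * q ^ (s - 1) \<Longrightarrow> 0 \<le> \<delta> \<Longrightarrow>
      2 * (free_count q n i s i)\<^sup>2 \<le> \<delta> * (free_count q n i s (i - 1) * free_count q n i s (i + 1))"
proof -
  define b where "b y = gbinom q n y" for y
  define u where "u y = (if y = 0 then 0 else gbinom q (i - 2) (y - 1) * q ^ (i - 2 + s - y))" for y
  have fc: "free_count q n i s y = b y + u y" for y by (simp add: free_count_def b_def u_def)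
  have q1: "1 \<le> q" using q by simp
  have n3: "3 \<le> n" using i by simp
  have nn: "3 * n \<le> n\<^sup>2" using n3 by (simp add: power2_eq_square)
  have b0: "0 \<le> b y" for y unfolding b_def by (rule gbinom_mono_bound(1)[OF q])
  have u0: "0 \<le> u y" for y unfolding u_def using gbinom_mono_bound(1)[OF q] q1 by simp
  have b1: "1 \<le> b y" if "y \<le> n" for y unfolding b_def using that by (rule gbinom_mono_bound(3)[OF q])
  have bu: "b y \<le> q ^ n\<^sup>2" if "y \<le> n" for y
  proof -
    have "b y \<le> (q ^ n) ^ y" unfolding b_def by (rule gbinom_mono_bound(2)[OF q])
    also have "\<dots> \<le> q ^ n\<^sup>2" unfolding power_mult[symmetric] using q1 that
      by (intro power_increasing) (auto simp: power2_eq_square)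
    finally show ?thesis .
  qed
  have uu: "u y \<le> q ^ (n\<^sup>2 + n + s)" if "y \<le> n" for y
  proof (cases "y = 0")
    case False
    have "gbinom q (i - 2) (y - 1) \<le> (q ^ (i - 2)) ^ (y - 1)" by (rule gbinom_mono_bound(2)[OF q])
    also have "\<dots> \<le> q ^ n\<^sup>2" unfolding power_mult[symmetric] power2_eq_square using q1 that i
      by (intro power_increasing mult_le_mono) auto
    finally have "gbinom q (i - 2) (y - 1) * q ^ (i - 2 + s - y) \<le> q ^ n\<^sup>2 * q ^ (n + s)"
      using q1 i gbinom_mono_bound(1)[OF q] by (intro mult_mono power_increasing) auto
    then show ?thesis using False by (simp add: u_def power_add)
  qed (use q1 in \<open>simp add: u_def\<close>)
  have ul: "q ^ (s - 1) \<le> u y" if "1 \<le> y" "y < i" for y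
  proof -
    have "1 \<le> gbinom q (i - 2) (y - 1)" using that by (intro gbinom_mono_bound(3)[OF q]) auto
    moreover have "q ^ (s - 1) \<le> q ^ (i - 2 + s - y)" using that q1 by (intro power_increasing) auto
    ultimately have "1 * q ^ (s - 1) \<le> gbinom q (i - 2) (y - 1) * q ^ (i - 2 + s - y)"
      using q1 by (intro mult_mono) auto
    then show ?thesis using that by (simp add: u_def)
  qed
  have uz: "u y = 0" if "i \<le> y" for y
    using that i by (auto simp: u_def gbinom_eq_0)
  show "1 \<le> free_count q n i s y" if "y \<le> n" using b1[OF that] u0[of y] by (simp add: fc)
  show "free_count q n i s y \<le> q ^ (n\<^sup>2 + n + s + 1)" if "y \<le> n"
  proof -
    have "q ^ n\<^sup>2 \<le> q ^ (n\<^sup>2 + n + s)" using q1 by (intro power_increasing) auto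
    then have "free_count q n i s y \<le> 2 * q ^ (n\<^sup>2 + n + s)" using bu[OF that] uu[OF that] by (simp add: fc)
    also have "\<dots> \<le> q * q ^ (n\<^sup>2 + n + s)" using q by (intro mult_right_mono) auto
    finally show ?thesis by simp
  qed
  show "2 * (free_count q n i s (j - 1) * free_count q n i s (j + 1)) \<le> (free_count q n i s j)\<^sup>2"
    if j: "1 \<le> j" "j < n" "j \<noteq> i"
  proof -
    obtain k where k: "j = Suc k" using j by (cases j) auto
    have bb: "4 * (b k * b (Suc (Suc k))) \<le> (b (Suc k))\<^sup>2" unfolding b_def by (rule gbinom_log_concave[OF q])
    show ?thesis
    proof (cases "i < j")
      case True
      then have "u k = 0" "u (Suc k) = 0" "u (Suc (Suc k)) = 0" using uz k by auto
      moreover have "0 \<le> b k * b (Suc (Suc k))" using b0 by simp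
      ultimately show ?thesis using bb by (simp add: fc k)
    next
      case False
      then have ji: "Suc k < i" using j k by simp
      have uk: "4 * (u k * u (Suc (Suc k))) \<le> (u (Suc k))\<^sup>2"
      proof (cases k)
        case 0
        then show ?thesis by (simp add: u_def)
      next
        case (Suc m)
        define e where "e = i - 2 + s - (m + 3)"
        have "m + 3 \<le> s" using s nn j k Suc by linarith
        then have ex: "i - 2 + s - Suc m = e + 2" "i - 2 + s - Suc (Suc m) = e + 1" "i - 2 + s - Suc (Suc (Suc m)) = e"
          by (auto simp: e_def)
        have "4 * (gbinom q (i - 2) m * gbinom q (i - 2) (Suc (Suc m))) * (q ^ (e + 1))\<^sup>2 \<le>
            (gbinom q (i - 2) (Suc m))\<^sup>2 * (q ^ (e + 1))\<^sup>2"
          by (intro mult_right_mono gbinom_log_concave[OF q]) simp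
        then show ?thesis unfolding u_def Suc by (simp add: ex power_mult_distrib) (simp add: power2_eq_square mult_ac)
      qed
      have "b k * u (Suc (Suc k)) \<le> q ^ n\<^sup>2 * q ^ (n\<^sup>2 + n + s)" "u k * b (Suc (Suc k)) \<le> q ^ (n\<^sup>2 + n + s) * q ^ n\<^sup>2"
        using bu uu u0 b0 j k q1 by (auto intro!: mult_mono)
      then have cross: "8 * (b k * u (Suc (Suc k)) + u k * b (Suc (Suc k))) \<le> 16 * q ^ (2 * n\<^sup>2 + n + s)"
        by (simp add: power_add mult_2 mult_ac)
      also have "\<dots> \<le> q ^ 4 * q ^ (2 * n\<^sup>2 + n + s)"
      proof -
        have "(2::real) ^ 4 \<le> q ^ 4" using q by (intro power_mono) auto
        then show ?thesis using q1 by (intro mult_right_mono) auto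
      qed
      \<comment> \<open>This amounts to \<open>s \<ge> 2 * n\<^sup>2 + n + 6\<close>, which follows
        from \<open>s \<ge> 5 * n\<^sup>2\<close> and \<open>n \<ge> 3\<close>.\<close>
      also have "\<dots> \<le> q ^ (s - 1) * q ^ (s - 1)"
        unfolding power_add[symmetric] using q1 s nn n3 by (intro power_increasing) linarith+
      also have "\<dots> \<le> u (Suc k) * u (Suc k)"
        using ul[of "Suc k"] ji q1 u0 by (intro mult_mono) auto
      finally have "8 * (b k * u (Suc (Suc k)) + u k * b (Suc (Suc k))) \<le> (u (Suc k))\<^sup>2" by (simp add: power2_eq_square)
      moreover have "0 \<le> b (Suc k) * u (Suc k)" using b0 u0 by simp
      moreover have "(b (Suc k) + u (Suc k))\<^sup>2 = (b (Suc k))\<^sup>2 + 2 * (b (Suc k) * u (Suc k)) + (u (Suc k))\<^sup>2"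
        by (simp add: power2_eq_square algebra_simps)
      moreover have "(b k + u k) * (b (Suc (Suc k)) + u (Suc (Suc k))) =
          b k * b (Suc (Suc k)) + (b k * u (Suc (Suc k)) + u k * b (Suc (Suc k))) + u k * u (Suc (Suc k))"
        by (simp add: algebra_simps)
      moreover have "0 \<le> (b (Suc k))\<^sup>2" "0 \<le> (u (Suc k))\<^sup>2" by simp_all
      ultimately have "2 * ((b k + u k) * (b (Suc (Suc k)) + u (Suc (Suc k)))) \<le> (b (Suc k) + u (Suc k))\<^sup>2"
        using bb uk by argo
      then show ?thesis by (simp add: fc k)
    qed
  qed
  show "2 * (free_count q n i s i)\<^sup>2 \<le> \<delta> * (free_count q n i s (i - 1) * free_count q n i s (i + 1))"
    if \<delta>: "2 * q ^ (2 * n\<^sup>2) \<le> \<delta> * q ^ (s - 1)" "0 \<le> \<delta>"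
  proof -
    have "free_count q n i s i \<le> q ^ n\<^sup>2" "0 \<le> free_count q n i s i" using bu[of i] uz[of i] b0 i by (auto simp: fc)
    then have "(free_count q n i s i)\<^sup>2 \<le> (q ^ n\<^sup>2)\<^sup>2" by (rule power_mono)
    also have "(q ^ n\<^sup>2)\<^sup>2 = q ^ (2 * n\<^sup>2)" by (simp add: power_mult[symmetric] mult.commute)
    finally have 1: "2 * (free_count q n i s i)\<^sup>2 \<le> \<delta> * q ^ (s - 1)" using \<delta>(1) by linarith
    have "1 \<le> i - 1" "i - 1 < i" using i by auto
    then have "q ^ (s - 1) \<le> free_count q n i s (i - 1)" using ul[of "i - 1"] b0[of "i - 1"] unfolding fc by linarith
    moreover have "1 \<le> free_count q n i s (i + 1)" using b1[of "i + 1"] u0[of "i + 1"] i by (simp add: fc)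
    ultimately have "q ^ (s - 1) * 1 \<le> free_count q n i s (i - 1) * free_count q n i s (i + 1)"
      using q1 by (intro mult_mono) (auto intro: order_trans[rotated])
    then show ?thesis using 1 mult_left_mono[OF _ \<delta>(2)] by fastforce
  qed
qed

section \<open>The matroids\<close>

context vector_space_over_finite_field
begin

lemma dim_span_insert:
  assumes "subspace Y" "finite Y" "v \<notin> Y"
  shows "dim (span (insert v Y)) = Suc (dim Y)"
proof -
  have v0: "v \<noteq> 0" using assms subspace_0 by auto
  then have d1: "dim (span {v}) = 1" by (simp add: dim_eq_card_independent)
  have "span {v} \<inter> Y = {0}"
  proof
    show "span {v} \<inter> Y \<subseteq> {0}"
    proof
      fix w assume w: "w \<in> span {v} \<inter> Y"
      then obtain k where k: "w = k *s v" by (auto simp: span_singleton)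
      show "w \<in> {0}"
      proof (cases "k = 0")
        case False
        then have "v = inverse k *s w" by (simp add: k)
        then have "v \<in> Y" using w subspace_scale[OF assms(1)] by auto
        then show ?thesis using assms(3) by simp
      qed (simp add: k)
    qed
  qed (use subspace_0[OF assms(1)] in \<open>auto simp: span_zero\<close>)
  moreover have "span (span {v} \<union> Y) = span (insert v Y)"
  proof
    have "span {v} \<subseteq> span (insert v Y)" "Y \<subseteq> span (insert v Y)" 
      using span_mono[of "{v}" "insert v Y"] by (auto intro: span_base)
    then show "span (span {v} \<union> Y) \<subseteq> span (insert v Y)" by (intro span_minimal) auto
    show "span (insert v Y) \<subseteq> span (span {v} \<union> Y)" by (intro span_mono) (auto intro: span_base)
  qed
  moreover have "finite (span {v})" by (intro finite_span) simp
  ultimately show ?thesis using dim_sum_Int[of "span {v}" Y] assms d1 by simp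
qed

text \<open>Double counting of pairs \<open>(X, v)\<close> with \<open>v\<close> in
  \<open>X - H\<close>. Such a pair is determined by \<open>Y = X \<inter> H\<close>, an arbitrary
  subspace of \<open>J\<close> of dimension \<open>k\<close>, and by \<open>v\<close>, an arbitrary
  vector of \<open>K - H\<close>, because \<open>X = span (insert v Y)\<close>.\<close>

lemma card_subspaces_meeting_hyperplane:
  assumes K: "subspace K" "finite K" and H: "subspace H" "H \<subseteq> K" "dim K = Suc (dim H)"
    and J: "subspace J" "J \<subseteq> H"
  shows "real (card {X \<in> subspaces_between {0} K. dim X = Suc k \<and> X \<inter> H \<subseteq> J \<and> \<not> X \<subseteq> H}) =
    gbinom q (dim J) k * real q ^ (dim H - k)"
proof -
  let ?S = "{X \<in> subspaces_between {0} K. dim X = Suc k \<and> X \<inter> H \<subseteq> J \<and> \<not> X \<subseteq> H}"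
  let ?T = "{Y \<in> subspaces_between {0} J. dim Y = k}"
  have finH: "finite H" "finite J" using K H J finite_subset by (auto dest: finite_subset)
  have inter: "dim (X \<inter> H) = k" if X: "subspace X" "X \<subseteq> K" "dim X = Suc k" "\<not> X \<subseteq> H" for X
  proof -
    have finX: "finite X" using X K finite_subset by auto
    have sub: "span (X \<union> H) \<subseteq> K" using X H K by (intro span_minimal) auto
    have "H \<subset> span (X \<union> H)" using X by (auto intro: span_base)
    then have "dim H < dim (span (X \<union> H))" using H K sub finite_subset by (intro dim_strict_mono) auto
    moreover have "dim (span (X \<union> H)) \<le> dim K" using sub K by (intro dim_mono_finite) auto
    ultimately show ?thesis using dim_sum_Int[of X H] X H finX finH by simp
  qed
  have bij: "bij_betw (\<lambda>(X, v). (X \<inter> H, v)) (Sigma ?S (\<lambda>X. X - H)) (?T \<times> (K - H))"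
  proof (rule bij_betw_byWitness[where f' = "\<lambda>(Y, v). (span (insert v Y), v)"])
    have "span (insert v (X \<inter> H)) = X" if "X \<in> ?S" "v \<in> X - H" for X v
    proof -
      have X: "subspace X" "X \<subseteq> K" "dim X = Suc k" "\<not> X \<subseteq> H" "finite X"
        using that K finite_subset[of X K] by (auto simp: subspaces_between_def)
      show ?thesis
      proof (rule dim_eq_imp_eq)
        show "span (insert v (X \<inter> H)) \<subseteq> X" using that X by (intro span_minimal) auto
        have "dim (span (insert v (X \<inter> H))) = Suc (dim (X \<inter> H))"
          using X H that by (intro dim_span_insert subspace_inter) auto
        then show "dim X \<le> dim (span (insert v (X \<inter> H)))" using inter[OF X(1-4)] X by simp
      qed (use X in auto)
    qed
    then have "(case (case a of (X, v) \<Rightarrow> (X \<inter> H, v)) of (Y, v) \<Rightarrow> (span (insert v Y), v)) = a"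
      if "a \<in> Sigma ?S (\<lambda>X. X - H)" for a
      using that by (cases a) (simp only: prod.case mem_Sigma_iff)
    then show "\<forall>a\<in>Sigma ?S (\<lambda>X. X - H). (case (case a of (X, v) \<Rightarrow> (X \<inter> H, v)) of (Y, v) \<Rightarrow> (span (insert v Y), v)) = a"
      by (rule ballI)
    have T: "span (insert v Y) \<inter> H = Y \<and> span (insert v Y) \<in> ?S" if "Y \<in> ?T" "v \<in> K - H" for Y v
    proof -
      have Y: "subspace Y" "Y \<subseteq> J" "dim Y = k" "finite Y"
        using that finH finite_subset[of Y J] by (auto simp: subspaces_between_def)
      let ?X = "span (insert v Y)"
      have "insert v Y \<subseteq> K" using that Y J H by auto
      then have X: "subspace ?X" "?X \<subseteq> K" using K by (auto simp: span_minimal)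
      have dX: "dim ?X = Suc k" using dim_span_insert[of Y v] Y J H that by auto
      have vX: "\<not> ?X \<subseteq> H" using that span_base[of v "insert v Y"] by auto
      have "Y = ?X \<inter> H"
      proof (rule dim_eq_imp_eq)
        show "Y \<subseteq> ?X \<inter> H" using Y J by (auto intro: span_base)
        show "dim (?X \<inter> H) \<le> dim Y" using inter[OF X dX vX] Y by simp
      qed (use X Y H finH in \<open>auto intro: subspace_inter\<close>)
      then show ?thesis using X dX vX Y by (auto simp: subspaces_between_def subspace_0)
    qed
    then have "(case (case a of (Y, v) \<Rightarrow> (span (insert v Y), v)) of (X, v) \<Rightarrow> (X \<inter> H, v)) = a"
      if "a \<in> ?T \<times> (K - H)" for a
      using that by (cases a) (simp only: prod.case mem_Sigma_iff)
    then show "\<forall>a\<in>?T \<times> (K - H). (case (case a of (Y, v) \<Rightarrow> (span (insert v Y), v)) of (X, v) \<Rightarrow> (X \<inter> H, v)) = a"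
      by (rule ballI)
    show "(\<lambda>(Y, v). (span (insert v Y), v)) ` (?T \<times> (K - H)) \<subseteq> Sigma ?S (\<lambda>X. X - H)"
    proof
      fix x assume "x \<in> (\<lambda>(Y, v). (span (insert v Y), v)) ` (?T \<times> (K - H))"
      then obtain Y v where Y: "x = (span (insert v Y), v)" "Y \<in> ?T" "v \<in> K - H" by auto
      then show "x \<in> Sigma ?S (\<lambda>X. X - H)"
        using T[OF Y(2,3)] span_base[of v "insert v Y"] by blast
    qed
    show "(\<lambda>(X, v). (X \<inter> H, v)) ` Sigma ?S (\<lambda>X. X - H) \<subseteq> ?T \<times> (K - H)"
    proof
      fix x assume "x \<in> (\<lambda>(X, v). (X \<inter> H, v)) ` Sigma ?S (\<lambda>X. X - H)"
      then obtain a where a: "a \<in> Sigma ?S (\<lambda>X. X - H)" "x = (\<lambda>(X, v). (X \<inter> H, v)) a" by (elim imageE)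
      obtain X v where Xv: "a = (X, v)" by (cases a)
      have x: "x = (X \<inter> H, v)" "X \<in> ?S" "v \<in> X - H"
        using a unfolding Xv by (simp_all only: prod.case mem_Sigma_iff)
      then have X: "subspace X" "X \<subseteq> K" "dim X = Suc k" "\<not> X \<subseteq> H" "X \<inter> H \<subseteq> J"
        unfolding subspaces_between_def by blast+
      then have "X \<inter> H \<in> ?T" "v \<in> K - H"
        using inter[OF X(1-4)] subspace_inter[OF X(1) H(1)] subspace_0[of "X \<inter> H"] x(3)
        by (auto simp: subspaces_between_def)
      then show "x \<in> ?T \<times> (K - H)" using x(1) by simp
    qed
  qed
  have finS: "finite ?S" using finite_subspaces_between[OF K(2)] by simp
  have card_diff: "real (card (A - H)) = real q ^ Suc d - real q ^ d"
    if "subspace A" "finite A" "dim A = Suc d" "dim (A \<inter> H) = d" for A d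
  proof -
    have "card (A - H) = card A - card (A \<inter> H)" using that by (simp add: card_Diff_subset_Int)
    moreover have "card (A \<inter> H) \<le> card A" using that by (intro card_mono) auto
    moreover have "card A = q ^ Suc d" "card (A \<inter> H) = q ^ d"
      using that H by (auto simp: card_subspace subspace_inter)
    ultimately show ?thesis by (simp add: of_nat_diff)
  qed
  have "card (Sigma ?S (\<lambda>X. X - H)) = card (?T \<times> (K - H))" using bij by (rule bij_betw_same_card)
  moreover have "card (Sigma ?S (\<lambda>X. X - H)) = (\<Sum>X\<in>?S. card (X - H))"
  proof (intro card_SigmaI ballI finS)
    fix X assume "X \<in> ?S"
    then have "X \<subseteq> K" unfolding subspaces_between_def by blast
    then show "finite (X - H)" using K(2) finite_subset by blast
  qed
  ultimately have "(\<Sum>X\<in>?S. card (X - H)) = card ?T * card (K - H)"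
    by (simp only: card_cartesian_product)
  then have "real (\<Sum>X\<in>?S. card (X - H)) = real (card ?T * card (K - H))" by (rule arg_cong)
  then have cnt: "(\<Sum>X\<in>?S. real (card (X - H))) = real (card ?T) * real (card (K - H))"
    by (simp only: of_nat_sum of_nat_mult)
  have "real (card (X - H)) = real q ^ Suc k - real q ^ k" if "X \<in> ?S" for X
  proof -
    have X: "subspace X" "X \<subseteq> K" "dim X = Suc k" "\<not> X \<subseteq> H"
      using that unfolding subspaces_between_def by blast+
    show ?thesis by (rule card_diff[OF X(1) finite_subset[OF X(2) K(2)] X(3) inter[OF X]])
  qed
  then have "(\<Sum>X\<in>?S. real (card (X - H))) = (\<Sum>X\<in>?S. real q ^ Suc k - real q ^ k)"
    by (rule sum.cong[OF refl])
  then have s1: "(\<Sum>X\<in>?S. real (card (X - H))) = real (card ?S) * (real q ^ Suc k - real q ^ k)"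
    by (simp only: sum_constant)
  have s2: "real (card (K - H)) = real q ^ Suc (dim H) - real q ^ dim H"
    by (rule card_diff[OF K H(3)]) (simp only: Int_absorb1[OF H(2)])
  have s3: "real (card ?T) = gbinom q (dim J) k" using J finH by (intro card_subspaces)
  have "real (card ?S) * (real q ^ Suc k - real q ^ k) = gbinom q (dim J) k * (real q ^ Suc (dim H) - real q ^ dim H)"
    using cnt unfolding s1 s2 s3 .
  note this[unfolded power_Suc]
  moreover have "a * (w * t - t) = g * (w * u - u) \<Longrightarrow> a * t * (w - 1) = g * u * (w - 1)" for a g t u w :: real
    by (simp add: algebra_simps)
  ultimately have eq: "real (card ?S) * real q ^ k * (real q - 1) = gbinom q (dim J) k * real q ^ dim H * (real q - 1)"
    by blast
  have q1: "real q - 1 \<noteq> 0" "real q ^ k \<noteq> 0" using q_ge_2 by auto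
  have cancel: "a = g * b" if "a * t * w = g * (b * t) * w" "t \<noteq> 0" "w \<noteq> 0" for a b g t w :: real
    using that by simp
  show ?thesis
  proof (cases "k \<le> dim J")
    case True
    moreover have "dim J \<le> dim H" using J H finH by (intro dim_mono_finite)
    ultimately have "real q ^ dim H = real q ^ (dim H - k) * real q ^ k" by (simp add: power_add[symmetric])
    from cancel[OF eq[unfolded this] q1(2,1)] show ?thesis .
  next
    case False
    then have g: "gbinom q (dim J) k = 0" by (intro gbinom_eq_0) simp
    have "real (card ?S) * real q ^ k * (real q - 1) = 0" using eq unfolding g mult_zero_left .
    then have "real (card ?S) = 0" using q1 unfolding mult_eq_0_iff by blast
    then show ?thesis unfolding g mult_zero_left .
  qed
qed

text \<open>Two proper subspaces leave at least a quarter of \<open>V\<close> uncovered: by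
  inclusion and exclusion, \<open>N\<close> times the uncovered part is at least
  \<open>(N - card X) * (N - card Y)\<close>. Codimension 3 confines \<open>K\<close> to an eighth
  of \<open>V\<close> even for \<open>q = 2\<close>, where codimension 2 would allow a full
  quarter.\<close>

lemma exists_outside_three_subspaces:
  assumes V: "subspace V" "finite V" and X: "subspace X" "X \<subset> V" and Y: "subspace Y" "Y \<subset> V"
    and K: "subspace K" "K \<subseteq> V" "dim K + 3 \<le> dim V"
  obtains v where "v \<in> V" "v \<notin> X" "v \<notin> Y" "v \<notin> K"
proof (rule ccontr)
  assume "\<not> thesis"
  then have cover: "V \<subseteq> X \<union> Y \<union> K" using that by blast
  define N where "N = real (card V)"
  have fin: "finite X" "finite Y" "finite K" using X Y K V finite_subset by (auto dest: finite_subset)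
  have half: "2 * real (card A) \<le> N" if A: "subspace A" "A \<subset> V" for A
  proof -
    have "dim A < dim V" using A V by (intro dim_strict_mono)
    then have "real q * real q ^ dim A \<le> real q ^ dim V"
      unfolding power_Suc[symmetric] using q_ge_2 by (intro power_increasing) auto
    moreover have "2 * real q ^ dim A \<le> real q * real q ^ dim A" using q_ge_2 by (intro mult_right_mono) auto
    ultimately show ?thesis using A V finite_subset[of A V] by (simp add: N_def card_subspace)
  qed
  have k8: "8 * real (card K) \<le> N"
  proof -
    have "(2::real) ^ 3 \<le> real q ^ 3" using q_ge_2 by (intro power_mono) auto
    then have "8 * real q ^ dim K \<le> real q ^ 3 * real q ^ dim K" by (intro mult_right_mono) auto
    also have "\<dots> \<le> real q ^ dim V" unfolding power_add[symmetric] using q_ge_2 K by (intro power_increasing) auto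
    finally show ?thesis using K V fin by (simp add: N_def card_subspace)
  qed
  have N0: "N > 0" using V subspace_0[OF V(1)] by (auto simp: N_def card_gt_0_iff)
  have inter: "real (card X) * real (card Y) \<le> N * real (card (X \<inter> Y))"
  proof -
    have "dim X + dim Y = dim (span (X \<union> Y)) + dim (X \<inter> Y)" using dim_sum_Int X Y fin by simp
    also have "\<dots> \<le> dim V + dim (X \<inter> Y)"
      using X Y V by (intro add_right_mono dim_mono_finite span_minimal) auto
    finally have "real q ^ (dim X + dim Y) \<le> real q ^ (dim V + dim (X \<inter> Y))"
      using q_ge_2 by (intro power_increasing) auto
    then show ?thesis using X Y V fin by (simp add: N_def card_subspace subspace_inter power_add)
  qed
  have "card V \<le> card (X \<union> Y \<union> K)" using cover fin by (intro card_mono) auto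
  also have "\<dots> \<le> card (X \<union> Y) + card K" by (rule card_Un_le)
  finally have "N \<le> real (card X) + real (card Y) - real (card (X \<inter> Y)) + real (card K)"
    using card_Un_Int[OF fin(1,2)] unfolding N_def by linarith
  then have "N * N \<le> N * (real (card X) + real (card Y) - real (card (X \<inter> Y)) + real (card K))"
    using N0 by (intro mult_left_mono) auto
  then have 1: "N * N \<le> N * real (card X) + N * real (card Y) - real (card X) * real (card Y) + N * real (card K)"
    using inter by (simp add: algebra_simps)
  have "(N / 2) * (N / 2) \<le> (N - real (card X)) * (N - real (card Y))"
    using half[OF X] half[OF Y] N0 by (intro mult_mono) auto
  moreover have "N * real (card K) \<le> N * (N / 8)" using k8 N0 by (intro mult_left_mono) auto
  ultimately have "N * N \<le> 0" using 1 by (simp add: algebra_simps)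
  then show False using N0 by (simp add: mult_le_0_iff)
qed

lemma exists_projective_representatives:
  assumes V: "subspace V" "finite V" and D: "\<And>c v. c \<noteq> 0 \<Longrightarrow> v \<in> D \<Longrightarrow> c *s v \<in> D"
  obtains E :: "nat set" and vec where "finite E" "vec ` E \<subseteq> V - D - {0}"
    "\<And>v. v \<in> V - D \<Longrightarrow> v \<noteq> 0 \<Longrightarrow> \<exists>e\<in>E. \<exists>c. c \<noteq> 0 \<and> vec e = c *s v"
    "\<And>e f. e \<in> E \<Longrightarrow> f \<in> E \<Longrightarrow> e \<noteq> f \<Longrightarrow> vec f \<notin> span {vec e}"
proof -
  \<comment> \<open>The choice depends on the line only, so proportional vectors get the same
    representative.\<close>
  define rep where "rep v = (SOME w. w \<in> span {v} \<and> w \<noteq> 0)" for v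
  have rep: "rep v \<in> span {v}" "rep v \<noteq> 0" if "v \<noteq> 0" for v
    using someI[of "\<lambda>w. w \<in> span {v} \<and> w \<noteq> 0" v] that span_base[of v "{v}"] by (auto simp: rep_def)
  have rep_scale: "\<exists>c. c \<noteq> 0 \<and> rep v = c *s v" if "v \<noteq> 0" for v
    using rep[OF that] by (auto simp: span_singleton)
  have span_scale_eq: "span {c *s v} = span {v}" if "c \<noteq> 0" for c v
  proof
    show "span {c *s v} \<subseteq> span {v}" by (intro span_minimal) (auto intro: span_scale span_base)
    have "inverse c *s (c *s v) \<in> span {c *s v}" by (intro span_scale span_base) auto
    then show "span {v} \<subseteq> span {c *s v}" using that by (intro span_minimal) auto
  qed
  define R where "R = rep ` (V - D - {0})"
  have finR: "finite R" using V by (simp add: R_def)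
  have RV: "R \<subseteq> V - D - {0}"
  proof
    fix w assume "w \<in> R"
    then obtain v where v: "v \<in> V" "v \<notin> D" "v \<noteq> 0" "w = rep v" by (auto simp: R_def)
    then obtain c where c: "c \<noteq> 0" "w = c *s v" using rep_scale by auto
    have "w \<notin> D"
    proof
      assume "w \<in> D"
      then have "inverse c *s w \<in> D" using c by (intro D) auto
      then show False using c v by simp
    qed
    then show "w \<in> V - D - {0}" using c v V subspace_scale by auto
  qed
  obtain vec where vec: "bij_betw vec {..<card R} R" using ex_bij_betw_nat_finite[OF finR] by (auto simp: lessThan_atLeast0)
  have img: "vec ` {..<card R} = R" using vec by (simp add: bij_betw_def)
  show ?thesis
  proof (rule that[of "{..<card R}" vec])
    show "vec ` {..<card R} \<subseteq> V - D - {0}" using RV img by simp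
    fix v assume v: "v \<in> V - D" "v \<noteq> 0"
    then have "rep v \<in> R" by (auto simp: R_def)
    then have "rep v \<in> vec ` {..<card R}" by (simp only: img)
    then show "\<exists>e\<in>{..<card R}. \<exists>c. c \<noteq> 0 \<and> vec e = c *s v" using rep_scale[OF v(2)] by fastforce
  next
    fix e f assume ef: "e \<in> {..<card R}" "f \<in> {..<card R}" "e \<noteq> f"
    then have "vec e \<in> R" "vec f \<in> R" and ne: "vec e \<noteq> vec f"
      using img vec by (auto simp: bij_betw_def inj_on_def)
    then obtain v w where "vec e = rep v" "vec f = rep w" "v \<noteq> 0" "w \<noteq> 0"
      unfolding R_def by blast
    with ne have vw: "vec e = rep v" "vec f = rep w" "v \<noteq> 0" "w \<noteq> 0" "rep v \<noteq> rep w" by simp_all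
    show "vec f \<notin> span {vec e}"
    proof
      assume "vec f \<in> span {vec e}"
      then obtain k where k: "vec f = k *s vec e" by (auto simp: span_singleton)
      then have k0: "k \<noteq> 0" using vw rep(2)[of w] by auto
      obtain c d where cd: "c \<noteq> 0" "rep v = c *s v" "d \<noteq> 0" "rep w = d *s w" using rep_scale vw by metis
      have "span {v} = span {rep v}" using cd span_scale_eq by simp
      also have "\<dots> = span {rep w}" using k k0 vw span_scale_eq[of k "rep v"] by simp
      also have "\<dots> = span {w}" using cd span_scale_eq by simp
      finally have "rep v = rep w" by (simp add: rep_def)
      then show False using vw by simp
    qed
  qed simp
qed

lemma subspace_subset_Un:
  assumes "subspace X" "subspace A" "subspace B" "X \<subseteq> A \<union> B"
  shows "X \<subseteq> A \<or> X \<subseteq> B"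
proof (rule ccontr)
  assume "\<not> (X \<subseteq> A \<or> X \<subseteq> B)"
  then obtain x y where x: "x \<in> X" "x \<notin> A" and y: "y \<in> X" "y \<notin> B" by blast
  have "x + y \<in> A \<union> B" using x y assms subspace_add by blast
  then show False
  proof
    assume "x + y \<in> A"
    moreover have "y \<in> A" using y assms by blast
    ultimately have "x + y - y \<in> A" by (rule subspace_diff[OF assms(2)])
    then show False using x by simp
  next
    assume "x + y \<in> B"
    moreover have "x \<in> B" using x assms by blast
    ultimately have "x + y - x \<in> B" by (rule subspace_diff[OF assms(3)])
    then show False using y by simp
  qed
qed

end

context vector_matroid
begin

text \<open>\<open>representable\<close> speaks of the indexed family, \<open>dim\<close> of its set
  of values. Full rank forces the family to be injective, and conversely a repeated vector would
  give a relation with coefficients 1 and -1.\<close>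

lemma rank_eq_card_iff:
  assumes "X \<subseteq> E"
  shows "dim (vec ` X) = card X \<longleftrightarrow> (\<forall>c. (\<Sum>e\<in>X. c e *s vec e) = 0 \<longrightarrow> (\<forall>e\<in>X. c e = 0))"
proof -
  have fin: "finite X" by (rule finite_subset[OF assms finite_E])
  show ?thesis
  proof
    assume eq: "dim (vec ` X) = card X"
    obtain B where B: "B \<subseteq> vec ` X" "independent B" "card B = dim (vec ` X)"
      using basis_exists[of "vec ` X"] by metis
    have "card (vec ` X) \<le> card X" using fin by (rule card_image_le)
    moreover have "card B \<le> card (vec ` X)" using B fin by (intro card_mono) auto
    ultimately have card: "card (vec ` X) = card X" "card B = card (vec ` X)" using B(3) eq by auto
    have "B = vec ` X" using card_subset_eq[OF finite_imageI[OF fin] B(1) card(2)] .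
    then have ind: "independent (vec ` X)" using B(2) by simp
    have inj: "inj_on vec X" using card fin by (intro eq_card_imp_inj_on) auto
    show "\<forall>c. (\<Sum>e\<in>X. c e *s vec e) = 0 \<longrightarrow> (\<forall>e\<in>X. c e = 0)"
    proof (intro allI impI ballI)
      fix c e assume c: "(\<Sum>e\<in>X. c e *s vec e) = 0" and e: "e \<in> X"
      have "(\<Sum>v\<in>vec ` X. c (inv_into X vec v) *s v) = (\<Sum>e\<in>X. c e *s vec e)"
        using inj by (simp add: sum.reindex)
      then have "c (inv_into X vec (vec e)) = 0"
        using independentD[OF ind, of "vec ` X" "\<lambda>v. c (inv_into X vec v)" "vec e"] c e fin by auto
      then show "c e = 0" using inj e by simp
    qed
  next
    assume R: "\<forall>c. (\<Sum>e\<in>X. c e *s vec e) = 0 \<longrightarrow> (\<forall>e\<in>X. c e = 0)"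
    have inj: "inj_on vec X"
    proof (rule inj_onI, rule ccontr)
      fix e f assume ef: "e \<in> X" "f \<in> X" "vec e = vec f" "e \<noteq> f"
      let ?c = "\<lambda>x. if x = e then 1 else if x = f then - 1 else (0 :: 'k)"
      have "(\<Sum>x\<in>X. ?c x *s vec x) = (\<Sum>x\<in>{e, f}. ?c x *s vec x)"
        using ef fin by (intro sum.mono_neutral_right) auto
      also have "\<dots> = 0" using ef by simp
      finally have "?c e = 0" using R[rule_format, of ?c e] ef(1) by simp
      then show False by simp
    qed
    have "independent (vec ` X)"
    proof (rule independent_if_scalars_zero)
      fix h v assume h: "(\<Sum>x\<in>vec ` X. h x *s x) = 0" and v: "v \<in> vec ` X"
      then obtain e where e: "e \<in> X" "v = vec e" by auto
      have "(\<Sum>e\<in>X. h (vec e) *s vec e) = 0" using h inj by (simp add: sum.reindex)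
      then show "h v = 0" using R[rule_format, of "\<lambda>e. h (vec e)" e] e by simp
    qed (use fin in simp)
    then have "dim (vec ` X) = card (vec ` X)" by (rule dim_eq_card_independent)
    then show "dim (vec ` X) = card X" using inj by (simp add: card_image)
  qed
qed

end

text \<open>\<open>E\<close> represents the points of the projective space over \<open>V\<close> outside \<open>D\<close>.\<close>

locale point_arrangement = vector_matroid scale q V E vec
  for scale :: "'k::{field,finite} \<Rightarrow> 'v::ab_group_add \<Rightarrow> 'v" (infixr \<open>*s\<close> 75) and q :: nat
    and V :: "'v set" and E :: "'a set" and vec :: "'a \<Rightarrow> 'v" +
  fixes D K0 :: "'v set"
  assumes vec_avoids: "\<And>e. e \<in> E \<Longrightarrow> vec e \<notin> D"
    and vec_covers: "\<And>v. v \<in> V \<Longrightarrow> v \<notin> D \<Longrightarrow> v \<noteq> 0 \<Longrightarrow> \<exists>e\<in>E. \<exists>c. c \<noteq> 0 \<and> vec e = c *s v"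
    and vec_distinct: "\<And>e f. e \<in> E \<Longrightarrow> f \<in> E \<Longrightarrow> e \<noteq> f \<Longrightarrow> vec f \<notin> span {vec e}"
    and D_subset: "D \<subseteq> K0" and K0: "subspace K0" "K0 \<subseteq> V" "dim K0 + 3 \<le> dim V"
begin

lemma vec_scale_mem_iff:
  assumes "subspace X" "k \<noteq> 0"
  shows "k *s v \<in> X \<longleftrightarrow> v \<in> X"
proof
  assume "k *s v \<in> X"
  then have "inverse k *s (k *s v) \<in> X" by (rule subspace_scale[OF assms(1)])
  then show "v \<in> X" using assms(2) by simp
qed (rule subspace_scale[OF assms(1)])

text \<open>Deleting points inside \<open>K0\<close> does not enable two proper subspaces to cover
  the rest. With \<open>X = Y\<close> this shows that the points span \<open>V\<close>; with the
  spans of a set and of its complement it gives 3-connectedness.\<close>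

lemma covering_subspaces:
  assumes X: "subspace X" "X \<subseteq> V" and Y: "subspace Y" "Y \<subseteq> V" and cover: "vec ` E \<subseteq> X \<union> Y"
  shows "X = V \<or> Y = V"
proof (rule ccontr)
  assume "\<not> (X = V \<or> Y = V)"
  then have "X \<subset> V" "Y \<subset> V" using X Y by auto
  then obtain v where v: "v \<in> V" "v \<notin> X" "v \<notin> Y" "v \<notin> K0"
    using exists_outside_three_subspaces[OF subspace_V finite_V X(1) _ Y(1) _ K0] by metis
  then have "v \<notin> D" "v \<noteq> 0" using D_subset subspace_0[OF X(1)] by auto
  then obtain e c where "e \<in> E" "c \<noteq> 0" "vec e = c *s v" using vec_covers v(1) by blast
  then show False using cover v vec_scale_mem_iff X(1) Y(1) by (metis UnE image_subset_iff)
qed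

lemma span_vec_subset: "A \<subseteq> E \<Longrightarrow> span (vec ` A) \<subseteq> V"
  using vec_in_V subspace_V by (intro span_minimal) auto

lemma spans: "span (vec ` E) = V"
  using covering_subspaces[of "span (vec ` E)" "span (vec ` E)"] span_vec_subset[of E] span_superset[of "vec ` E"] by auto

lemma rank_singleton: "e \<in> E \<Longrightarrow> rk M {e} = 1"
  using vec_nonzero by (simp add: rk_M dim_eq_card_independent)

lemma rank_pair:
  assumes "e \<in> E" "f \<in> E" "e \<noteq> f"
  shows "rk M {e, f} = 2"
proof -
  have "independent {vec f, vec e}"
    using assms vec_distinct vec_nonzero by (intro independent_insertI) (auto simp: independent_empty)
  moreover have "vec f \<noteq> vec e" using vec_distinct[OF assms] span_base[of "vec e" "{vec e}"] by auto
  ultimately show ?thesis by (simp add: rk_M dim_eq_card_independent insert_commute)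
qed

lemma simple_M: "simple_matroid M"
  unfolding simple_matroid_def indep_def using rank_singleton rank_pair by auto

lemma rank_M: "matroid_rank M = dim V"
  using spans by (simp add: matroid_rank_def rk_flat)

lemma rank_ge:
  assumes "B \<subseteq> E" "k \<le> card B" "k \<in> {1, 2}"
  shows "k \<le> rk M B"
proof -
  consider "k = 1" | "k = 2" using assms by auto
  then show ?thesis
  proof cases
    case 1
    then obtain e where "e \<in> B" using assms by fastforce
    then show ?thesis using mat.rank_mono[of "{e}" B] rank_singleton[of e] assms 1 by auto
  next
    case 2
    then have "\<not> card B \<le> Suc 0" "finite B" using assms finite_E finite_subset by auto
    then obtain e f where ef: "e \<in> B" "f \<in> B" "e \<noteq> f" using card_le_Suc0_iff_eq[of B] by blast
    then have "rk M {e, f} = 2" using assms by (intro rank_pair) auto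
    moreover have "rk M {e, f} \<le> rk M B" using ef assms by (intro mat.rank_mono) auto
    ultimately show ?thesis using 2 by simp
  qed
qed

text \<open>One side of any partition has full rank, so the connectivity of the partition is the
  rank of the other side. That side has at least \<open>k\<close> elements and, by simplicity, rank
  at least \<open>k\<close>.\<close>

lemma three_connected_M: "three_connected M"
  unfolding three_connected_def has_separation_def
proof (intro ballI notI, elim exE conjE)
  fix k A assume k: "k \<in> {1, 2 :: nat}" and A: "A \<subseteq> ground M" "k \<le> card A" "k \<le> card (ground M - A)"
    and lt: "rk M A + rk M (ground M - A) < rk M (ground M) + k"
  have AE: "A \<subseteq> E" "E - A \<subseteq> E" using A by auto
  have "vec ` E \<subseteq> span (vec ` A) \<union> span (vec ` (E - A))" by (auto intro: span_base)
  then have "span (vec ` A) = V \<or> span (vec ` (E - A)) = V"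
    using AE by (intro covering_subspaces span_vec_subset) auto
  then have "rk M A = rk M E \<or> rk M (E - A) = rk M E"
    unfolding rk_flat spans by (elim disjE) (simp_all only: simp_thms)
  moreover have "k \<le> rk M A" "k \<le> rk M (E - A)" using rank_ge[OF _ _ k] A AE by auto
  ultimately show False using lt by auto
qed

lemma elems_empty_iff:
  assumes "X \<in> subs V" "0 \<in> D"
  shows "elems X = {} \<longleftrightarrow> X \<subseteq> D"
proof
  assume e: "elems X = {}"
  show "X \<subseteq> D"
  proof
    fix v assume v: "v \<in> X"
    show "v \<in> D"
    proof (rule ccontr)
      assume "v \<notin> D"
      then obtain e c where "e \<in> E" "c \<noteq> 0" "vec e = c *s v"
        using vec_covers[of v] v assms by (auto simp: subs_iff)
      then have "e \<in> elems X" using v assms by (auto simp: elems_def subs_iff intro: subspace_scale)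
      then show False using e by simp
    qed
  qed
next
  assume "X \<subseteq> D"
  then show "elems X = {}" using vec_avoids by (auto simp: elems_def)
qed

text \<open>A subspace inside \<open>K \<union> K1\<close> lies in one of the two. One that lies in
  \<open>K1\<close> but not in \<open>K\<close> meets the hyperplane \<open>H\<close> only inside
  \<open>K \<inter> K1\<close>, so its dimension is at most one more than that of
  \<open>K \<inter> K1\<close>.\<close>

lemma card_free_subs:
  assumes D: "D = K \<union> (K1 - H)" and K: "subspace K" "K \<subseteq> V" and K1: "subspace K1" "K1 \<subseteq> V"
    and H: "subspace H" "H \<subseteq> K1" "dim K1 = Suc (dim H)" and KK: "K \<inter> K1 \<subseteq> H"
  shows "real (card (free_subs y V)) = gbinom q (dim K) y +
    (if y = 0 then 0 else gbinom q (dim (K \<inter> K1)) (y - 1) * real q ^ (dim H - (y - 1)))"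
proof -
  let ?T = "{X \<in> subs K1. dim X = y \<and> X \<inter> H \<subseteq> K \<inter> K1 \<and> \<not> X \<subseteq> H}"
  let ?S = "{X \<in> subs K. dim X = y}"
  have fin: "finite K" "finite K1" using K K1 finite_V finite_subset by auto
  have D0: "0 \<in> D" using D K subspace_0 by auto
  have "free_subs y V = ?S \<union> ?T"
  proof (intro equalityI subsetI)
    fix X assume "X \<in> free_subs y V"
    then have X: "subspace X" "X \<subseteq> V" "dim X = y" "X \<subseteq> D"
      using elems_empty_iff[OF _ D0] by (auto simp: free_subs_def subs_iff)
    show "X \<in> ?S \<union> ?T"
    proof (cases "X \<subseteq> K")
      case True
      then show ?thesis using X by (simp add: subs_iff)
    next
      case False
      then have XK1: "X \<subseteq> K1" using subspace_subset_Un[OF X(1) K(1) K1(1)] X(4) D by blast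
      moreover have "X \<inter> H \<subseteq> K \<inter> K1" using X(4) D XK1 by blast
      moreover from this have "\<not> X \<subseteq> H" using False by blast
      ultimately show ?thesis using X by (simp add: subs_iff)
    qed
  next
    fix X assume "X \<in> ?S \<union> ?T"
    then have "X \<in> subs V \<and> X \<subseteq> D \<and> dim X = y"
    proof
      assume "X \<in> ?S"
      then show ?thesis using K D by (auto simp: subs_iff)
    next
      assume "X \<in> ?T"
      then have X: "subspace X" "X \<subseteq> K1" "X \<inter> H \<subseteq> K \<inter> K1" "dim X = y" by (simp_all add: subs_iff)
      then have "X \<subseteq> D" using D by blast
      then show ?thesis using X K1 by (auto simp: subs_iff)
    qed
    then show "X \<in> free_subs y V" using elems_empty_iff[OF _ D0, of X] by (simp add: free_subs_def)
  qed
  moreover have "?S \<inter> ?T = {}"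
  proof -
    have False if "X \<subseteq> K" "X \<subseteq> K1" "\<not> X \<subseteq> H" for X using that KK by blast
    then show ?thesis by (auto simp: subs_iff)
  qed
  moreover have "finite ?S" "finite ?T"
    using finite_subspaces_between[OF fin(1), of "{0}"] finite_subspaces_between[OF fin(2), of "{0}"] by simp_all
  ultimately have "card (free_subs y V) = card ?S + card ?T" by (simp only: card_Un_disjoint)
  moreover have "real (card ?S) = gbinom q (dim K) y" using K fin by (intro card_subspaces)
  moreover have "real (card ?T) = (if y = 0 then 0 else gbinom q (dim (K \<inter> K1)) (y - 1) * real q ^ (dim H - (y - 1)))"
  proof (cases y)
    case 0
    have "X \<subseteq> H" if "X \<in> subs K1" "dim X = 0" for X
    proof -
      have "finite X" "subspace X" using that fin finite_subset by (auto simp: subs_iff)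
      then have "X = {0}" using dim_eq_0_iff that by blast
      then show ?thesis using subspace_0[OF H(1)] by simp
    qed
    then have "?T = {}" using 0 by blast
    then show ?thesis using 0 by (simp only: card.empty) simp
  next
    case (Suc k)
    then show ?thesis
      using card_subspaces_meeting_hyperplane[OF K1(1) fin(2) H subspace_inter[OF K(1) K1(1)] KK, of k] by simp
  qed
  ultimately show ?thesis by simp
qed

end

section \<open>The arrangement in coordinates\<close>

definition fscale :: "'k::field \<Rightarrow> (nat \<Rightarrow> 'k) \<Rightarrow> nat \<Rightarrow> 'k" where
  "fscale c f = (\<lambda>x. c * f x)"

definition coord_space :: "nat set \<Rightarrow> (nat \<Rightarrow> 'k::field) set" where
  "coord_space I = {f. \<forall>x. x \<notin> I \<longrightarrow> f x = 0}"

lemma vector_space_fscale: "vector_space (fscale :: 'k::field \<Rightarrow> _)"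
  by unfold_locales (auto simp: fscale_def fun_eq_iff algebra_simps)

lemma sum_fun_apply: "(\<Sum>a\<in>A. f a) x = (\<Sum>a\<in>A. (f a x :: 'b::comm_monoid_add))"
  by (induction A rule: infinite_finite_induct) auto

lemma card_coord_space:
  assumes "finite I"
  shows "finite (coord_space I :: (nat \<Rightarrow> 'k::{field,finite}) set)"
    "card (coord_space I :: (nat \<Rightarrow> 'k) set) = card (UNIV :: 'k set) ^ card I"
proof -
  have bij: "bij_betw (\<lambda>f. restrict f I) (coord_space I :: (nat \<Rightarrow> 'k) set) (I \<rightarrow>\<^sub>E UNIV)"
    by (rule bij_betw_byWitness[where f' = "\<lambda>f x. if x \<in> I then f x else 0"])
      (auto simp: coord_space_def fun_eq_iff PiE_def extensional_def)
  moreover have fin: "finite (I \<rightarrow>\<^sub>E (UNIV :: 'k set))" using assms by (intro finite_PiE) auto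
  ultimately show "finite (coord_space I :: (nat \<Rightarrow> 'k) set)" using bij_betw_finite by blast
  show "card (coord_space I :: (nat \<Rightarrow> 'k) set) = card (UNIV :: 'k set) ^ card I"
    using bij_betw_same_card[OF bij] assms by (simp add: card_PiE)
qed

text \<open>The parameter \<open>s\<close>, the number of coordinates that the cone has of its own,
  controls the failure ratio; \<open>r\<close> then has to be large enough for the error
  estimate.\<close>

lemma exists_matroid_failing_log_concavity:
  fixes i n s r :: nat and \<delta> :: real
  assumes i: "2 \<le> i" "i < n" and s: "5 * n\<^sup>2 \<le> s" and r: "12 * n\<^sup>2 + 4 * n + 2 * s + 10 \<le> r"
    and \<delta>: "0 \<le> \<delta>" "\<delta> \<le> 1" "2 * real (card (UNIV :: 'k set)) ^ (2 * n\<^sup>2) \<le> \<delta> * real (card (UNIV :: 'k set)) ^ (s - 1)"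
  shows "\<exists>M :: nat matroid. is_matroid M \<and> simple_matroid M \<and> three_connected M \<and>
    representable TYPE('k::{field,finite}) M \<and>
    fails_log_concavity_only_at (inverse_KL_poly M) n i \<and> matroid_rank M = r \<and>
    (of_int (coeff (inverse_KL_poly M) i))\<^sup>2 /
      (of_int (coeff (inverse_KL_poly M) (i - 1)) * of_int (coeff (inverse_KL_poly M) (i + 1))) < \<delta>"
proof -
  define q where "q = card (UNIV :: 'k set)"
  interpret fs: vector_space_over_finite_field "fscale :: 'k \<Rightarrow> _" q
    by (intro vector_space_over_finite_field.intro vector_space_over_finite_field_axioms.intro
        vector_space_fscale) (simp add: q_def)
  let ?C = "coord_space :: nat set \<Rightarrow> (nat \<Rightarrow> 'k) set"
  have sub: "fs.subspace (?C I)" for I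
    by (auto simp: fs.subspace_def coord_space_def fscale_def)
  have mono: "?C I \<subseteq> ?C J" if "I \<subseteq> J" for I J using that by (auto simp: coord_space_def)
  have inter: "?C I \<inter> ?C J = ?C (I \<inter> J)" for I J by (auto simp: coord_space_def)
  have dim: "fs.dim (?C I) = card I" if "finite I" for I
  proof -
    have "q ^ fs.dim (?C I) = q ^ card I"
      using fs.card_subspace[OF sub card_coord_space(1)[OF that]] card_coord_space(2)[OF that, where 'k = 'k] by (simp add: q_def)
    then show ?thesis using fs.q_ge_2 by (simp add: power_inject_exp)
  qed
  \<comment> \<open>\<open>K1\<close> shares its first \<open>i - 2\<close> coordinates with
    \<open>K\<close> and has \<open>s\<close> further ones; the cone \<open>K1 - H\<close> consists
    of its vectors with nonzero coordinate \<open>n\<close>. Since \<open>K \<inter> K1\<close> has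
    dimension \<open>i - 2\<close>, the cone adds free subspaces of dimension at most
    \<open>i - 1\<close>, in numbers that grow with \<open>s\<close>.\<close>
  define V where "V = ?C {..<r}"
  define K where "K = ?C {..<n}"
  define K1 where "K1 = ?C ({..<i - 2} \<union> {n..<n + s})"
  define H where "H = ?C ({..<i - 2} \<union> {Suc n..<n + s})"
  define K0 where "K0 = ?C {..<n + s}"
  define D where "D = K \<union> (K1 - H)"
  have nn: "3 * n \<le> n\<^sup>2" using i by (simp add: power2_eq_square)
  have sn: "n < s" "1 \<le> s" using s nn i by linarith+
  have nsr: "n + s + 3 \<le> r" using r by simp
  have subs: "fs.subspace V" "fs.subspace K" "fs.subspace K1" "fs.subspace H" "fs.subspace K0"
    unfolding V_def K_def K1_def H_def K0_def by (rule sub)+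
  have finV: "finite V" unfolding V_def by (rule card_coord_space) simp
  have incl: "K \<subseteq> V" "K1 \<subseteq> V" "H \<subseteq> K1" "K0 \<subseteq> V" "K \<subseteq> K0" "K1 \<subseteq> K0" "K \<inter> K1 \<subseteq> H"
    unfolding V_def K_def K1_def H_def K0_def inter using i nsr by (auto intro!: mono)
  have dimV: "fs.dim V = r" and dimK: "fs.dim K = n" and dimK0: "fs.dim K0 = n + s"
    unfolding V_def K_def K0_def by (simp_all add: dim)
  have cd: "card ({..<i - 2} \<union> {m..<n + s}) = i - 2 + (n + s - m)" if "n \<le> m" for m
  proof -
    have "{..<i - 2} \<inter> {m..<n + s} = {}" using that i by auto
    then show ?thesis by (subst card_Un_disjoint) auto
  qed
  have dimH: "fs.dim H = i - 2 + (s - 1)" and dimK1: "fs.dim K1 = i - 2 + s"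
    unfolding H_def K1_def by (simp_all add: dim cd)
  have dimKK: "fs.dim (K \<inter> K1) = i - 2"
  proof -
    have "{..<n} \<inter> ({..<i - 2} \<union> {n..<n + s}) = {..<i - 2}" using i by auto
    then show ?thesis unfolding K_def K1_def inter by (simp add: dim)
  qed
  have Dscale: "fscale c v \<in> D" if "c \<noteq> 0" "v \<in> D" for c v
    using that unfolding D_def K_def K1_def H_def by (auto simp: coord_space_def fscale_def)
  obtain E :: "nat set" and vec where E: "finite E" "vec ` E \<subseteq> V - D - {0}"
    and cov: "\<And>v. v \<in> V - D \<Longrightarrow> v \<noteq> 0 \<Longrightarrow> \<exists>e\<in>E. \<exists>c. c \<noteq> 0 \<and> vec e = fscale c v"
    and dist: "\<And>e f. e \<in> E \<Longrightarrow> f \<in> E \<Longrightarrow> e \<noteq> f \<Longrightarrow> vec f \<notin> fs.span {vec e}"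
    using fs.exists_projective_representatives[OF subs(1) finV Dscale] by metis
  interpret pa: point_arrangement "fscale :: 'k \<Rightarrow> _" q V E vec D K0
  proof unfold_locales
    show "D \<subseteq> K0" using incl by (auto simp: D_def)
    show "fs.dim K0 + 3 \<le> fs.dim V" using nsr by (simp add: dimV dimK0)
  qed (use subs finV E cov dist incl in auto)
  let ?M = pa.M
  have N: "real (card (pa.free_subs y V)) = free_count q n i s y" for y
  proof -
    have "fs.dim H - (y - 1) = i - 2 + s - y" if "y \<noteq> 0" using that sn by (simp add: dimH)
    then show ?thesis
      using pa.card_free_subs[OF D_def subs(2) incl(1) subs(3) incl(2) subs(4) incl(3) _ incl(7), of y] sn
      by (simp add: dimK dimKK dimK1 dimH free_count_def)
  qed
  have q2: "real q \<ge> 2" using fs.q_ge_2 by simp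
  have q1: "real q \<ge> 1" using q2 by simp
  note fcb = free_count_bounds[OF q2 i s]
  define A where "A = real q ^ (n\<^sup>2 + n + s + 1)"
  have A1: "1 \<le> A" unfolding A_def using q1 by (rule one_le_power)
  have zero: "free_count q n i s y = 0" if "n < y" for y
    using that i by (simp add: free_count_def gbinom_eq_0)
  have NA: "real (card (pa.free_subs y V)) \<le> A" for y
    using fcb(2)[of y] zero[of y] A1 unfolding N A_def by (cases "y \<le> n") auto
  have empty: "pa.free_subs y V = {}" if "n < y" for y
    using N[of y] zero[OF that] pa.finite_free_subs[of y] by simp
  have nonempty: "pa.free_subs y V \<noteq> {}" if "y \<le> n" for y
    using N[of y] fcb(1)[OF that] by auto
  have n2r: "2 * n < fs.dim V" using r by (simp add: dimV)
  have two_pow: "real m \<le> real q ^ m" for m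
  proof -
    have "real m \<le> 2 ^ m" using less_exp[of m] by (metis less_imp_le of_nat_le_iff of_nat_numeral of_nat_power)
    also have "\<dots> \<le> real q ^ m" using q2 by (intro power_mono) auto
    finally show ?thesis .
  qed
  have pow2: "(2::real) ^ m \<le> real q ^ m" for m using q2 by (intro power_mono) auto
  have large1: "128 * A\<^sup>2 * (2 * real n + 1) * real q ^ (10 * n\<^sup>2 + n) \<le> real q ^ fs.dim V"
  proof -
    have "(128::real) \<le> real q ^ 7" using pow2[of 7] by simp
    moreover have "2 * real n + 1 \<le> real q ^ (n + 1)"
    proof -
      have "2 * real n + 1 \<le> 2 * 2 ^ n"
      proof (induction n)
        case (Suc m)
        have "1 \<le> x \<Longrightarrow> 2 * u + 1 \<le> 2 * x \<Longrightarrow> 2 * (1 + u) + 1 \<le> 2 * (2 * x)" for u x :: real by argo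
        from this[OF one_le_power Suc.IH] show ?case by simp
      qed simp
      then show ?thesis using pow2[of "n + 1"] by simp
    qed
    ultimately have "128 * A\<^sup>2 * (2 * real n + 1) * real q ^ (10 * n\<^sup>2 + n) \<le>
        real q ^ 7 * A\<^sup>2 * real q ^ (n + 1) * real q ^ (10 * n\<^sup>2 + n)"
      using q1 A1 by (intro mult_mono) auto
    \<comment> \<open>The exponents add up to \<open>12 * n\<^sup>2 + 4 * n + 2 * s + 10\<close>,
      the lower bound imposed on \<open>r\<close>.\<close>
    also have "\<dots> = real q ^ (7 + 2 * (n\<^sup>2 + n + s + 1) + (n + 1) + (10 * n\<^sup>2 + n))"
    proof -
      have "A\<^sup>2 = real q ^ (2 * (n\<^sup>2 + n + s + 1))"
        unfolding A_def power_mult[symmetric] by (simp only: mult.commute)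
      then show ?thesis by (simp only: power_add)
    qed
    also have "\<dots> \<le> real q ^ fs.dim V" using r q1 by (intro power_increasing) (simp_all add: dimV)
    finally show ?thesis .
  qed
  have large2: "64 * real n \<le> real q ^ (fs.dim V - 2 * n)"
  proof -
    have "64 * real n \<le> real q ^ 6 * real q ^ n" using pow2[of 6] two_pow[of n] by (intro mult_mono) auto
    also have "\<dots> = real q ^ (6 + n)" by (simp only: power_add)
    also have "\<dots> \<le> real q ^ (fs.dim V - 2 * n)" using r q1 by (intro power_increasing) (simp_all add: dimV)
    finally show ?thesis .
  qed
  note bounds = pa.normalized_coeff_bounds[OF pa.spans n2r _ empty NA A1 nonempty large1 large2, unfolded N]
  have Q: "2 ^ (n + 1) * A < real q ^ fs.dim V"
  proof -
    have "2 ^ (n + 1) * A \<le> real q ^ (n + 1) * A" using pow2[of "n + 1"] A1 by (intro mult_right_mono) auto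
    also have "\<dots> = real q ^ (n + 1 + (n\<^sup>2 + n + s + 1))" by (simp only: A_def power_add)
    also have "\<dots> < real q ^ fs.dim V" using r q2 by (intro power_strict_increasing) (simp_all add: dimV)
    finally show ?thesis .
  qed
  have B: "0 < real q ^ (fs.dim V choose 2)" using q2 by simp
  have i1: "1 \<le> i" using i by simp
  have \<delta>': "2 * real q ^ (2 * n\<^sup>2) \<le> \<delta> * real q ^ (s - 1)" using \<delta>(3) by (simp add: q_def)
  have c0: "coeff (inverse_KL_poly ?M) y = 0" if "n < y" for y
    by (rule pa.coeff_inverse_KL_eq_0[OF pa.spans empty[OF that]])
  have A_le: "free_count q n i s y \<le> A" if "y \<le> n" for y using fcb(2)[OF that] by (simp add: A_def)
  note fails = fails_log_concavity_only_atI[OF q2 B i1 i(2) c0 bounds(1) bounds(2) fcb(1) A_le Q fcb(3) fcb(4)[OF \<delta>' \<delta>(1)] \<delta>(2)]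
  have rep: "representable TYPE('k) ?M"
    unfolding representable_def
  proof (intro exI[of _ r] exI[of _ "\<lambda>j e. vec e j"] allI impI)
    fix X assume X: "X \<subseteq> ground ?M"
    then have XE: "X \<subseteq> E" by simp
    have "(\<Sum>e\<in>X. fscale (c e) (vec e)) = 0 \<longleftrightarrow> (\<forall>j<r. (\<Sum>e\<in>X. c e * vec e j) = 0)" for c
    proof -
      \<comment> \<open>Coordinates from \<open>r\<close> on vanish on \<open>V\<close>, so
        \<open>r\<close> rows suffice.\<close>
      have "(\<Sum>e\<in>X. c e * vec e j) = 0" if "\<not> j < r" for j
        using that XE E(2) by (intro sum.neutral) (auto simp: V_def coord_space_def)
      then show ?thesis by (auto simp: fun_eq_iff sum_fun_apply fscale_def)
    qed
    then show "indep ?M X \<longleftrightarrow> (\<forall>c. (\<forall>j<r. (\<Sum>e\<in>X. c e * vec e j) = 0) \<longrightarrow> (\<forall>e\<in>X. c e = 0))"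
      using pa.rank_eq_card_iff[OF XE] XE by (simp add: indep_def pa.rk_M)
  qed
  show ?thesis
    using pa.is_matroid_M pa.simple_M pa.three_connected_M rep fails pa.rank_M dimV by blast
qed

theorem corollary7p4:
  fixes i d :: nat
  assumes "i \<ge> 2" and "d \<ge> 1"
  shows "(\<exists>M :: nat matroid.
            is_matroid M \<and> simple_matroid M \<and> three_connected M \<and>
            representable TYPE('k::{field,finite}) M \<and>
            fails_log_concavity_only_at (inverse_KL_poly M) (i + d) i \<and>
            matroid_rank M = (i + d) + 40 * (i + d)\<^sup>2) \<and>
         (\<forall>\<epsilon>::real. \<epsilon> > 0 \<longrightarrow>
           (\<exists>M :: nat matroid.
              is_matroid M \<and> simple_matroid M \<and> three_connected M \<and>
              representable TYPE('k) M \<and>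
              fails_log_concavity_only_at (inverse_KL_poly M) (i + d) i \<and>
              (of_int (coeff (inverse_KL_poly M) i))\<^sup>2 /
                (of_int (coeff (inverse_KL_poly M) (i - 1)) *
                 of_int (coeff (inverse_KL_poly M) (i + 1))) < \<epsilon>))"
proof -
  define n where "n = i + d"
  define q where "q = real (card (UNIV :: 'k set))"
  have "card {0, 1 :: 'k} \<le> card (UNIV :: 'k set)" by (rule card_mono) auto
  then have q2: "q \<ge> 2" by (simp add: q_def)
  have i: "2 \<le> i" "i < n" using assms by (auto simp: n_def)
  have nn: "3 * n \<le> n\<^sup>2" using i by (simp add: power2_eq_square)
  \<comment> \<open>For the first claim the smallest admissible \<open>s\<close> suffices, with the
    failure ratio only required to be below 1.\<close>
  have "2 * q ^ (2 * n\<^sup>2) \<le> 1 * q ^ (5 * n\<^sup>2 - 1)"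
  proof -
    have "2 * q ^ (2 * n\<^sup>2) \<le> q * q ^ (2 * n\<^sup>2)" using q2 by (intro mult_right_mono) auto
    also have "\<dots> = q ^ Suc (2 * n\<^sup>2)" by simp
    also have "\<dots> \<le> q ^ (5 * n\<^sup>2 - 1)" using q2 nn i by (intro power_increasing) linarith+
    finally show ?thesis by simp
  qed
  \<comment> \<open>With \<open>s = 5 * n\<^sup>2\<close> the requirement on the rank is
    \<open>22 * n\<^sup>2 + 4 * n + 10\<close>.\<close>
  moreover have "12 * n\<^sup>2 + 4 * n + 2 * (5 * n\<^sup>2) + 10 \<le> n + 40 * n\<^sup>2" using nn i by linarith
  ultimately have part1: "\<exists>M :: nat matroid. is_matroid M \<and> simple_matroid M \<and> three_connected M \<and>
      representable TYPE('k) M \<and> fails_log_concavity_only_at (inverse_KL_poly M) n i \<and> matroid_rank M = n + 40 * n\<^sup>2"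
    using exists_matroid_failing_log_concavity[OF i, of "5 * n\<^sup>2" "n + 40 * n\<^sup>2" 1, where 'k = 'k] unfolding q_def by auto
  have part2: "\<exists>M :: nat matroid. is_matroid M \<and> simple_matroid M \<and> three_connected M \<and>
      representable TYPE('k) M \<and> fails_log_concavity_only_at (inverse_KL_poly M) n i \<and>
      (of_int (coeff (inverse_KL_poly M) i))\<^sup>2 /
        (of_int (coeff (inverse_KL_poly M) (i - 1)) * of_int (coeff (inverse_KL_poly M) (i + 1))) < \<epsilon>"
    if \<epsilon>: "\<epsilon> > 0" for \<epsilon> :: real
  proof -
    define \<delta> where "\<delta> = min 1 \<epsilon>"
    have \<delta>: "0 < \<delta>" "\<delta> \<le> 1" "\<delta> \<le> \<epsilon>" using \<epsilon> by (auto simp: \<delta>_def)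
    \<comment> \<open>Enlarging the cone by at least \<open>t\<close> coordinates forces the ratio
      below \<open>\<delta>\<close>. The rank is then taken equal to its lower bound, so it grows
      with \<open>s\<close> while \<open>n\<close> stays fixed.\<close>
    obtain t where t: "2 * q ^ (2 * n\<^sup>2) / \<delta> < q ^ t" using real_arch_pow[of q] q2 by auto
    define s where "s = 5 * n\<^sup>2 + t + 1"
    have "q ^ t \<le> q ^ (s - 1)" using q2 by (intro power_increasing) (auto simp: s_def)
    then have "2 * q ^ (2 * n\<^sup>2) / \<delta> \<le> q ^ (s - 1)" using t by linarith
    then have "2 * q ^ (2 * n\<^sup>2) \<le> \<delta> * q ^ (s - 1)" using \<delta> by (simp add: divide_le_eq mult.commute)
    moreover have "5 * n\<^sup>2 \<le> s" by (simp add: s_def)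
    ultimately obtain M :: "nat matroid" where "is_matroid M" "simple_matroid M" "three_connected M"
      "representable TYPE('k) M" "fails_log_concavity_only_at (inverse_KL_poly M) n i"
      "(of_int (coeff (inverse_KL_poly M) i))\<^sup>2 /
        (of_int (coeff (inverse_KL_poly M) (i - 1)) * of_int (coeff (inverse_KL_poly M) (i + 1))) < \<delta>"
      using exists_matroid_failing_log_concavity[OF i _ order_refl less_imp_le[OF \<delta>(1)] \<delta>(2), of s, where 'k = 'k]
      unfolding q_def by blast
    then show ?thesis using \<delta>(3) by (meson less_le_trans)
  qed
  show ?thesis using part1 part2 unfolding n_def by blast
qed

end
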